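(* Let $f=(f_1,\ldots,f_n)$ be an $n$-tuple of formal power series with the model property and let $(M_{Z_1},\ldots,M_{Z_n})$ be the multiplication operators on $\mathbb H^2(f)$ associated with the noncommutative domain $\mathbb B_f$. A subspace $\mathcal N\subseteq\mathbb H^2(f)\otimes\mathcal H$ is invariant under each operator $M_{Z_1}\otimes I_{\mathcal H},\ldots,M_{Z_n}\otimes I_{\mathcal H}$ if and only if there exist a Hilbert space $\mathcal E$ and an inner multi-analytic operator $\Psi:\mathbb H^2(f)\otimes\mathcal E\to\mathbb H^2(f)\otimes\mathcal H$ with respect to $M_{Z_1},\ldots,M_{Z_n}$ such that $$\mathcal N=\Psi[\mathbb H^2(f)\otimes\mathcal E].$$
   Context: Notation. $\mathbb F_n^+$ is the free semigroup on $g_1,\ldots,g_n$ with identity $g_0$ and length $|\cdot|$. For an $n$-tuple $X$ of elements of a unital algebra, $X_\alpha=X_{i_1}\cdots X_{i_k}$ if $\alpha=g_{i_1}\cdots g_{i_k}$, $X_{g_0}=I$. A tuple $X\in B(\mathcal H)^n$ is viewed as a row operator, so $\|X\|=\|\sum X_iX_i^*\|^{1/2}$; $[B(\mathcal H)^n]_\gamma=\{X:\|X\|<\gamma\}$. A free holomorphic function on $[B(\mathcal H)^n]_\gamma$ is a formal power series $\sum a_\alpha Z_\alpha$ in noncommuting indeterminates (complex coefficients) with radius of convergence $r$, $r^{-1}=\limsup_k(\sum_{|\alpha|=k}|a_\alpha|^2)^{1/2k}$, at least $\gamma$, identified with the map $X\mapsto\sum_k\sum_{|\alpha|=k}a_\alpha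 X_\alpha$ (norm convergence; $\mathcal H$ separable infinite-dimensional). $H^2_{\bf ball}$ is the Hilbert space of series with $\sum|a_\alpha|^2<\infty$ (the $Z_\alpha$ being orthonormal). Convergence sets. For an $n$-tuple $f$ of formal power series $f_j=\sum c^{(j)}_\alpha Z_\alpha$ and a Hilbert space $\mathcal H$: $\mathcal C_f^{SOT}(\mathcal H)$ is the set of $X\in B(\mathcal H)^n$ such that each series $f_j(X):=\sum_k\sum_{|\alpha|=k}c^{(j)}_\alpha X_\alpha$ is SOT-convergent; $\mathcal C_f^{rad}(\mathcal H)$ is the set of $X$ such that for some $\delta\in(0,1)$ these series converge in norm at $rX$ for all $r\in(\delta,1)$ and $f_j(X):=\text{SOT-}\lim_{r\to1}f_j(rX)$ exists for each $j$. Model property. $f=(f_1,\ldots,f_n)$ has the model property if one of the following holds. (A) $f$ is an $n$-tuple of noncommutative polynomials for which there is an $n$-tuple $g$ of noncommutative polynomials with $f\circ g=g\circ f=\mathrm{id}$. Then $\{f_\alpha\}$ is a linear basis of $\mathbb C[Z_1,\ldots,Z_n]$ and $\mathbb H^2(f)$ is the completion of $\mathbb C[Z_1,\ldots,Z_n]$ for the inner product $\langle f_\alpha,f_\beta\rangle=\delta_{\alpha\beta}$. (S) $f$ is an $n$-tuple of formal power series with $f(0)=0$, nonzero radius of convergence and $\det J_f(0)\neq0$ ($J_f(0)_{ij}$ is the coefficient of $Z_j$ in $f_i$); $\mathbb H^2(f)$ is the Hilbert space of formal power series $\sum a_\alpha f_\alpha$, $\sum|a_\alpha|^2<\infty$,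 with $\{f_\alpha\}$ orthonormal; $Z_1,\ldots,Z_n\in\mathbb H^2(f)$; left multiplication $M_{Z_i}$ by $Z_i$ is bounded on $\mathbb H^2(f)$; and $M_Z=(M_{Z_1},\ldots,M_{Z_n})$ belongs to $\mathcal C_f^{SOT}(\mathbb H^2(f))$ or $\mathcal C_f^{rad}(\mathbb H^2(f))$ with $f_j(M_Z)=M_{f_j}$ (left multiplication by $f_j$), $j=1,\ldots,n$. (F) $f$ is an $n$-tuple of free holomorphic functions on some $[B(\mathcal H)^n]_\gamma$, $\gamma>0$, with range in $[B(\mathcal H)^n]_1$, such that $G\circ f\not\equiv0$ for every nonzero free holomorphic $G$ on $[B(\mathcal H)^n]_1$; $\mathbb H^2(f)=\{G\circ f:G\in H^2_{\bf ball}\}$ with $\langle F\circ f,G\circ f\rangle=\langle F,G\rangle$; the coordinate functions $Z_1,\ldots,Z_n$ lie in $\mathbb H^2(f)$, left multiplications $M_{Z_i}$ by them are bounded on $\mathbb H^2(f)$, and $M_Z$ is in $\mathcal C_f^{SOT}(\mathbb H^2(f))$ or $\mathcal C_f^{rad}(\mathbb H^2(f))$ with $f_j(M_Z)=M_{f_j}$ for all $j$. In all cases $\{f_\alpha\}_{\alpha\in\mathbb F_n^+}$ is an orthonormal basis of $\mathbb H^2(f)$; writing $Z_i=\sum_\alpha a^{(i)}_\alpha f_\alpha$ in $\mathbb H^2(f)$, one has $M_{Z_i}f_\beta=\sum_\alpha a^{(i)}_\alpha f_{\alpha\beta}$. A bounded operator $A:\mathbb H^2(f)\otimes\mathcal E\to\mathbb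 H^2(f)\otimes\mathcal H$ is multi-analytic with respect to $M_{Z_1},\ldots,M_{Z_n}$ if $A(M_{Z_i}\otimes I_{\mathcal E})=(M_{Z_i}\otimes I_{\mathcal H})A$ for all $i$; it is inner if, in addition, it is a partial isometry. Subspaces are closed; $\mathcal H$ is an arbitrary Hilbert space. *)

theory Defs
  imports "HOL-Analysis.Analysis" "HOL-Library.Function_Algebras"
begin

section \<open>Complex Hilbert spaces\<close>

text \<open>
  A Hilbert space consists of a linear subspace (the carrier) of an ambient complex vector space
  and an inner product on that carrier, linear in the first argument.  Carriers rather than
  types are used because the spaces below depend on data (the tuple f, closed subspaces).
\<close>

record 'a hilb =
  hcarrier :: "'a set"
  hscale :: "complex \<Rightarrow> 'a \<Rightarrow> 'a"
  hip :: "'a \<Rightarrow> 'a \<Rightarrow> complex"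

definition hnorm :: "'a hilb \<Rightarrow> 'a \<Rightarrow> real" where
  "hnorm V x = sqrt (Re (hip V x x))"

definition hspan :: "('a::ab_group_add) hilb \<Rightarrow> 'a set \<Rightarrow> 'a set" where
  "hspan V = module.span (hscale V)"

locale hilbert_space = vector_space "hscale V" for V :: "('a::ab_group_add) hilb" +
  assumes carrier_subspace: "subspace (hcarrier V)"
    and ip_add: "\<lbrakk>x \<in> hcarrier V; y \<in> hcarrier V; z \<in> hcarrier V\<rbrakk>
      \<Longrightarrow> hip V (x + y) z = hip V x z + hip V y z"
    and ip_scale: "\<lbrakk>x \<in> hcarrier V; y \<in> hcarrier V\<rbrakk> \<Longrightarrow> hip V (hscale V c x) y = c * hip V x y"
    and ip_cnj: "\<lbrakk>x \<in> hcarrier V; y \<in> hcarrier V\<rbrakk> \<Longrightarrow> hip V x y = cnj (hip V y x)"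
    and ip_pos: "\<lbrakk>x \<in> hcarrier V; x \<noteq> 0\<rbrakk> \<Longrightarrow> 0 < Re (hip V x x)"
    and complete: "\<lbrakk>\<And>k. s k \<in> hcarrier V;
        \<And>e. 0 < e \<Longrightarrow> \<exists>M. \<forall>j\<ge>M. \<forall>k\<ge>M. hnorm V (s j - s k) < e\<rbrakk>
      \<Longrightarrow> \<exists>l\<in>hcarrier V. (\<lambda>k. hnorm V (s k - l)) \<longlonglongrightarrow> 0"

definition hdense :: "('a::ab_group_add) hilb \<Rightarrow> 'a set \<Rightarrow> bool" where
  "hdense V D \<longleftrightarrow> D \<subseteq> hcarrier V \<and> (\<forall>x\<in>hcarrier V. \<forall>e>0. \<exists>d\<in>D. hnorm V (x - d) < e)"

definition hseparable :: "('a::ab_group_add) hilb \<Rightarrow> bool" where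
  "hseparable V \<longleftrightarrow> (\<exists>D. countable D \<and> hdense V D)"

definition hinfinite_dim :: "('a::ab_group_add) hilb \<Rightarrow> bool" where
  "hinfinite_dim V \<longleftrightarrow> (\<forall>A. finite A \<longrightarrow> \<not> hcarrier V \<subseteq> hspan V A)"

definition closed_subspace :: "('a::ab_group_add) hilb \<Rightarrow> 'a set \<Rightarrow> bool" where
  "closed_subspace V N \<longleftrightarrow> module.subspace (hscale V) N \<and> N \<subseteq> hcarrier V \<and>
     (\<forall>s l. (\<forall>k. s k \<in> N) \<and> l \<in> hcarrier V \<and> (\<lambda>k. hnorm V (s k - l)) \<longlonglongrightarrow> 0 \<longrightarrow> l \<in> N)"


section \<open>Bounded operators\<close>

text \<open>
  Operators are functions on the ambient type that vanish off the carrier of the domain, so that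
  two operators are equal as functions iff they agree on the carrier.
\<close>

definition bdd_ops ::
    "('a::ab_group_add) hilb \<Rightarrow> ('b::ab_group_add) hilb \<Rightarrow> ('a \<Rightarrow> 'b) set" where
  "bdd_ops V W = {T.
     (\<forall>x\<in>hcarrier V. T x \<in> hcarrier W) \<and>
     (\<forall>x\<in>hcarrier V. \<forall>y\<in>hcarrier V. T (x + y) = T x + T y) \<and>
     (\<forall>c. \<forall>x\<in>hcarrier V. T (hscale V c x) = hscale W c (T x)) \<and>
     (\<exists>C. \<forall>x\<in>hcarrier V. hnorm W (T x) \<le> C * hnorm V x) \<and>
     (\<forall>x. x \<notin> hcarrier V \<longrightarrow> T x = 0)}"

definition on_carrier :: "'a hilb \<Rightarrow> ('a \<Rightarrow> 'b::zero) \<Rightarrow> 'a \<Rightarrow> 'b" where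
  "on_carrier V T = (\<lambda>x. if x \<in> hcarrier V then T x else 0)"

definition op_norm :: "'a hilb \<Rightarrow> 'b hilb \<Rightarrow> ('a \<Rightarrow> 'b) \<Rightarrow> real" where
  "op_norm V W T = Inf {C. 0 \<le> C \<and> (\<forall>x\<in>hcarrier V. hnorm W (T x) \<le> C * hnorm V x)}"

definition adj :: "('a::ab_group_add) hilb \<Rightarrow> ('a \<Rightarrow> 'a) \<Rightarrow> 'a \<Rightarrow> 'a" where
  "adj V T = (THE S. S \<in> bdd_ops V V \<and>
     (\<forall>x\<in>hcarrier V. \<forall>y\<in>hcarrier V. hip V (T x) y = hip V x (S y)))"

definition partial_isometry ::
    "('a::ab_group_add) hilb \<Rightarrow> ('b::ab_group_add) hilb \<Rightarrow> ('a \<Rightarrow> 'b) \<Rightarrow> bool" where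
  "partial_isometry V W T \<longleftrightarrow> T \<in> bdd_ops V W \<and>
     (\<forall>x\<in>hcarrier V. (\<forall>y\<in>hcarrier V. T y = 0 \<longrightarrow> hip V x y = 0) \<longrightarrow> hnorm W (T x) = hnorm V x)"

definition unitary_op ::
    "('a::ab_group_add) hilb \<Rightarrow> ('b::ab_group_add) hilb \<Rightarrow> ('a \<Rightarrow> 'b) \<Rightarrow> bool" where
  "unitary_op V W U \<longleftrightarrow> U \<in> bdd_ops V W \<and> U ` hcarrier V = hcarrier W \<and>
     (\<forall>x\<in>hcarrier V. \<forall>y\<in>hcarrier V. hip W (U x) (U y) = hip V x y)"

definition norm_tendsto ::
    "('a::ab_group_add) hilb \<Rightarrow> (nat \<Rightarrow> 'a \<Rightarrow> 'a) \<Rightarrow> ('a \<Rightarrow> 'a) \<Rightarrow> bool" where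
  "norm_tendsto V T L \<longleftrightarrow> L \<in> bdd_ops V V \<and> (\<lambda>m. op_norm V V (T m - L)) \<longlonglongrightarrow> 0"

definition sot_tendsto ::
    "('a::ab_group_add) hilb \<Rightarrow> ('t \<Rightarrow> 'a \<Rightarrow> 'a) \<Rightarrow> 't filter \<Rightarrow> ('a \<Rightarrow> 'a) \<Rightarrow> bool" where
  "sot_tendsto V T F L \<longleftrightarrow> L \<in> bdd_ops V V \<and>
     (\<forall>x\<in>hcarrier V. ((\<lambda>t. hnorm V (T t x - L x)) \<longlongrightarrow> 0) F)"


section \<open>Hilbert tensor products\<close>

text \<open>
  The pair of T and the bilinear map \<open>\<tau>\<close> is a realization of the Hilbert space tensor product of
  K and H; such a realization is unique up to a unique unitary compatible with \<open>\<tau>\<close>.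
\<close>

definition hilbert_tensor ::
    "('a::ab_group_add) hilb \<Rightarrow> ('b::ab_group_add) hilb \<Rightarrow> ('c::ab_group_add) hilb
      \<Rightarrow> ('a \<Rightarrow> 'b \<Rightarrow> 'c) \<Rightarrow> bool" where
  "hilbert_tensor K H T \<tau> \<longleftrightarrow> hilbert_space T \<and>
     (\<forall>x\<in>hcarrier K. \<forall>h\<in>hcarrier H. \<tau> x h \<in> hcarrier T) \<and>
     (\<forall>x\<in>hcarrier K. \<forall>y\<in>hcarrier K. \<forall>h\<in>hcarrier H. \<tau> (x + y) h = \<tau> x h + \<tau> y h) \<and>
     (\<forall>x\<in>hcarrier K. \<forall>h\<in>hcarrier H. \<forall>k\<in>hcarrier H. \<tau> x (h + k) = \<tau> x h + \<tau> x k) \<and>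
     (\<forall>c. \<forall>x\<in>hcarrier K. \<forall>h\<in>hcarrier H.
        \<tau> (hscale K c x) h = hscale T c (\<tau> x h) \<and> \<tau> x (hscale H c h) = hscale T c (\<tau> x h)) \<and>
     (\<forall>x\<in>hcarrier K. \<forall>y\<in>hcarrier K. \<forall>h\<in>hcarrier H. \<forall>k\<in>hcarrier H.
        hip T (\<tau> x h) (\<tau> y k) = hip K x y * hip H h k) \<and>
     hdense T (hspan T {\<tau> x h |x h. x \<in> hcarrier K \<and> h \<in> hcarrier H})"

text \<open>The operator \<open>M \<otimes> I\<close>.\<close>

definition ampliation ::
    "('a::ab_group_add) hilb \<Rightarrow> ('b::ab_group_add) hilb \<Rightarrow> ('c::ab_group_add) hilb
      \<Rightarrow> ('a \<Rightarrow> 'b \<Rightarrow> 'c) \<Rightarrow> ('a \<Rightarrow> 'a) \<Rightarrow> 'c \<Rightarrow> 'c" where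
  "ampliation K H T \<tau> M = (THE A. A \<in> bdd_ops T T \<and>
     (\<forall>x\<in>hcarrier K. \<forall>h\<in>hcarrier H. A (\<tau> x h) = \<tau> (M x) h))"


section \<open>Noncommutative formal power series\<close>

text \<open>
  Words in the free semigroup on generators indexed by the finite type 'n are lists, and a
  series is its coefficient function.  Beware that \<open>*\<close> on functions is pointwise; the product of
  series is \<open>nc_mult\<close>.
\<close>

type_synonym 'n ncseries = "'n list \<Rightarrow> complex"

definition nc_scale :: "complex \<Rightarrow> 'n ncseries \<Rightarrow> 'n ncseries" where
  "nc_scale c p = (\<lambda>w. c * p w)"

definition nc_one :: "'n ncseries" where
  "nc_one = (\<lambda>w. if w = [] then 1 else 0)"

definition nc_var :: "'n \<Rightarrow> 'n ncseries" where
  "nc_var i = (\<lambda>w. if w = [i] then 1 else 0)"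

definition nc_mult :: "'n ncseries \<Rightarrow> 'n ncseries \<Rightarrow> 'n ncseries" where
  "nc_mult p q = (\<lambda>w. \<Sum>k\<le>length w. p (take k w) * q (drop k w))"

primrec nc_word :: "('n \<Rightarrow> 'n ncseries) \<Rightarrow> 'n list \<Rightarrow> 'n ncseries" where
  "nc_word f [] = nc_one"
| "nc_word f (i # \<alpha>) = nc_mult (f i) (nc_word f \<alpha>)"

definition nc_polys :: "'n ncseries set" where
  "nc_polys = {p. finite {w. p w \<noteq> 0}}"

definition nc_subst :: "'n ncseries \<Rightarrow> ('n \<Rightarrow> 'n ncseries) \<Rightarrow> 'n ncseries" where
  "nc_subst p f = (\<lambda>w. \<Sum>\<alpha> | p \<alpha> \<noteq> 0. p \<alpha> * nc_word f \<alpha> w)"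

definition nc_radius :: "('n::finite) ncseries \<Rightarrow> ereal" where
  "nc_radius a = inverse (limsup (\<lambda>k::nat.
     ereal ((\<Sum>\<alpha> | length \<alpha> = k. (cmod (a \<alpha>))\<^sup>2) powr (1 / (2 * real k)))))"

definition free_holomorphic :: "real \<Rightarrow> ('n::finite) ncseries \<Rightarrow> bool" where
  "free_holomorphic \<gamma> a \<longleftrightarrow> ereal \<gamma> \<le> nc_radius a"

definition H2_ball :: "'n ncseries set" where
  "H2_ball = {a. (\<lambda>\<alpha>. (cmod (a \<alpha>))\<^sup>2) summable_on UNIV}"

definition H2_ball_ip :: "'n ncseries \<Rightarrow> 'n ncseries \<Rightarrow> complex" where
  "H2_ball_ip a b = infsum (\<lambda>\<alpha>. a \<alpha> * cnj (b \<alpha>)) UNIV"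


section \<open>Evaluation at operator tuples and convergence sets\<close>

primrec word_op :: "('a::ab_group_add) hilb \<Rightarrow> ('n \<Rightarrow> 'a \<Rightarrow> 'a) \<Rightarrow> 'n list \<Rightarrow> 'a \<Rightarrow> 'a" where
  "word_op V X [] = on_carrier V (\<lambda>x. x)"
| "word_op V X (i # \<alpha>) = X i \<circ> word_op V X \<alpha>"

definition nc_psum ::
    "('a::ab_group_add) hilb \<Rightarrow> ('n::finite) ncseries \<Rightarrow> ('n \<Rightarrow> 'a \<Rightarrow> 'a) \<Rightarrow> nat \<Rightarrow> 'a \<Rightarrow> 'a" where
  "nc_psum V c X m = (\<lambda>x. \<Sum>k<m. \<Sum>\<alpha> | length \<alpha> = k. hscale V (c \<alpha>) (word_op V X \<alpha> x))"

definition nc_eval ::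
    "('a::ab_group_add) hilb \<Rightarrow> ('n::finite) ncseries \<Rightarrow> ('n \<Rightarrow> 'a \<Rightarrow> 'a) \<Rightarrow> 'a \<Rightarrow> 'a" where
  "nc_eval V c X = (THE L. norm_tendsto V (nc_psum V c X) L)"

definition row_norm :: "('a::ab_group_add) hilb \<Rightarrow> ('n::finite \<Rightarrow> 'a \<Rightarrow> 'a) \<Rightarrow> real" where
  "row_norm V X = sqrt (op_norm V V (\<Sum>i\<in>UNIV. X i \<circ> adj V (X i)))"

definition op_ball :: "('a::ab_group_add) hilb \<Rightarrow> real \<Rightarrow> ('n::finite \<Rightarrow> 'a \<Rightarrow> 'a) set" where
  "op_ball V \<gamma> = {X. (\<forall>i. X i \<in> bdd_ops V V) \<and> row_norm V X < \<gamma>}"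

definition tuple_scale :: "'a hilb \<Rightarrow> real \<Rightarrow> ('n \<Rightarrow> 'a \<Rightarrow> 'a) \<Rightarrow> 'n \<Rightarrow> 'a \<Rightarrow> 'a" where
  "tuple_scale V r X = (\<lambda>i x. hscale V (of_real r) (X i x))"

definition conv_SOT ::
    "('a::ab_group_add) hilb \<Rightarrow> ('n::finite \<Rightarrow> 'n ncseries) \<Rightarrow> ('n \<Rightarrow> 'a \<Rightarrow> 'a) set" where
  "conv_SOT V f = {X. (\<forall>i. X i \<in> bdd_ops V V) \<and>
     (\<forall>j. \<exists>L. sot_tendsto V (nc_psum V (f j) X) sequentially L)}"

definition eval_SOT ::
    "('a::ab_group_add) hilb \<Rightarrow> ('n::finite) ncseries \<Rightarrow> ('n \<Rightarrow> 'a \<Rightarrow> 'a) \<Rightarrow> 'a \<Rightarrow> 'a" where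
  "eval_SOT V c X = (THE L. sot_tendsto V (nc_psum V c X) sequentially L)"

definition conv_rad ::
    "('a::ab_group_add) hilb \<Rightarrow> ('n::finite \<Rightarrow> 'n ncseries) \<Rightarrow> ('n \<Rightarrow> 'a \<Rightarrow> 'a) set" where
  "conv_rad V f = {X. (\<forall>i. X i \<in> bdd_ops V V) \<and>
     (\<exists>\<delta>. 0 < \<delta> \<and> \<delta> < 1 \<and>
        (\<forall>r. \<delta> < r \<and> r < 1 \<longrightarrow>
           (\<forall>j. \<exists>L. norm_tendsto V (nc_psum V (f j) (tuple_scale V r X)) L))) \<and>
     (\<forall>j. \<exists>L. sot_tendsto V (\<lambda>r. nc_eval V (f j) (tuple_scale V r X)) (at_left 1) L)}"

definition eval_rad ::
    "('a::ab_group_add) hilb \<Rightarrow> ('n::finite) ncseries \<Rightarrow> ('n \<Rightarrow> 'a \<Rightarrow> 'a) \<Rightarrow> 'a \<Rightarrow> 'a" where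
  "eval_rad V c X = (THE L. sot_tendsto V (\<lambda>r. nc_eval V c (tuple_scale V r X)) (at_left 1) L)"

text \<open>The tuple MZ lies in one of the two convergence sets and \<open>f\<^sub>j(MZ) = Mf\<^sub>j\<close> for all j.\<close>

definition calculus_condition ::
    "('a::ab_group_add) hilb \<Rightarrow> ('n::finite \<Rightarrow> 'n ncseries)
      \<Rightarrow> ('n \<Rightarrow> 'a \<Rightarrow> 'a) \<Rightarrow> ('n \<Rightarrow> 'a \<Rightarrow> 'a) \<Rightarrow> bool" where
  "calculus_condition V f MZ Mf \<longleftrightarrow>
     MZ \<in> conv_SOT V f \<and> (\<forall>j. eval_SOT V (f j) MZ = Mf j) \<or>
     MZ \<in> conv_rad V f \<and> (\<forall>j. eval_rad V (f j) MZ = Mf j)"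


section \<open>The model property\<close>

subsection \<open>Polynomial automorphisms\<close>

definition model_A :: "('n::finite \<Rightarrow> 'n ncseries) \<Rightarrow> bool" where
  "model_A f \<longleftrightarrow> (\<forall>i. f i \<in> nc_polys) \<and>
     (\<exists>g. (\<forall>i. g i \<in> nc_polys) \<and>
        (\<forall>i. nc_subst (f i) g = nc_var i) \<and> (\<forall>i. nc_subst (g i) f = nc_var i))"

text \<open>
  K with the embedding \<open>\<iota>\<close> of the polynomials is a completion of the polynomials for the inner
  product making the \<open>f\<^sub>\<alpha>\<close> orthonormal.
\<close>

definition H2_A :: "('n::finite \<Rightarrow> 'n ncseries) \<Rightarrow> ('k::ab_group_add) hilb
    \<Rightarrow> ('n ncseries \<Rightarrow> 'k) \<Rightarrow> bool" where
  "H2_A f K \<iota> \<longleftrightarrow> hilbert_space K \<and>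
     (\<forall>p\<in>nc_polys. \<forall>q\<in>nc_polys. \<iota> (p + q) = \<iota> p + \<iota> q) \<and>
     (\<forall>c. \<forall>p\<in>nc_polys. \<iota> (nc_scale c p) = hscale K c (\<iota> p)) \<and>
     (\<forall>\<alpha> \<beta>. hip K (\<iota> (nc_word f \<alpha>)) (\<iota> (nc_word f \<beta>)) = (if \<alpha> = \<beta> then 1 else 0)) \<and>
     hdense K (\<iota> ` nc_polys)"

subsection \<open>Formal power series\<close>

text \<open>
  The series \<open>\<Sum>\<^sub>\<alpha> a\<^sub>\<alpha> f\<^sub>\<alpha>\<close>.  When \<open>f(0) = 0\<close>, the coefficient of \<open>f\<^sub>\<alpha>\<close> at w vanishes if
  \<open>\<alpha>\<close> is longer than w, so this coefficientwise sum has only the displayed terms.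
\<close>

definition series_comb :: "('n::finite \<Rightarrow> 'n ncseries) \<Rightarrow> 'n ncseries \<Rightarrow> 'n ncseries" where
  "series_comb f a = (\<lambda>w. \<Sum>\<alpha> | length \<alpha> \<le> length w. a \<alpha> * nc_word f \<alpha> w)"

definition series_coeffs :: "('n::finite \<Rightarrow> 'n ncseries) \<Rightarrow> 'n ncseries \<Rightarrow> 'n ncseries" where
  "series_coeffs f h = (THE a. a \<in> H2_ball \<and> series_comb f a = h)"

definition H2_S :: "('n::finite \<Rightarrow> 'n ncseries) \<Rightarrow> 'n ncseries hilb" where
  "H2_S f = \<lparr> hcarrier = series_comb f ` H2_ball, hscale = nc_scale,
     hip = (\<lambda>h k. H2_ball_ip (series_coeffs f h) (series_coeffs f k)) \<rparr>"

definition MZ_S :: "('n::finite \<Rightarrow> 'n ncseries) \<Rightarrow> 'n \<Rightarrow> 'n ncseries \<Rightarrow> 'n ncseries" where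
  "MZ_S f i = on_carrier (H2_S f) (nc_mult (nc_var i))"

definition Mf_S :: "('n::finite \<Rightarrow> 'n ncseries) \<Rightarrow> 'n \<Rightarrow> 'n ncseries \<Rightarrow> 'n ncseries" where
  "Mf_S f j = on_carrier (H2_S f) (nc_mult (f j))"

definition model_S :: "('n::finite \<Rightarrow> 'n ncseries) \<Rightarrow> bool" where
  "model_S f \<longleftrightarrow> (\<forall>j. f j [] = 0) \<and> (\<forall>j. 0 < nc_radius (f j)) \<and>
     det (\<chi> i j. f i [j]) \<noteq> 0 \<and>
     (\<forall>i. nc_var i \<in> hcarrier (H2_S f)) \<and>
     (\<forall>i. MZ_S f i \<in> bdd_ops (H2_S f) (H2_S f)) \<and>
     calculus_condition (H2_S f) f (MZ_S f) (Mf_S f)"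

subsection \<open>Free holomorphic functions\<close>

text \<open>
  Elements of \<open>H\<^sup>2(f)\<close> are here maps from tuples of operators on B to operators on B, put equal
  to 0 off the ball of radius \<open>\<gamma>\<close>; the product is the composition of the values.
\<close>

type_synonym ('n, 'b) op_map = "('n \<Rightarrow> 'b \<Rightarrow> 'b) \<Rightarrow> 'b \<Rightarrow> 'b"

definition eval_map :: "('b::ab_group_add) hilb \<Rightarrow> real \<Rightarrow> ('n::finite) ncseries
    \<Rightarrow> ('n, 'b) op_map" where
  "eval_map B \<gamma> a = (\<lambda>X. if X \<in> op_ball B \<gamma> then nc_eval B a X else 0)"

definition comp_map :: "('b::ab_group_add) hilb \<Rightarrow> real \<Rightarrow> ('n::finite \<Rightarrow> 'n ncseries)
    \<Rightarrow> 'n ncseries \<Rightarrow> ('n, 'b) op_map" where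
  "comp_map B \<gamma> f G =
     (\<lambda>X. if X \<in> op_ball B \<gamma> then nc_eval B G (\<lambda>j. nc_eval B (f j) X) else 0)"

definition comp_coeffs :: "('b::ab_group_add) hilb \<Rightarrow> real \<Rightarrow> ('n::finite \<Rightarrow> 'n ncseries)
    \<Rightarrow> ('n, 'b) op_map \<Rightarrow> 'n ncseries" where
  "comp_coeffs B \<gamma> f h = (THE G. G \<in> H2_ball \<and> comp_map B \<gamma> f G = h)"

definition H2_F :: "('b::ab_group_add) hilb \<Rightarrow> real \<Rightarrow> ('n::finite \<Rightarrow> 'n ncseries)
    \<Rightarrow> ('n, 'b) op_map hilb" where
  "H2_F B \<gamma> f = \<lparr> hcarrier = comp_map B \<gamma> f ` H2_ball,
     hscale = (\<lambda>c h X x. hscale B c (h X x)),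
     hip = (\<lambda>h k. H2_ball_ip (comp_coeffs B \<gamma> f h) (comp_coeffs B \<gamma> f k)) \<rparr>"

definition left_mult :: "('b::ab_group_add) hilb \<Rightarrow> real \<Rightarrow> ('n::finite \<Rightarrow> 'n ncseries)
    \<Rightarrow> 'n ncseries \<Rightarrow> ('n, 'b) op_map \<Rightarrow> ('n, 'b) op_map" where
  "left_mult B \<gamma> f a = on_carrier (H2_F B \<gamma> f) (\<lambda>h X. eval_map B \<gamma> a X \<circ> h X)"

definition MZ_F :: "('b::ab_group_add) hilb \<Rightarrow> real \<Rightarrow> ('n::finite \<Rightarrow> 'n ncseries)
    \<Rightarrow> 'n \<Rightarrow> ('n, 'b) op_map \<Rightarrow> ('n, 'b) op_map" where
  "MZ_F B \<gamma> f i = left_mult B \<gamma> f (nc_var i)"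

definition Mf_F :: "('b::ab_group_add) hilb \<Rightarrow> real \<Rightarrow> ('n::finite \<Rightarrow> 'n ncseries)
    \<Rightarrow> 'n \<Rightarrow> ('n, 'b) op_map \<Rightarrow> ('n, 'b) op_map" where
  "Mf_F B \<gamma> f j = left_mult B \<gamma> f (f j)"

definition model_F :: "('b::ab_group_add) hilb \<Rightarrow> real \<Rightarrow> ('n::finite \<Rightarrow> 'n ncseries) \<Rightarrow> bool" where
  "model_F B \<gamma> f \<longleftrightarrow> 0 < \<gamma> \<and> (\<forall>j. free_holomorphic \<gamma> (f j)) \<and>
     (\<forall>X\<in>op_ball B \<gamma>. (\<lambda>j. nc_eval B (f j) X) \<in> op_ball B 1) \<and>
     (\<forall>G. free_holomorphic 1 G \<and> G \<noteq> 0 \<longrightarrow> comp_map B \<gamma> f G \<noteq> 0) \<and>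
     (\<forall>i. eval_map B \<gamma> (nc_var i) \<in> hcarrier (H2_F B \<gamma> f)) \<and>
     (\<forall>i. MZ_F B \<gamma> f i \<in> bdd_ops (H2_F B \<gamma> f) (H2_F B \<gamma> f)) \<and>
     calculus_condition (H2_F B \<gamma> f) f (MZ_F B \<gamma> f) (Mf_F B \<gamma> f)"

subsection \<open>The model space and its multiplication operators\<close>

text \<open>
  The tuple f has the model property, K is (a unitary copy of) \<open>H\<^sup>2(f)\<close> and MZ is the tuple of
  left multiplications by the variables, transported to K.  The unitary copies serve to treat
  the three differently constructed spaces on one type; the identity is allowed for U.
  B is the separable infinite-dimensional space on which free holomorphic functions are evaluated.
\<close>

definition unitarily_equiv ::
    "('a::ab_group_add) hilb \<Rightarrow> ('n \<Rightarrow> 'a \<Rightarrow> 'a) \<Rightarrow> ('k::ab_group_add) hilb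
      \<Rightarrow> ('n \<Rightarrow> 'k \<Rightarrow> 'k) \<Rightarrow> bool" where
  "unitarily_equiv V M K MZ \<longleftrightarrow> hilbert_space K \<and> (\<forall>i. MZ i \<in> bdd_ops K K) \<and>
     (\<exists>U. unitary_op V K U \<and> (\<forall>i. \<forall>h\<in>hcarrier V. MZ i (U h) = U (M i h)))"

definition model_space :: "('b::ab_group_add) hilb \<Rightarrow> ('n::finite \<Rightarrow> 'n ncseries)
    \<Rightarrow> ('k::ab_group_add) hilb \<Rightarrow> ('n \<Rightarrow> 'k \<Rightarrow> 'k) \<Rightarrow> bool" where
  "model_space B f K MZ \<longleftrightarrow>
     (model_A f \<and> (\<exists>\<iota>. H2_A f K \<iota> \<and> (\<forall>i. MZ i \<in> bdd_ops K K \<and>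
        (\<forall>p\<in>nc_polys. MZ i (\<iota> p) = \<iota> (nc_mult (nc_var i) p))))) \<or>
     (model_S f \<and> unitarily_equiv (H2_S f) (MZ_S f) K MZ) \<or>
     (\<exists>\<gamma>. model_F B \<gamma> f \<and> unitarily_equiv (H2_F B \<gamma> f) (MZ_F B \<gamma> f) K MZ)"


section \<open>Inner multi-analytic operators and invariant subspaces\<close>

text \<open>
  KE and KH, with the bilinear maps \<open>\<sigma>\<close> and \<open>\<tau>\<close>, stand for the tensor products of K with E and H.
\<close>

definition multi_analytic ::
    "('k::ab_group_add) hilb \<Rightarrow> ('n \<Rightarrow> 'k \<Rightarrow> 'k)
      \<Rightarrow> ('e::ab_group_add) hilb \<Rightarrow> ('s::ab_group_add) hilb \<Rightarrow> ('k \<Rightarrow> 'e \<Rightarrow> 's)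
      \<Rightarrow> ('h::ab_group_add) hilb \<Rightarrow> ('t::ab_group_add) hilb \<Rightarrow> ('k \<Rightarrow> 'h \<Rightarrow> 't)
      \<Rightarrow> ('s \<Rightarrow> 't) \<Rightarrow> bool" where
  "multi_analytic K MZ E KE \<sigma> H KH \<tau> A \<longleftrightarrow> A \<in> bdd_ops KE KH \<and>
     (\<forall>i. \<forall>x\<in>hcarrier KE.
        A (ampliation K E KE \<sigma> (MZ i) x) = ampliation K H KH \<tau> (MZ i) (A x))"

definition inner_multi_analytic ::
    "('k::ab_group_add) hilb \<Rightarrow> ('n \<Rightarrow> 'k \<Rightarrow> 'k)
      \<Rightarrow> ('e::ab_group_add) hilb \<Rightarrow> ('s::ab_group_add) hilb \<Rightarrow> ('k \<Rightarrow> 'e \<Rightarrow> 's)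
      \<Rightarrow> ('h::ab_group_add) hilb \<Rightarrow> ('t::ab_group_add) hilb \<Rightarrow> ('k \<Rightarrow> 'h \<Rightarrow> 't)
      \<Rightarrow> ('s \<Rightarrow> 't) \<Rightarrow> bool" where
  "inner_multi_analytic K MZ E KE \<sigma> H KH \<tau> A \<longleftrightarrow>
     multi_analytic K MZ E KE \<sigma> H KH \<tau> A \<and> partial_isometry KE KH A"

text \<open>E, realized together with KE, is a Hilbert space whose inner operator A has range N.\<close>

definition beurling_rep ::
    "('k::ab_group_add) hilb \<Rightarrow> ('n \<Rightarrow> 'k \<Rightarrow> 'k)
      \<Rightarrow> ('h::ab_group_add) hilb \<Rightarrow> ('t::ab_group_add) hilb \<Rightarrow> ('k \<Rightarrow> 'h \<Rightarrow> 't) \<Rightarrow> 't set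
      \<Rightarrow> ('e::ab_group_add) hilb \<Rightarrow> ('s::ab_group_add) hilb \<Rightarrow> ('k \<Rightarrow> 'e \<Rightarrow> 's)
      \<Rightarrow> ('s \<Rightarrow> 't) \<Rightarrow> bool" where
  "beurling_rep K MZ H KH \<tau> N E KE \<sigma> A \<longleftrightarrow>
     hilbert_space E \<and> hilbert_tensor K E KE \<sigma> \<and>
     inner_multi_analytic K MZ E KE \<sigma> H KH \<tau> A \<and> N = A ` hcarrier KE"

definition invariant_under_ampliations ::
    "('k::ab_group_add) hilb \<Rightarrow> ('n \<Rightarrow> 'k \<Rightarrow> 'k)
      \<Rightarrow> ('h::ab_group_add) hilb \<Rightarrow> ('t::ab_group_add) hilb \<Rightarrow> ('k \<Rightarrow> 'h \<Rightarrow> 't) \<Rightarrow> 't set \<Rightarrow> bool" where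
  "invariant_under_ampliations K MZ H KH \<tau> N \<longleftrightarrow>
     (\<forall>i. ampliation K H KH \<tau> (MZ i) ` N \<subseteq> N)"

end

theory Submission
  imports Defs
begin

text \<open>
  In each of the three models, \<open>K\<close> has an orthonormal basis \<open>e\<^sub>\<alpha>\<close> (the copies of the \<open>f\<^sub>\<alpha>\<close>), and
  the left multiplications \<open>S\<^sub>j\<close> by the \<open>f\<^sub>j\<close>, which act by \<open>S\<^sub>j e\<^sub>\<alpha> = e\<^bsub>j\<alpha>\<^esub>\<close>, are strong limits of
  polynomials in the \<open>M\<^bsub>Z\<^sub>i\<^esub>\<close>.  By the uniform boundedness principle a subspace N that is invariant
  under the \<open>M\<^bsub>Z\<^sub>i\<^esub> \<otimes> I\<close> is therefore invariant under the \<open>S\<^sub>j \<otimes> I\<close>, which are isometries with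
  orthogonal ranges.  A Wold decomposition writes N as the orthogonal sum of the
  \<open>(S\<^sub>\<alpha> \<otimes> I) E\<close>, where E is the wandering subspace, and \<open>\<Psi> (e\<^sub>\<alpha> \<otimes> y) = (S\<^sub>\<alpha> \<otimes> I) y\<close> is an isometry
  onto N.  It intertwines the \<open>M\<^bsub>Z\<^sub>i\<^esub> \<otimes> I\<close> and not only the \<open>S\<^sub>j \<otimes> I\<close>, because
  \<open>M\<^bsub>Z\<^sub>i\<^esub> e\<^sub>\<beta> = \<Sum>\<^sub>\<alpha> a\<^sub>\<alpha> e\<^bsub>\<alpha>\<beta>\<^esub>\<close> with coefficients independent of \<open>\<beta>\<close>; this is checked on matrix
  coefficients, where all sums are finite.
\<close>

section \<open>Geometry of Hilbert spaces on carriers\<close>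

text \<open>The geometry sees the three models only through \<open>creation_model\<close>, which
  keeps the basis, the shifts and the right-translation rules for the matrix of each
  \<open>MZ i\<close>. Tensor products are known only through the axioms in
  \<open>hilbert_tensor\<close>, so even the existence of \<open>M \<otimes> I\<close>, with the
  norm bound of \<open>M\<close>, has to be derived from finite sums of elementary tensors.
  Convergence on elementary tensors spreads to the whole tensor product only for a bounded sequence,
  and \<open>sot_tendsto\<close> supplies no bound. The radial calculus moreover takes limits of
  limits. This is why \<open>sot_alg\<close> is closed under sequential limits at every stage and
  why each limit is treated by itself. In the power series and free holomorphic models the space
  comes as a bare record; its Hilbert space axioms are pulled back from \<open>K\<close> along the
  given unitary. No direct sum of copies of \<open>E\<close> is built. Since \<open>\<Psi>\<close>
  is to be an isometry onto \<open>N\<close>, a copy of \<open>N\<close> itself can serve as the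
  tensor product of \<open>K\<close> and \<open>E\<close>, and the work goes into showing that it
  satisfies \<open>hilbert_tensor\<close>.\<close>

context hilbert_space
begin

lemma carrier_0 [simp]: "0 \<in> hcarrier V"
  and carrier_add [simp]: "\<And>x y. x \<in> hcarrier V \<Longrightarrow> y \<in> hcarrier V \<Longrightarrow> x + y \<in> hcarrier V"
  and carrier_diff [simp]: "\<And>x y. x \<in> hcarrier V \<Longrightarrow> y \<in> hcarrier V \<Longrightarrow> x - y \<in> hcarrier V"
  and carrier_neg [simp]: "\<And>x. x \<in> hcarrier V \<Longrightarrow> - x \<in> hcarrier V"
  and carrier_scale [simp]: "\<And>c x. x \<in> hcarrier V \<Longrightarrow> hscale V c x \<in> hcarrier V"
  and carrier_sum: "\<And>f A. (\<And>i. i \<in> A \<Longrightarrow> f i \<in> hcarrier V) \<Longrightarrow> sum f A \<in> hcarrier V"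
  using carrier_subspace
  by (auto simp: subspace_0 subspace_add subspace_diff subspace_neg subspace_scale subspace_sum)

lemma ip_zero_left [simp]: "y \<in> hcarrier V \<Longrightarrow> hip V 0 y = 0"
  using ip_add[of 0 0 y] by simp

lemma ip_zero_right [simp]: "y \<in> hcarrier V \<Longrightarrow> hip V y 0 = 0"
  using ip_cnj[of y 0] by simp

lemma ip_neg: "x \<in> hcarrier V \<Longrightarrow> y \<in> hcarrier V \<Longrightarrow> hip V (- x) y = - hip V x y"
  using ip_add[of x "-x" y] by (simp add: eq_neg_iff_add_eq_0 add.commute)

lemma ip_diff: "x \<in> hcarrier V \<Longrightarrow> y \<in> hcarrier V \<Longrightarrow> z \<in> hcarrier V
    \<Longrightarrow> hip V (x - y) z = hip V x z - hip V y z"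
  using ip_add[of x "-y" z] ip_neg by simp

lemma ip_add_right: "x \<in> hcarrier V \<Longrightarrow> y \<in> hcarrier V \<Longrightarrow> z \<in> hcarrier V
    \<Longrightarrow> hip V z (x + y) = hip V z x + hip V z y"
  by (metis carrier_add complex_cnj_add ip_add ip_cnj)

lemma ip_diff_right: "x \<in> hcarrier V \<Longrightarrow> y \<in> hcarrier V \<Longrightarrow> z \<in> hcarrier V
    \<Longrightarrow> hip V z (x - y) = hip V z x - hip V z y"
  by (metis carrier_diff complex_cnj_diff ip_diff ip_cnj)

lemma ip_scale_right: "x \<in> hcarrier V \<Longrightarrow> y \<in> hcarrier V
    \<Longrightarrow> hip V y (hscale V c x) = cnj c * hip V y x"
  by (metis carrier_scale complex_cnj_mult ip_scale ip_cnj)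

lemma ip_sum: "(\<And>i. i \<in> A \<Longrightarrow> f i \<in> hcarrier V) \<Longrightarrow> y \<in> hcarrier V
    \<Longrightarrow> hip V (sum f A) y = (\<Sum>i\<in>A. hip V (f i) y)"
  by (induction A rule: infinite_finite_induct) (auto simp: ip_add carrier_sum)

lemma ip_commute_zero: "x \<in> hcarrier V \<Longrightarrow> y \<in> hcarrier V \<Longrightarrow> hip V x y = 0 \<Longrightarrow> hip V y x = 0"
  using ip_cnj[of y x] by simp

lemma Re_ip_nonneg: "x \<in> hcarrier V \<Longrightarrow> 0 \<le> Re (hip V x x)"
  using ip_pos[of x] by (cases "x = 0") auto

lemma hnorm_nonneg [simp]: "x \<in> hcarrier V \<Longrightarrow> 0 \<le> hnorm V x"
  by (simp add: hnorm_def Re_ip_nonneg)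

lemma hnorm_zero [simp]: "hnorm V 0 = 0"
  by (simp add: hnorm_def)

lemma hnorm_eq_0_iff: "x \<in> hcarrier V \<Longrightarrow> hnorm V x = 0 \<longleftrightarrow> x = 0"
  using ip_pos[of x] by (cases "x = 0") (auto simp: hnorm_def)

lemma ip_self: "x \<in> hcarrier V \<Longrightarrow> hip V x x = of_real ((hnorm V x)\<^sup>2)"
  using ip_cnj[of x x] Re_ip_nonneg[of x] by (simp add: hnorm_def complex_eq_iff)

lemma hnorm_sq: "x \<in> hcarrier V \<Longrightarrow> (hnorm V x)\<^sup>2 = Re (hip V x x)"
  by (simp add: hnorm_def Re_ip_nonneg)

lemma ip_self_eq_0_iff: "x \<in> hcarrier V \<Longrightarrow> hip V x x = 0 \<longleftrightarrow> x = 0"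
  by (simp add: ip_self hnorm_eq_0_iff)

lemma hnorm_scale: "x \<in> hcarrier V \<Longrightarrow> hnorm V (hscale V c x) = cmod c * hnorm V x"
proof -
  assume x: "x \<in> hcarrier V"
  have "hip V (hscale V c x) (hscale V c x) = (c * cnj c) * hip V x x"
    using x by (simp add: ip_scale ip_scale_right)
  also have "\<dots> = of_real ((cmod c)\<^sup>2 * (hnorm V x)\<^sup>2)"
    by (simp only: ip_self[OF x] complex_norm_square[symmetric] of_real_mult)
  finally show ?thesis
    using x by (simp add: hnorm_def[of V "hscale V c x"] real_sqrt_mult)
qed

lemma hnorm_neg [simp]: "x \<in> hcarrier V \<Longrightarrow> hnorm V (- x) = hnorm V x"
  using hnorm_scale[of x "-1"] by simp

lemma hnorm_minus_commute: "x \<in> hcarrier V \<Longrightarrow> y \<in> hcarrier V \<Longrightarrow> hnorm V (x - y) = hnorm V (y - x)"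
  using hnorm_neg[of "x - y"] by simp

lemma hnorm_add_sq: "x \<in> hcarrier V \<Longrightarrow> y \<in> hcarrier V
    \<Longrightarrow> (hnorm V (x + y))\<^sup>2 = (hnorm V x)\<^sup>2 + (hnorm V y)\<^sup>2 + 2 * Re (hip V x y)"
  using ip_cnj[of y x] by (simp add: hnorm_sq ip_add ip_add_right)

lemma pythagoras: "x \<in> hcarrier V \<Longrightarrow> y \<in> hcarrier V \<Longrightarrow> hip V x y = 0
    \<Longrightarrow> (hnorm V (x + y))\<^sup>2 = (hnorm V x)\<^sup>2 + (hnorm V y)\<^sup>2"
  by (simp add: hnorm_add_sq)

lemma Cauchy_Schwarz: "x \<in> hcarrier V \<Longrightarrow> y \<in> hcarrier V
    \<Longrightarrow> cmod (hip V x y) \<le> hnorm V x * hnorm V y"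
proof (cases "y = 0")
  case False
  assume x: "x \<in> hcarrier V" and y: "y \<in> hcarrier V"
  have ny: "hnorm V y > 0" using False y by (simp add: hnorm_eq_0_iff order_less_le)
  \<comment> \<open>The vector \<open>p\<close> below is the projection of \<open>x\<close> on the
    line of \<open>y\<close>. Its length is \<open>cmod (hip V x y) / hnorm V y\<close>, and
    Pythagoras bounds it by the length of \<open>x\<close>.\<close>
  define c where "c = hip V x y / hip V y y"
  have yy: "hip V y y \<noteq> 0" using False y by (simp add: ip_self_eq_0_iff)
  define p where "p = hscale V c y"
  have p: "p \<in> hcarrier V" using y by (simp add: p_def)
  have "hip V (x - p) p = 0"
    using x y yy by (simp add: p_def ip_diff ip_scale ip_scale_right c_def)
  then have "(hnorm V x)\<^sup>2 = (hnorm V (x - p))\<^sup>2 + (hnorm V p)\<^sup>2"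
    using pythagoras[of "x - p" p] x p by simp
  then have "(hnorm V p)\<^sup>2 \<le> (hnorm V x)\<^sup>2" by simp
  then have "hnorm V p \<le> hnorm V x" by (rule power2_le_imp_le) (use x in simp)
  moreover have "hnorm V p = cmod (hip V x y) / hnorm V y"
    using y ny by (simp add: p_def hnorm_scale c_def norm_divide ip_self norm_mult power2_eq_square)
  ultimately show ?thesis using ny by (simp add: field_simps)
qed auto

lemma hnorm_triangle: "x \<in> hcarrier V \<Longrightarrow> y \<in> hcarrier V \<Longrightarrow> hnorm V (x + y) \<le> hnorm V x + hnorm V y"
proof (rule power2_le_imp_le)
  assume x: "x \<in> hcarrier V" and y: "y \<in> hcarrier V"
  have "Re (hip V x y) \<le> hnorm V x * hnorm V y"
    using Cauchy_Schwarz[OF x y] complex_Re_le_cmod order_trans by blast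
  then show "(hnorm V (x + y))\<^sup>2 \<le> (hnorm V x + hnorm V y)\<^sup>2"
    using x y by (simp add: hnorm_add_sq power2_sum)
qed auto

lemma hnorm_triangle_diff: "x \<in> hcarrier V \<Longrightarrow> y \<in> hcarrier V \<Longrightarrow> hnorm V (x - y) \<le> hnorm V x + hnorm V y"
  using hnorm_triangle[of x "-y"] by simp

lemma hnorm_triangle_via: "x \<in> hcarrier V \<Longrightarrow> y \<in> hcarrier V \<Longrightarrow> z \<in> hcarrier V
    \<Longrightarrow> hnorm V (x - z) \<le> hnorm V (x - y) + hnorm V (y - z)"
  using hnorm_triangle[of "x - y" "y - z"] by simp

lemma hnorm_sum_le: "(\<And>i. i \<in> A \<Longrightarrow> f i \<in> hcarrier V)
    \<Longrightarrow> hnorm V (sum f A) \<le> (\<Sum>i\<in>A. hnorm V (f i))"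
proof (induction A rule: infinite_finite_induct)
  case (insert i A)
  then show ?case
    using hnorm_triangle[of "f i" "sum f A"] by (auto simp: carrier_sum intro: order_trans)
qed auto

lemma hnorm_diff_abs: "x \<in> hcarrier V \<Longrightarrow> y \<in> hcarrier V \<Longrightarrow> \<bar>hnorm V x - hnorm V y\<bar> \<le> hnorm V (x - y)"
  using hnorm_triangle[of "x - y" y] hnorm_triangle[of "y - x" x] hnorm_minus_commute[of x y] by simp

lemma hnorm_tendsto:
  assumes "\<And>k. s k \<in> hcarrier V" "l \<in> hcarrier V" "((\<lambda>k. hnorm V (s k - l)) \<longlongrightarrow> 0) F"
  shows "((\<lambda>k. hnorm V (s k)) \<longlongrightarrow> hnorm V l) F"
proof -
  have "((\<lambda>k. hnorm V (s k) - hnorm V l) \<longlongrightarrow> 0) F"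
    by (rule Lim_null_comparison[OF _ assms(3)]) (use assms in \<open>auto simp: hnorm_diff_abs\<close>)
  then show ?thesis by (simp add: LIM_zero_iff)
qed

lemma hlim_unique:
  assumes "\<And>k. s k \<in> hcarrier V" "l \<in> hcarrier V" "l' \<in> hcarrier V"
    and "((\<lambda>k. hnorm V (s k - l)) \<longlongrightarrow> 0) F" "((\<lambda>k. hnorm V (s k - l')) \<longlongrightarrow> 0) F" "F \<noteq> bot"
  shows "l = l'"
proof -
  have "((\<lambda>k. hnorm V (l - l')) \<longlongrightarrow> 0) F"
  proof (rule Lim_null_comparison)
    show "((\<lambda>k. hnorm V (s k - l) + hnorm V (s k - l')) \<longlongrightarrow> 0) F"
      using tendsto_add[OF assms(4,5)] by simp
    show "\<forall>\<^sub>F k in F. norm (hnorm V (l - l')) \<le> hnorm V (s k - l) + hnorm V (s k - l')"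
      using assms(1-3) hnorm_triangle_via[of l "s _" l'] hnorm_minus_commute[of l "s _"] by simp
  qed
  then have "hnorm V (l - l') = 0" using assms(6) by (simp add: tendsto_const_iff)
  then show ?thesis using assms(2,3) by (simp add: hnorm_eq_0_iff)
qed

lemma closed_subspaceD:
  assumes "closed_subspace V N"
  shows "subspace N" "N \<subseteq> hcarrier V" "x \<in> N \<Longrightarrow> x \<in> hcarrier V"
    "(\<And>k. s k \<in> N) \<Longrightarrow> l \<in> hcarrier V \<Longrightarrow> (\<lambda>k. hnorm V (s k - l)) \<longlonglongrightarrow> 0 \<Longrightarrow> l \<in> N"
  using assms unfolding closed_subspace_def by blast+

text \<open>Completeness is closedness plus completeness of \<open>V\<close>. The wandering subspace
  becomes a Hilbert space over the same type in this way.\<close>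

lemma closed_subspace_restrict:
  assumes "closed_subspace V N"
  shows "hilbert_space (V\<lparr>hcarrier := N\<rparr>)"
proof -
  let ?W = "V\<lparr>hcarrier := N\<rparr>"
  note mem = closed_subspaceD(3)[OF assms]
  have nn: "hnorm ?W = hnorm V" by (simp add: fun_eq_iff hnorm_def)
  show ?thesis
  proof (intro hilbert_space.intro hilbert_space_axioms.intro)
    show "vector_space (hscale ?W)" using vector_space_axioms by simp
    show "module.subspace (hscale ?W) (hcarrier ?W)" using closed_subspaceD(1)[OF assms] by simp
  next
    fix x y assume "x \<in> hcarrier ?W" "y \<in> hcarrier ?W"
    then have "x \<in> hcarrier V" "y \<in> hcarrier V" using mem by simp_all
    then have "hip V x y = cnj (hip V y x)" by (rule ip_cnj)
    then show "hip ?W x y = cnj (hip ?W y x)" by simp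
  next
    fix s :: "nat \<Rightarrow> 'a" assume s: "\<And>k. s k \<in> hcarrier ?W"
      and c: "\<And>e. 0 < e \<Longrightarrow> \<exists>M. \<forall>j\<ge>M. \<forall>k\<ge>M. hnorm ?W (s j - s k) < e"
    have sN: "\<And>k. s k \<in> N" using s by simp
    obtain l where l: "l \<in> hcarrier V" "(\<lambda>k. hnorm V (s k - l)) \<longlonglongrightarrow> 0"
      using complete[of s] c mem[OF sN] unfolding nn by blast
    show "\<exists>l\<in>hcarrier ?W. (\<lambda>k. hnorm ?W (s k - l)) \<longlonglongrightarrow> 0"
      using closed_subspaceD(4)[OF assms sN l] l unfolding nn by auto
  qed (use mem in \<open>simp_all add: ip_add ip_scale ip_pos\<close>)
qed

end

section \<open>Projections, bounded functionals and bounded operators\<close>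

context hilbert_space
begin

lemma parallelogram: "x \<in> hcarrier V \<Longrightarrow> y \<in> hcarrier V
    \<Longrightarrow> (hnorm V (x + y))\<^sup>2 + (hnorm V (x - y))\<^sup>2 = 2 * (hnorm V x)\<^sup>2 + 2 * (hnorm V y)\<^sup>2"
  using hnorm_add_sq[of x y] hnorm_add_sq[of x "-y"] ip_diff_right[of 0 y x] by simp

theorem projection:
  assumes N: "closed_subspace V N" and x: "x \<in> hcarrier V"
  shows "\<exists>p\<in>N. \<forall>n\<in>N. hip V (x - p) n = 0"
proof -
  note sub = closed_subspaceD(1)[OF N] and mem [simp] = closed_subspaceD(3)[OF N]
  define D where "D = (\<lambda>n. hnorm V (x - n)) ` N"
  define d where "d = Inf D"
  have ne: "D \<noteq> {}" using subspace_0[OF sub] by (auto simp: D_def)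
  have bb: "bdd_below D" using x by (auto simp: D_def intro!: bdd_belowI[of _ 0])
  have d0: "0 \<le> d" unfolding d_def by (rule cInf_greatest[OF ne]) (use x in \<open>auto simp: D_def\<close>)
  have dle: "d \<le> hnorm V (x - n)" if "n \<in> N" for n
    unfolding d_def using that bb by (intro cInf_lower) (auto simp: D_def)
  have "\<exists>n\<in>N. hnorm V (x - n) < d + 1 / real (Suc k)" for k
    using cInf_lessD[OF ne, of "d + 1 / real (Suc k)"] by (auto simp: D_def d_def)
  then obtain s where s: "\<And>k. s k \<in> N" "\<And>k. hnorm V (x - s k) < d + 1 / real (Suc k)"
    by metis
  \<comment> \<open>The midpoint \<open>m\<close> of \<open>u\<close> and \<open>v\<close> lies in
    \<open>N\<close>, so its distance from \<open>x\<close> is at least \<open>d\<close>. The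
    parallelogram law for \<open>x - u\<close> and \<open>x - v\<close> then controls
    \<open>u - v\<close>, which makes a minimizing sequence Cauchy.\<close>
  have gap: "(hnorm V (u - v))\<^sup>2 \<le> 2 * (hnorm V (x - u))\<^sup>2 + 2 * (hnorm V (x - v))\<^sup>2 - 4 * d\<^sup>2"
    if uv: "u \<in> N" "v \<in> N" for u v
  proof -
    define m where "m = hscale V (1/2) (u + v)"
    have m: "m \<in> N" unfolding m_def using uv sub by (simp add: subspace_add subspace_scale)
    have mm: "hscale V 2 m = u + v" by (simp add: m_def)
    have "2 * hnorm V (x - m) = hnorm V (hscale V 2 (x - m))"
      using x m by (simp add: hnorm_scale)
    also have "hscale V 2 (x - m) = (x - u) + (x - v)"
      using mm scale_left_distrib[of 1 1 x] by (simp add: scale_right_diff_distrib)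
    finally have a: "(hnorm V ((x - u) + (x - v)))\<^sup>2 = 4 * (hnorm V (x - m))\<^sup>2"
      by (metis power_mult_distrib four_x_squared)
    have b: "u - v = (x - v) - (x - u)" by simp
    have "(hnorm V (u - v))\<^sup>2 + (hnorm V ((x - u) + (x - v)))\<^sup>2
        = 2 * (hnorm V (x - u))\<^sup>2 + 2 * (hnorm V (x - v))\<^sup>2"
      unfolding b add.commute[of "x - u"] using x uv
      by (subst add.commute, subst parallelogram) auto
    moreover have "d\<^sup>2 \<le> (hnorm V (x - m))\<^sup>2" using dle[OF m] d0 by (rule power_mono)
    ultimately show ?thesis using a by linarith
  qed
  \<comment> \<open>The square of \<open>1 / Suc k\<close> is absorbed into
    \<open>1 / Suc k\<close>; this is where the constant \<open>2 * d + 1\<close> comes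
    from.\<close>
  have sq: "(hnorm V (x - s k))\<^sup>2 \<le> d\<^sup>2 + (2 * d + 1) / real (Suc k)" for k
  proof -
    have "(hnorm V (x - s k))\<^sup>2 \<le> (d + 1 / real (Suc k))\<^sup>2"
      using s x by (intro power_mono) (auto intro: less_imp_le)
    also have "\<dots> = d\<^sup>2 + 2 * d / real (Suc k) + (1 / real (Suc k)) * (1 / real (Suc k))"
      by (simp only: power2_eq_square) (simp add: algebra_simps)
    also have "(1 / real (Suc k)) * (1 / real (Suc k)) \<le> 1 * (1 / real (Suc k))"
      by (intro mult_right_mono) auto
    finally show ?thesis by (simp add: add_divide_distrib)
  qed
  have cauchy: "\<exists>M. \<forall>j\<ge>M. \<forall>k\<ge>M. hnorm V (s j - s k) < e" if e: "0 < e" for e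
  proof -
    \<comment> \<open>From this \<open>M\<close> on, each of the two terms left by
      \<open>gap\<close> and \<open>sq\<close> is below half of \<open>e\<^sup>2\<close>.\<close>
    obtain M where M: "real M > 4 * (2 * d + 1) / e\<^sup>2" using reals_Archimedean2 by blast
    have Me: "4 * ((2 * d + 1) / real (Suc k)) < e\<^sup>2" if "k \<ge> M" for k
    proof -
      have "4 * (2 * d + 1) < real (Suc k) * e\<^sup>2"
        using M e that by (simp add: divide_less_eq) (smt (verit) mult_right_mono of_nat_mono zero_le_power2)
      then show ?thesis by (simp add: divide_less_eq mult.commute)
    qed
    show ?thesis
    proof (intro exI allI impI)
      fix j k assume jk: "M \<le> j" "M \<le> k"
      have "(hnorm V (s j - s k))\<^sup>2 \<le> 2 * ((2 * d + 1) / real (Suc j)) + 2 * ((2 * d + 1) / real (Suc k))"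
        using gap[OF s(1) s(1), of j k] sq[of j] sq[of k] by linarith
      also have "\<dots> < e\<^sup>2" using Me[OF jk(1)] Me[OF jk(2)] by linarith
      finally show "hnorm V (s j - s k) < e" using e by (simp add: power2_less_imp_less)
    qed
  qed
  obtain p where p: "p \<in> hcarrier V" "(\<lambda>k. hnorm V (s k - p)) \<longlonglongrightarrow> 0"
    using complete[of s] s(1) cauchy by auto
  have pN: "p \<in> N" using closed_subspaceD(4)[OF N, of s p] s(1) p by blast
  have "(\<lambda>k. hnorm V (x - s k)) \<longlonglongrightarrow> hnorm V (x - p)"
    by (rule hnorm_tendsto) (use x s(1) p hnorm_minus_commute[of "s _" p] in auto)
  moreover have "(\<lambda>k. d + 1 / real (Suc k)) \<longlonglongrightarrow> d"
    using tendsto_add[OF tendsto_const LIMSEQ_Suc[OF lim_1_over_n], of d] by simp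
  ultimately have "hnorm V (x - p) \<le> d"
    by (rule LIMSEQ_le) (use s(2) in \<open>auto intro: less_imp_le simp: add.commute\<close>)
  have "hip V (x - p) n = 0" if n: "n \<in> N" for n
  proof (cases "n = 0")
    case False
    \<comment> \<open>\<open>hscale V c n\<close> is the component of \<open>x - p\<close> along
      \<open>n\<close>. Moving \<open>p\<close> by it would shorten the distance to
      \<open>x\<close>, so minimality forces \<open>c = 0\<close>.\<close>
    define c where "c = hip V (x - p) n / hip V n n"
    have nn: "hip V n n \<noteq> 0" using False n by (simp add: ip_self_eq_0_iff)
    have "p + hscale V c n \<in> N" using pN n sub by (simp add: subspace_add subspace_scale)
    from dle[OF this] have "hnorm V (x - p) \<le> hnorm V (x - (p + hscale V c n))"
      using \<open>hnorm V (x - p) \<le> d\<close> by simp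
    then have le: "(hnorm V (x - p))\<^sup>2 \<le> (hnorm V (x - p - hscale V c n))\<^sup>2"
      using x pN by (intro power_mono) (auto simp: diff_diff_eq)
    have "hip V (x - p - hscale V c n) (hscale V c n) = 0"
      using x pN n nn by (simp add: ip_diff ip_scale ip_scale_right c_def)
    from pythagoras[OF _ _ this]
    have "(hnorm V (x - p))\<^sup>2 = (hnorm V (x - p - hscale V c n))\<^sup>2 + (hnorm V (hscale V c n))\<^sup>2"
      using x pN n by simp
    with le have "hnorm V (hscale V c n) = 0" by simp
    then have "c = 0" using False n by (simp add: hnorm_scale hnorm_eq_0_iff)
    then show ?thesis using nn by (simp add: c_def)
  qed (use x pN in auto)
  then show ?thesis using pN by blast
qed

end

section \<open>Bounded functionals, total sets and Riesz representation\<close>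

definition bdd_functionals :: "('a::ab_group_add) hilb \<Rightarrow> ('a \<Rightarrow> complex) set" where
  "bdd_functionals V = {\<phi>. (\<forall>x\<in>hcarrier V. \<forall>y\<in>hcarrier V. \<phi> (x + y) = \<phi> x + \<phi> y) \<and>
     (\<forall>c. \<forall>x\<in>hcarrier V. \<phi> (hscale V c x) = c * \<phi> x) \<and>
     (\<exists>M. \<forall>x\<in>hcarrier V. cmod (\<phi> x) \<le> M * hnorm V x)}"

lemma bdd_functionalsI:
  assumes "\<And>x y. x \<in> hcarrier V \<Longrightarrow> y \<in> hcarrier V \<Longrightarrow> \<phi> (x + y) = \<phi> x + \<phi> y"
    "\<And>c x. x \<in> hcarrier V \<Longrightarrow> \<phi> (hscale V c x) = c * \<phi> x"
    "\<And>x. x \<in> hcarrier V \<Longrightarrow> cmod (\<phi> x) \<le> M * hnorm V x"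
  shows "\<phi> \<in> bdd_functionals V"
  using assms unfolding bdd_functionals_def by blast

lemma bdd_functionalsD:
  assumes "\<phi> \<in> bdd_functionals V"
  shows "x \<in> hcarrier V \<Longrightarrow> y \<in> hcarrier V \<Longrightarrow> \<phi> (x + y) = \<phi> x + \<phi> y"
    "x \<in> hcarrier V \<Longrightarrow> \<phi> (hscale V c x) = c * \<phi> x"
  using assms by (auto simp: bdd_functionals_def)

text \<open>Totality is phrased through closed subspaces so that it acts as an induction principle:
  a property that cuts out a closed subspace holds everywhere once it holds on
  \<open>D\<close>.\<close>

definition htotal :: "('a::ab_group_add) hilb \<Rightarrow> 'a set \<Rightarrow> bool" where
  "htotal V D \<longleftrightarrow> D \<subseteq> hcarrier V \<and> (\<forall>N. closed_subspace V N \<longrightarrow> D \<subseteq> N \<longrightarrow> hcarrier V \<subseteq> N)"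

lemma htotalD: "htotal V D \<Longrightarrow> closed_subspace V N \<Longrightarrow> D \<subseteq> N \<Longrightarrow> x \<in> hcarrier V \<Longrightarrow> x \<in> N"
  by (auto simp: htotal_def)

context hilbert_space
begin

lemma closed_subspace_kernel:
  assumes "\<phi> \<in> bdd_functionals V"
  shows "closed_subspace V {x \<in> hcarrier V. \<phi> x = 0}"
proof -
  have add: "\<And>x y. x \<in> hcarrier V \<Longrightarrow> y \<in> hcarrier V \<Longrightarrow> \<phi> (x + y) = \<phi> x + \<phi> y"
    and sc: "\<And>c x. x \<in> hcarrier V \<Longrightarrow> \<phi> (hscale V c x) = c * \<phi> x"
    using assms by (auto simp: bdd_functionals_def)
  obtain M where M: "\<And>x. x \<in> hcarrier V \<Longrightarrow> cmod (\<phi> x) \<le> M * hnorm V x"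
    using assms unfolding bdd_functionals_def by blast
  have z: "\<phi> 0 = 0" using sc[of 0 0] by simp
  have df: "\<phi> x - \<phi> y = \<phi> (x - y)" if "x \<in> hcarrier V" "y \<in> hcarrier V" for x y
    using add[of "x - y" y] that by simp
  show ?thesis
    unfolding closed_subspace_def
  proof (intro conjI allI impI, goal_cases)
    case 1 show ?case by (rule subspaceI) (auto simp: add sc z)
  next
    case (3 s l)
    then have s: "\<And>k. s k \<in> hcarrier V" "\<And>k. \<phi> (s k) = 0" and l: "l \<in> hcarrier V"
      and lim: "(\<lambda>k. hnorm V (s k - l)) \<longlonglongrightarrow> 0" by auto
    have "(\<lambda>k. - \<phi> l) \<longlonglongrightarrow> 0"
    proof (rule Lim_null_comparison)
      show "(\<lambda>k. M * hnorm V (s k - l)) \<longlonglongrightarrow> 0" using tendsto_mult_left[OF lim, of M] by simp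
      show "\<forall>\<^sub>F k in sequentially. norm (- \<phi> l) \<le> M * hnorm V (s k - l)"
        using M[of "s _ - l"] df[OF s(1) l, symmetric] s l by simp
    qed
    then show ?case using l by (simp add: LIMSEQ_const_iff)
  qed auto
qed

text \<open>The kernel of a bounded functional is a closed subspace. Most identities below are
  paired with a fixed vector and then checked on a basis by means of this lemma.\<close>

lemma bf_zero_if_total:
  assumes "\<phi> \<in> bdd_functionals V" "htotal V D" "\<And>d. d \<in> D \<Longrightarrow> \<phi> d = 0" "x \<in> hcarrier V"
  shows "\<phi> x = 0"
  using htotalD[OF assms(2) closed_subspace_kernel[OF assms(1)] _ assms(4)] assms(2,3)
  by (auto simp: htotal_def)

lemma bf_cmult: "\<phi> \<in> bdd_functionals V \<Longrightarrow> (\<lambda>x. c * \<phi> x) \<in> bdd_functionals V"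
proof -
  assume a: "\<phi> \<in> bdd_functionals V"
  then obtain M where "\<And>x. x \<in> hcarrier V \<Longrightarrow> cmod (\<phi> x) \<le> M * hnorm V x"
    unfolding bdd_functionals_def by blast
  then have "cmod (c * \<phi> x) \<le> (cmod c * M) * hnorm V x" if "x \<in> hcarrier V" for x
    using that by (simp add: norm_mult mult.assoc mult_left_mono)
  then show ?thesis
    by (rule bdd_functionalsI[rotated 2]) (auto simp: bdd_functionalsD[OF a] algebra_simps)
qed

lemma bf_add:
  assumes "\<phi> \<in> bdd_functionals V" "\<psi> \<in> bdd_functionals V"
  shows "(\<lambda>x. \<phi> x + \<psi> x) \<in> bdd_functionals V"
proof -
  obtain M N where "\<And>x. x \<in> hcarrier V \<Longrightarrow> cmod (\<phi> x) \<le> M * hnorm V x"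
    "\<And>x. x \<in> hcarrier V \<Longrightarrow> cmod (\<psi> x) \<le> N * hnorm V x"
    using assms unfolding bdd_functionals_def by blast
  then have "cmod (\<phi> x + \<psi> x) \<le> (M + N) * hnorm V x" if "x \<in> hcarrier V" for x
    using that by (auto simp: distrib_right intro!: order_trans[OF norm_triangle_ineq] add_mono)
  then show ?thesis
    by (rule bdd_functionalsI[rotated 2])
      (auto simp: bdd_functionalsD[OF assms(1)] bdd_functionalsD[OF assms(2)] algebra_simps)
qed

lemma bf_diff:
  assumes "\<phi> \<in> bdd_functionals V" "\<psi> \<in> bdd_functionals V"
  shows "(\<lambda>x. \<phi> x - \<psi> x) \<in> bdd_functionals V"
  using bf_add[OF assms(1) bf_cmult[OF assms(2), of "-1"]] by simp

lemma bf_sum: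
  assumes "\<And>i. i \<in> A \<Longrightarrow> \<phi> i \<in> bdd_functionals V"
  shows "(\<lambda>x. \<Sum>i\<in>A. \<phi> i x) \<in> bdd_functionals V"
  using assms
proof (induction A rule: infinite_finite_induct)
  case (insert i A)
  then show ?case using bf_add[of "\<phi> i" "\<lambda>x. \<Sum>i\<in>A. \<phi> i x"] by simp
qed (auto simp: bdd_functionals_def intro: exI[of _ 0])

lemma bf_eq_if_total:
  assumes "\<phi> \<in> bdd_functionals V" "\<psi> \<in> bdd_functionals V" "htotal V D"
    "\<And>d. d \<in> D \<Longrightarrow> \<phi> d = \<psi> d" "x \<in> hcarrier V"
  shows "\<phi> x = \<psi> x"
  using bf_zero_if_total[OF bf_diff[OF assms(1,2)] assms(3) _ assms(5)] assms(4) by simp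

lemma bf_ip: "y \<in> hcarrier V \<Longrightarrow> (\<lambda>x. hip V x y) \<in> bdd_functionals V"
  using Cauchy_Schwarz[of _ y]
  by (intro bdd_functionalsI[where M = "hnorm V y"]) (simp_all add: ip_add ip_scale mult.commute)

lemma htotal_ip_zero:
  assumes "htotal V D" "x \<in> hcarrier V" "\<And>d. d \<in> D \<Longrightarrow> hip V d x = 0"
  shows "x = 0"
  using bf_zero_if_total[OF bf_ip[OF assms(2)] assms(1,3,2)] assms(2) ip_self_eq_0_iff by blast

text \<open>The residual of a projection onto a closed subspace containing \<open>D\<close> is
  orthogonal to \<open>D\<close>, hence zero.\<close>

lemma htotal_if_orthogonal_trivial:
  assumes D: "D \<subseteq> hcarrier V"
    and triv: "\<And>x. x \<in> hcarrier V \<Longrightarrow> (\<And>d. d \<in> D \<Longrightarrow> hip V x d = 0) \<Longrightarrow> x = 0"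
  shows "htotal V D"
  unfolding htotal_def
proof (intro conjI allI impI subsetI)
  fix N x assume N: "closed_subspace V N" and DN: "D \<subseteq> N" and x: "x \<in> hcarrier V"
  obtain p where p: "p \<in> N" "\<And>n. n \<in> N \<Longrightarrow> hip V (x - p) n = 0" using projection[OF N x] by blast
  have "x - p = 0" using p DN x closed_subspaceD(3)[OF N] by (intro triv) auto
  then show "x \<in> N" using p by simp
qed (use D in auto)

text \<open>The vectors approximable from \<open>span D\<close> form a closed subspace containing
  \<open>D\<close>, so totality makes it the whole carrier.\<close>

lemma hdense_if_total:
  assumes "htotal V D" shows "hdense V (span D)"
proof -
  have DC: "D \<subseteq> hcarrier V" using assms by (simp add: htotal_def)
  have sC: "span D \<subseteq> hcarrier V" using DC carrier_subspace by (rule span_minimal)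
  define N where "N = {x \<in> hcarrier V. \<forall>e>0. \<exists>d\<in>span D. hnorm V (x - d) < e}"
  have "subspace N"
  proof (rule subspaceI)
    show "0 \<in> N" by (auto simp: N_def intro!: bexI[of _ 0] span_zero)
  next
    fix x y assume xy: "x \<in> N" "y \<in> N"
    show "x + y \<in> N" unfolding N_def
    proof (safe)
      show "x + y \<in> hcarrier V" using xy by (simp add: N_def)
      fix e :: real assume "e > 0"
      then obtain a b where ab: "a \<in> span D" "b \<in> span D" "hnorm V (x - a) < e/2" "hnorm V (y - b) < e/2"
        using xy half_gt_zero[OF \<open>e > 0\<close>] unfolding N_def mem_Collect_eq by blast
      have "hnorm V ((x - a) + (y - b)) < e"
        using ab xy sC hnorm_triangle[of "x - a" "y - b"] by (force simp: N_def)
      then show "\<exists>d\<in>span D. hnorm V (x + y - d) < e"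
        using ab by (intro bexI[of _ "a + b"] span_add) (auto simp: algebra_simps)
    qed
  next
    fix c x assume x: "x \<in> N"
    show "hscale V c x \<in> N" unfolding N_def
    proof (safe)
      show "hscale V c x \<in> hcarrier V" using x by (simp add: N_def)
      fix e :: real assume "e > 0"
      \<comment> \<open>The summand 1 avoids a division by zero when \<open>c = 0\<close>.\<close>
      then have "e / (cmod c + 1) > 0" by (simp add: add_nonneg_pos)
      then obtain a where a: "a \<in> span D" "hnorm V (x - a) < e / (cmod c + 1)" using x by (auto simp: N_def)
      have aC: "a \<in> hcarrier V" "x \<in> hcarrier V" using a sC x by (auto simp: N_def)
      have "hnorm V (hscale V c x - hscale V c a) = cmod c * hnorm V (x - a)"
        using aC by (simp add: hnorm_scale flip: scale_right_diff_distrib)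
      also have "\<dots> \<le> (cmod c + 1) * hnorm V (x - a)" using aC by (intro mult_right_mono) auto
      also have "\<dots> < e" using a(2) by (simp add: pos_less_divide_eq add_nonneg_pos mult.commute)
      finally show "\<exists>d\<in>span D. hnorm V (hscale V c x - d) < e" using a(1) span_scale by blast
    qed
  qed
  moreover have "l \<in> N" if s: "\<And>k. s k \<in> N" and l: "l \<in> hcarrier V"
      and lim: "(\<lambda>k. hnorm V (s k - l)) \<longlonglongrightarrow> 0" for s l
    unfolding N_def
  proof (safe)
    fix e :: real assume e: "e > 0"
    then obtain k where k: "hnorm V (s k - l) < e/2"
      using LIMSEQ_D[OF lim, of "e/2"] by (metis abs_less_iff diff_zero half_gt_zero le_refl real_norm_def)
    obtain d where d: "d \<in> span D" "hnorm V (s k - d) < e/2" using s[of k] half_gt_zero[OF e]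
      unfolding N_def mem_Collect_eq by blast
    have "hnorm V (l - d) < e" using k d s[of k] l sC hnorm_triangle_via[of l "s k" d]
      hnorm_minus_commute[of l "s k"] by (force simp: N_def)
    then show "\<exists>d\<in>span D. hnorm V (l - d) < e" using d by blast
  qed (use l in auto)
  ultimately have cl: "closed_subspace V N" by (auto simp: closed_subspace_def N_def)
  have "D \<subseteq> N" using DC by (auto simp: N_def intro!: bexI[OF _ span_base])
  then show ?thesis using htotalD[OF assms cl] sC by (auto simp: hdense_def N_def)
qed

lemma htotal_if_hdense:
  assumes d: "hdense V (span D)"
  shows "htotal V D"
  unfolding htotal_def
proof (intro conjI allI impI subsetI)
  show "\<And>x. x \<in> D \<Longrightarrow> x \<in> hcarrier V" using d span_base by (auto simp: hdense_def)
  fix N x assume N: "closed_subspace V N" and DN: "D \<subseteq> N" and x: "x \<in> hcarrier V"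
  have sN: "span D \<subseteq> N" using DN closed_subspaceD(1)[OF N] by (rule span_minimal)
  have "\<exists>d\<in>N. hnorm V (x - d) < 1 / real (Suc k)" for k
    using d x sN by (auto simp: hdense_def) (metis subsetD of_nat_0_less_iff zero_less_Suc zero_less_divide_1_iff of_nat_Suc)
  then obtain s where s: "\<And>k. s k \<in> N" "\<And>k. hnorm V (x - s k) < 1 / real (Suc k)" by metis
  have "(\<lambda>k. hnorm V (s k - x)) \<longlonglongrightarrow> 0"
  proof (rule Lim_null_comparison[OF _ LIMSEQ_Suc[OF lim_1_over_n]])
    show "\<forall>\<^sub>F k in sequentially. norm (hnorm V (s k - x)) \<le> 1 / real (Suc k)"
      using s x closed_subspaceD(3)[OF N] hnorm_minus_commute[of x "s _"]
      by (auto intro!: always_eventually less_imp_le)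
  qed
  then show "x \<in> N" using closed_subspaceD(4)[OF N, of s x] s(1) x by blast
qed

theorem Riesz:
  assumes \<phi>: "\<phi> \<in> bdd_functionals V"
  shows "\<exists>y\<in>hcarrier V. \<forall>x\<in>hcarrier V. \<phi> x = hip V x y"
proof (cases "\<forall>x\<in>hcarrier V. \<phi> x = 0")
  case True then show ?thesis by (intro bexI[of _ 0]) auto
next
  case False
  have add: "\<And>x y. x \<in> hcarrier V \<Longrightarrow> y \<in> hcarrier V \<Longrightarrow> \<phi> (x + y) = \<phi> x + \<phi> y"
    and sc: "\<And>c x. x \<in> hcarrier V \<Longrightarrow> \<phi> (hscale V c x) = c * \<phi> x"
    using \<phi> by (auto simp: bdd_functionals_def)
  have df: "\<phi> (x - y) = \<phi> x - \<phi> y" if "x \<in> hcarrier V" "y \<in> hcarrier V" for x y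
    using add[of "x - y" y] that by simp
  from False obtain u where u: "u \<in> hcarrier V" "\<phi> u \<noteq> 0" by blast
  define N where "N = {x \<in> hcarrier V. \<phi> x = 0}"
  obtain p where p: "p \<in> N" and orth: "\<And>n. n \<in> N \<Longrightarrow> hip V (u - p) n = 0"
    using projection[OF closed_subspace_kernel[OF \<phi>] u(1)] unfolding N_def by blast
  define v where "v = u - p"
  have v: "v \<in> hcarrier V" "\<phi> v \<noteq> 0" using u p by (auto simp: v_def N_def df)
  have vv: "hip V v v \<noteq> 0" using v sc[of 0 0] by (auto simp: ip_self_eq_0_iff)
  \<comment> \<open>The scalar makes \<open>hip V v y\<close> equal to \<open>\<phi> v\<close>.
    Every \<open>x\<close> differs from a multiple of \<open>v\<close> by an element of the kernel,
    to which \<open>v\<close> is orthogonal, so agreement at \<open>v\<close> suffices.\<close>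
  define y where "y = hscale V (cnj (\<phi> v / hip V v v)) v"
  have "\<phi> x = hip V x y" if x: "x \<in> hcarrier V" for x
  proof -
    have "x - hscale V (\<phi> x / \<phi> v) v \<in> N" using x v by (simp add: N_def df sc)
    from orth[OF this] have "hip V v x = cnj (\<phi> x / \<phi> v) * hip V v v"
      using x v by (simp add: v_def[symmetric] ip_diff_right ip_scale_right)
    then have "hip V x v = (\<phi> x / \<phi> v) * hip V v v"
      using ip_cnj[OF x v(1)] ip_cnj[OF v(1) v(1)] by simp
    then show ?thesis using x v vv by (simp add: y_def ip_scale_right)
  qed
  moreover have "y \<in> hcarrier V" using v by (simp add: y_def)
  ultimately show ?thesis by blast
qed

end

section \<open>Bounded operators and their values on total sets\<close>

lemma bdd_opsD:
  assumes "T \<in> bdd_ops V W"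
  shows "x \<in> hcarrier V \<Longrightarrow> T x \<in> hcarrier W"
    "x \<in> hcarrier V \<Longrightarrow> y \<in> hcarrier V \<Longrightarrow> T (x + y) = T x + T y"
    "x \<in> hcarrier V \<Longrightarrow> T (hscale V c x) = hscale W c (T x)"
    "x \<notin> hcarrier V \<Longrightarrow> T x = 0"
  using assms by (auto simp: bdd_ops_def)

lemma bdd_opsI:
  assumes "\<And>x. x \<in> hcarrier V \<Longrightarrow> T x \<in> hcarrier W"
    "\<And>x y. x \<in> hcarrier V \<Longrightarrow> y \<in> hcarrier V \<Longrightarrow> T (x + y) = T x + T y"
    "\<And>c x. x \<in> hcarrier V \<Longrightarrow> T (hscale V c x) = hscale W c (T x)"
    "\<And>x. x \<in> hcarrier V \<Longrightarrow> hnorm W (T x) \<le> C * hnorm V x"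
    "\<And>x. x \<notin> hcarrier V \<Longrightarrow> T x = 0"
  shows "T \<in> bdd_ops V W"
  using assms unfolding bdd_ops_def by blast

locale hilbert_pair = V: hilbert_space V + W: hilbert_space W
  for V :: "('a::ab_group_add) hilb" and W :: "('b::ab_group_add) hilb"
begin

lemma bdd_ops_bound:
  assumes "T \<in> bdd_ops V W"
  obtains C where "0 \<le> C" "\<And>x. x \<in> hcarrier V \<Longrightarrow> hnorm W (T x) \<le> C * hnorm V x"
proof -
  obtain C where "\<And>x. x \<in> hcarrier V \<Longrightarrow> hnorm W (T x) \<le> C * hnorm V x"
    using assms unfolding bdd_ops_def by blast
  then have "hnorm W (T x) \<le> \<bar>C\<bar> * hnorm V x" if "x \<in> hcarrier V" for x
    using that V.hnorm_nonneg[OF that] by (smt (verit) mult_right_mono)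
  then show ?thesis using that[of "\<bar>C\<bar>"] by simp
qed

lemma ops_zero [simp]: "T \<in> bdd_ops V W \<Longrightarrow> T 0 = 0"
  using bdd_opsD(3)[of T V W 0 0] by simp

lemma ops_neg: "T \<in> bdd_ops V W \<Longrightarrow> x \<in> hcarrier V \<Longrightarrow> T (- x) = - T x"
  using bdd_opsD(3)[of T V W x "-1"] by simp

lemma ops_diff: "T \<in> bdd_ops V W \<Longrightarrow> x \<in> hcarrier V \<Longrightarrow> y \<in> hcarrier V \<Longrightarrow> T (x - y) = T x - T y"
  using bdd_opsD(2)[of T V W x "-y"] ops_neg by simp

lemma bf_ip_op:
  assumes T: "T \<in> bdd_ops V W" and y: "y \<in> hcarrier W"
  shows "(\<lambda>x. hip W (T x) y) \<in> bdd_functionals V"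
proof -
  obtain C where C: "0 \<le> C" "\<And>x. x \<in> hcarrier V \<Longrightarrow> hnorm W (T x) \<le> C * hnorm V x"
    using bdd_ops_bound[OF T] by blast
  have "cmod (hip W (T x) y) \<le> (C * hnorm W y) * hnorm V x" if x: "x \<in> hcarrier V" for x
  proof -
    have "cmod (hip W (T x) y) \<le> hnorm W (T x) * hnorm W y"
      using W.Cauchy_Schwarz bdd_opsD(1)[OF T x] y by blast
    also have "\<dots> \<le> (C * hnorm V x) * hnorm W y" using C(2)[OF x] y by (intro mult_right_mono) auto
    finally show ?thesis by (simp add: mult_ac)
  qed
  then show ?thesis
    by (rule bdd_functionalsI[rotated 2]) (use bdd_opsD[OF T] y in \<open>auto simp: W.ip_add W.ip_scale\<close>)
qed

text \<open>Members of \<open>bdd_ops\<close> vanish off the carrier, so agreement on a total set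
  gives equality as functions, which the \<open>THE\<close> in \<open>ampliation\<close>
  requires.\<close>

lemma ops_eq_if_total:
  assumes S: "S \<in> bdd_ops V W" and T: "T \<in> bdd_ops V W" and D: "htotal V D"
    and eq: "\<And>d. d \<in> D \<Longrightarrow> S d = T d"
  shows "S = T"
proof
  fix x show "S x = T x"
  proof (cases "x \<in> hcarrier V")
    case True
    have "hip W (S x) y = hip W (T x) y" if y: "y \<in> hcarrier W" for y
      by (rule V.bf_eq_if_total[OF bf_ip_op[OF S y] bf_ip_op[OF T y] D]) (use eq True in auto)
    then have "hip W (S x - T x) (S x - T x) = 0"
      using bdd_opsD(1)[OF S True] bdd_opsD(1)[OF T True] by (simp add: W.ip_diff)
    then show ?thesis using bdd_opsD(1)[OF S True] bdd_opsD(1)[OF T True]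
      by (simp add: W.ip_self_eq_0_iff)
  qed (use bdd_opsD(4)[OF S] bdd_opsD(4)[OF T] in auto)
qed

lemma ops_add:
  assumes S: "S \<in> bdd_ops V W" and T: "T \<in> bdd_ops V W"
  shows "(\<lambda>x. S x + T x) \<in> bdd_ops V W"
proof -
  obtain C where C: "\<And>x. x \<in> hcarrier V \<Longrightarrow> hnorm W (S x) \<le> C * hnorm V x"
    using bdd_ops_bound[OF S] by blast
  obtain D where D: "\<And>x. x \<in> hcarrier V \<Longrightarrow> hnorm W (T x) \<le> D * hnorm V x"
    using bdd_ops_bound[OF T] by blast
  show ?thesis
  proof (rule bdd_opsI[where C = "C + D"])
    fix x assume x: "x \<in> hcarrier V"
    show "hnorm W (S x + T x) \<le> (C + D) * hnorm V x"
      using W.hnorm_triangle[of "S x" "T x"] C[OF x] D[OF x] bdd_opsD(1)[OF S x] bdd_opsD(1)[OF T x]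
      by (simp add: distrib_right)
  qed (use bdd_opsD[OF S] bdd_opsD[OF T] in \<open>auto simp: W.scale_right_distrib\<close>)
qed

lemma ops_scale:
  assumes S: "S \<in> bdd_ops V W"
  shows "(\<lambda>x. hscale W c (S x)) \<in> bdd_ops V W"
proof -
  obtain C where C: "\<And>x. x \<in> hcarrier V \<Longrightarrow> hnorm W (S x) \<le> C * hnorm V x"
    using bdd_ops_bound[OF S] by blast
  show ?thesis
  proof (rule bdd_opsI[where C = "cmod c * C"])
    fix x assume x: "x \<in> hcarrier V"
    show "hnorm W (hscale W c (S x)) \<le> cmod c * C * hnorm V x"
      using C[OF x] bdd_opsD(1)[OF S x] by (simp add: W.hnorm_scale mult.assoc mult_left_mono)
  next
    fix d x assume x: "x \<in> hcarrier V"
    show "hscale W c (S (hscale V d x)) = hscale W d (hscale W c (S x))"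
      using bdd_opsD(3)[OF S x] by (simp add: mult.commute)
  qed (use bdd_opsD[OF S] in \<open>simp_all add: W.scale_right_distrib\<close>)
qed

lemma ops_minus: "S \<in> bdd_ops V W \<Longrightarrow> T \<in> bdd_ops V W \<Longrightarrow> S - T \<in> bdd_ops V W"
  using ops_add[OF _ ops_scale[of T "-1"], of S] by (simp add: fun_diff_def)

end

lemma ops_comp:
  assumes "hilbert_space V" "hilbert_space W" "hilbert_space X"
    and S: "S \<in> bdd_ops W X" and T: "T \<in> bdd_ops V W"
  shows "S \<circ> T \<in> bdd_ops V X"
proof -
  interpret VW: hilbert_pair V W using assms by (simp add: hilbert_pair_def)
  interpret WX: hilbert_pair W X using assms by (simp add: hilbert_pair_def)
  obtain C where C: "0 \<le> C" "\<And>x. x \<in> hcarrier W \<Longrightarrow> hnorm X (S x) \<le> C * hnorm W x"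
    using WX.bdd_ops_bound[OF S] by blast
  obtain D where D: "\<And>x. x \<in> hcarrier V \<Longrightarrow> hnorm W (T x) \<le> D * hnorm V x"
    using VW.bdd_ops_bound[OF T] by blast
  show ?thesis
  proof (rule bdd_opsI[where C = "C * D"])
    fix x assume x: "x \<in> hcarrier V"
    show "hnorm X ((S \<circ> T) x) \<le> C * D * hnorm V x"
      using C(2)[OF bdd_opsD(1)[OF T x]] mult_left_mono[OF D[OF x] C(1)] by (simp add: mult.assoc)
  qed (use bdd_opsD[OF S] bdd_opsD[OF T] WX.ops_zero[OF S] in auto)
qed

lemma (in hilbert_space) ops_id: "on_carrier V (\<lambda>x. x) \<in> bdd_ops V V"
  by (rule bdd_opsI[where C = 1]) (auto simp: on_carrier_def)

section \<open>Extension of densely defined operators, uniform boundedness\<close>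

lemma (in hilbert_space) hnorm_pos: "x \<in> hcarrier V \<Longrightarrow> x \<noteq> 0 \<Longrightarrow> 0 < hnorm V x"
  using hnorm_eq_0_iff[of x] hnorm_nonneg[of x] by linarith

text \<open>The linear hull of prescribed values is kept as a relation: before a norm bound is
  known, nothing guarantees that it is single-valued.\<close>

inductive lin_rel :: "('a::ab_group_add) hilb \<Rightarrow> ('b::ab_group_add) hilb \<Rightarrow> ('a \<times> 'b) set \<Rightarrow> 'a \<Rightarrow> 'b \<Rightarrow> bool"
  for V W P where
  zero: "lin_rel V W P 0 0"
| step: "(x, y) \<in> P \<Longrightarrow> lin_rel V W P u v \<Longrightarrow> lin_rel V W P (hscale V c x + u) (hscale W c y + v)"

context hilbert_pair
begin

lemma lin_rel_carrier:
  "lin_rel V W P u v \<Longrightarrow> P \<subseteq> hcarrier V \<times> hcarrier W \<Longrightarrow> u \<in> hcarrier V \<and> v \<in> hcarrier W"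
  by (induction rule: lin_rel.induct) auto

lemma lin_rel_add: "lin_rel V W P u v \<Longrightarrow> lin_rel V W P u' v' \<Longrightarrow> lin_rel V W P (u + u') (v + v')"
  by (induction rule: lin_rel.induct) (auto simp: add.assoc intro: lin_rel.step)

lemma lin_rel_scale: "lin_rel V W P u v \<Longrightarrow> lin_rel V W P (hscale V c u) (hscale W c v)"
proof (induction rule: lin_rel.induct)
  case (step x y u v d)
  from lin_rel.step[OF step(1,3), of "c * d"] show ?case
    by (simp add: V.scale_right_distrib W.scale_right_distrib)
qed (auto intro: lin_rel.zero)

lemma lin_rel_diff: "lin_rel V W P u v \<Longrightarrow> lin_rel V W P u' v' \<Longrightarrow> lin_rel V W P (u - u') (v - v')"
  using lin_rel_add[OF _ lin_rel_scale[of P u' v' "-1"], of u v] by simp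

lemma lin_rel_base: "(x, y) \<in> P \<Longrightarrow> lin_rel V W P x y"
  using lin_rel.step[OF _ lin_rel.zero, of x y P V W 1] by simp

lemma lin_rel_span: "u \<in> V.span (fst ` P) \<Longrightarrow> \<exists>v. lin_rel V W P u v"
proof (induction rule: V.span_induct_alt)
  case (step c x u)
  then obtain y v where "(x, y) \<in> P" "lin_rel V W P u v" by auto
  then show ?case using lin_rel.step by blast
qed (auto intro: lin_rel.zero)

text \<open>\<open>R\<close> in the proof is the closure of the linear hull of \<open>P\<close> in
  the product space. The bound passes to the closure and makes it single-valued; density of the
  domain and completeness of \<open>W\<close> make it everywhere defined.\<close>

theorem lin_rel_extension:
  assumes P: "P \<subseteq> hcarrier V \<times> hcarrier W" and total: "htotal V (fst ` P)" and C: "0 \<le> C"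
    and bound: "\<And>u v. lin_rel V W P u v \<Longrightarrow> hnorm W v \<le> C * hnorm V u"
  obtains T where "T \<in> bdd_ops V W" "\<And>x y. (x, y) \<in> P \<Longrightarrow> T x = y"
    "\<And>x. x \<in> hcarrier V \<Longrightarrow> hnorm W (T x) \<le> C * hnorm V x"
proof -
  note car = lin_rel_carrier[OF _ P]
  define R where "R x y \<longleftrightarrow> x \<in> hcarrier V \<and> y \<in> hcarrier W \<and>
    (\<forall>e>0. \<exists>u v. lin_rel V W P u v \<and> hnorm V (x - u) < e \<and> hnorm W (y - v) < e)" for x y
  have R_bound: "hnorm W y \<le> C * hnorm V x" if "R x y" for x y
  proof (rule field_le_epsilon)
    fix e :: real assume e: "0 < e"
    \<comment> \<open>The approximation error enters once through \<open>y\<close> and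
      \<open>C\<close> times through \<open>x\<close>, hence the factor
      \<open>1 + C\<close>.\<close>
    then have "e / (1 + C) > 0" using C by simp
    then obtain u v where uv: "lin_rel V W P u v" "hnorm V (x - u) < e / (1 + C)" "hnorm W (y - v) < e / (1 + C)"
      using \<open>R x y\<close> unfolding R_def by blast
    have m: "x \<in> hcarrier V" "y \<in> hcarrier W" "u \<in> hcarrier V" "v \<in> hcarrier W"
      using that car[OF uv(1)] by (auto simp: R_def)
    have "hnorm W y \<le> hnorm W (y - v) + hnorm W v" using W.hnorm_triangle[of "y - v" v] m by simp
    also have "hnorm W v \<le> C * hnorm V u" using bound uv(1) .
    also have "hnorm V u \<le> hnorm V (x - u) + hnorm V x"
      using V.hnorm_triangle[of "u - x" x] V.hnorm_minus_commute[of u x] m by simp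
    finally have "hnorm W y \<le> hnorm W (y - v) + C * (hnorm V (x - u) + hnorm V x)"
      using C by (simp add: mult_left_mono)
    also have "\<dots> \<le> e / (1 + C) + C * (e / (1 + C) + hnorm V x)"
      using uv C by (intro add_mono mult_left_mono) auto
    also have "\<dots> = C * hnorm V x + e / (1 + C) * (1 + C)" by (simp only: distrib_left distrib_right) simp
    also have "\<dots> = C * hnorm V x + e" using C by simp
    finally show "hnorm W y \<le> C * hnorm V x + e" .
  qed
  have R_add: "R (x + x') (y + y')" if a: "R x y" and b: "R x' y'" for x x' y y'
    unfolding R_def
  proof (intro conjI allI impI)
    fix e :: real assume "0 < e"
    then have e: "e / 2 > 0" by simp
    obtain u v where uv: "lin_rel V W P u v" "hnorm V (x - u) < e/2" "hnorm W (y - v) < e/2"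
      using a e unfolding R_def by blast
    obtain u' v' where uv': "lin_rel V W P u' v'" "hnorm V (x' - u') < e/2" "hnorm W (y' - v') < e/2"
      using b e unfolding R_def by blast
    have "hnorm V ((x - u) + (x' - u')) < e" "hnorm W ((y - v) + (y' - v')) < e"
      using uv uv' a b car[OF uv(1)] car[OF uv'(1)] V.hnorm_triangle[of "x - u" "x' - u'"]
        W.hnorm_triangle[of "y - v" "y' - v'"] by (auto simp: R_def)
    then show "\<exists>u v. lin_rel V W P u v \<and> hnorm V (x + x' - u) < e \<and> hnorm W (y + y' - v) < e"
      using lin_rel_add[OF uv(1) uv'(1)] by (metis add_diff_add)
  qed (use a b in \<open>auto simp: R_def\<close>)
  have R_scale: "R (hscale V c x) (hscale W c y)" if a: "R x y" for c x y
    unfolding R_def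
  proof (intro conjI allI impI)
    fix e :: real assume "0 < e"
    then have e: "e / (cmod c + 1) > 0" by (simp add: add_nonneg_pos)
    obtain u v where uv: "lin_rel V W P u v" "hnorm V (x - u) < e / (cmod c + 1)"
        "hnorm W (y - v) < e / (cmod c + 1)"
      using a e unfolding R_def by blast
    have m: "x - u \<in> hcarrier V" "y - v \<in> hcarrier W" using a car[OF uv(1)] by (auto simp: R_def)
    have small: "cmod c * t < e" if "0 \<le> t" "t < e / (cmod c + 1)" for t
    proof -
      have "cmod c * t \<le> (cmod c + 1) * t" using that by (intro mult_right_mono) auto
      also have "\<dots> < e" using that(2) by (simp add: pos_less_divide_eq add_nonneg_pos mult.commute)
      finally show ?thesis .
    qed
    have "hnorm V (hscale V c x - hscale V c u) < e" "hnorm W (hscale W c y - hscale W c v) < e"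
      using m small uv by (simp_all add: V.hnorm_scale W.hnorm_scale
          flip: V.scale_right_diff_distrib W.scale_right_diff_distrib)
    then show "\<exists>u v. lin_rel V W P u v \<and> hnorm V (hscale V c x - u) < e \<and> hnorm W (hscale W c y - v) < e"
      using lin_rel_scale[OF uv(1)] by blast
  qed (use a in \<open>auto simp: R_def\<close>)
  have R_ex: "\<exists>y. R x y" if x: "x \<in> hcarrier V" for x
  proof -
    have "\<exists>u v. lin_rel V W P u v \<and> hnorm V (x - u) < 1 / real (Suc k)" for k
    proof -
      have "1 / real (Suc k) > 0" by simp
      then obtain u where "u \<in> V.span (fst ` P)" "hnorm V (x - u) < 1 / real (Suc k)"
        using V.hdense_if_total[OF total] x unfolding hdense_def by blast
      then show ?thesis using lin_rel_span by blast
    qed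
    then obtain u v where uv: "\<And>k. lin_rel V W P (u k) (v k)" "\<And>k. hnorm V (x - u k) < 1 / real (Suc k)"
      by metis
    note m = car[OF uv(1)]
    have diff: "hnorm W (v j - v k) \<le> C * (1 / real (Suc j) + 1 / real (Suc k))" for j k
    proof -
      have "hnorm W (v j - v k) \<le> C * hnorm V (u j - u k)"
        using bound[OF lin_rel_diff[OF uv(1) uv(1)]] .
      also have "hnorm V (u j - u k) \<le> 1 / real (Suc j) + 1 / real (Suc k)"
        using V.hnorm_triangle_via[of "u j" x "u k"] uv(2)[of j] uv(2)[of k] m x
          V.hnorm_minus_commute[of "u j" x] by auto
      finally show ?thesis using C by (simp add: mult_left_mono)
    qed
    have tz: "(\<lambda>k. C * (1 / real (Suc k))) \<longlonglongrightarrow> 0"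
      using tendsto_mult_left[OF LIMSEQ_Suc[OF lim_1_over_n], of C] by simp
    have "\<exists>y\<in>hcarrier W. (\<lambda>k. hnorm W (v k - y)) \<longlonglongrightarrow> 0"
    proof (rule W.complete)
      fix e :: real assume "0 < e"
      then obtain M where M: "\<And>k. k \<ge> M \<Longrightarrow> C * (1 / real (Suc k)) < e / 2"
        using order_tendstoD(2)[OF tz, of "e/2"] by (auto simp: eventually_sequentially)
      show "\<exists>M. \<forall>j\<ge>M. \<forall>k\<ge>M. hnorm W (v j - v k) < e"
      proof (intro exI allI impI)
        fix j k assume "M \<le> j" "M \<le> k"
        then show "hnorm W (v j - v k) < e"
          using M[of j] M[of k] diff[of j k] unfolding distrib_left by linarith
      qed
    qed (use m in auto)
    then obtain y where y: "y \<in> hcarrier W" "(\<lambda>k. hnorm W (v k - y)) \<longlonglongrightarrow> 0" by blast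
    have "R x y" unfolding R_def
    proof (intro conjI allI impI)
      fix e :: real assume "0 < e"
      have "\<forall>\<^sub>F k in sequentially. 1 / real (Suc k) < e"
        using order_tendstoD(2)[OF LIMSEQ_Suc[OF lim_1_over_n] \<open>0 < e\<close>] by simp
      moreover have "\<forall>\<^sub>F k in sequentially. hnorm W (v k - y) < e"
        using order_tendstoD(2)[OF y(2) \<open>0 < e\<close>] .
      ultimately obtain k where k: "1 / real (Suc k) < e" "hnorm W (v k - y) < e"
        using eventually_happens[OF eventually_conj, of _ sequentially] by auto
      show "\<exists>u v. lin_rel V W P u v \<and> hnorm V (x - u) < e \<and> hnorm W (y - v) < e"
        using uv(1)[of k] uv(2)[of k] k W.hnorm_minus_commute[of y "v k"] m y(1) order_less_trans
        by metis
    qed (use x y in auto)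
    then show ?thesis ..
  qed
  have R_unique: "y = y'" if "R x y" "R x y'" for x y y'
  proof -
    \<comment> \<open>Two values at \<open>x\<close> differ by a value at \<open>0\<close>, where
      the bound leaves only \<open>0\<close>.\<close>
    have "R (x + hscale V (-1) x) (y + hscale W (-1) y')" using that R_add R_scale by blast
    then have r: "R 0 (y - y')" by simp
    have "hnorm W (y - y') = 0"
      using R_bound[OF r] r W.hnorm_nonneg[of "y - y'"] unfolding R_def by (metis antisym V.hnorm_zero mult_zero_right)
    then show ?thesis using that W.hnorm_eq_0_iff[of "y - y'"] by (auto simp: R_def)
  qed
  define T where "T x = (if x \<in> hcarrier V then THE y. R x y else 0)" for x
  have RT: "R x (T x)" if "x \<in> hcarrier V" for x
  proof -
    obtain y where y: "R x y" using R_ex \<open>x \<in> hcarrier V\<close> by blast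
    then have "T x = y" using that R_unique unfolding T_def by (auto intro: the_equality)
    then show ?thesis using y by simp
  qed
  have T: "T x = y" if "R x y" for x y using RT R_unique that by (metis R_def)
  show ?thesis
  proof (rule that[of T])
    show "T \<in> bdd_ops V W"
    proof (rule bdd_opsI[where C = C])
      show "x \<in> hcarrier V \<Longrightarrow> T x \<in> hcarrier W" for x using RT[of x] by (simp add: R_def)
      show "x \<in> hcarrier V \<Longrightarrow> hnorm W (T x) \<le> C * hnorm V x" for x using RT R_bound by blast
      show "x \<in> hcarrier V \<Longrightarrow> y \<in> hcarrier V \<Longrightarrow> T (x + y) = T x + T y" for x y using RT R_add T by blast
      show "x \<in> hcarrier V \<Longrightarrow> T (hscale V c x) = hscale W c (T x)" for c x using RT R_scale T by blast
      show "x \<notin> hcarrier V \<Longrightarrow> T x = 0" for x by (simp add: T_def)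
    qed
  next
    fix x y assume xy: "(x, y) \<in> P"
    have "R x y" unfolding R_def
    proof (intro conjI allI impI)
      fix e :: real assume "0 < e"
      then show "\<exists>u v. lin_rel V W P u v \<and> hnorm V (x - u) < e \<and> hnorm W (y - v) < e"
        by (intro exI[of _ x] exI[of _ y]) (simp add: lin_rel_base xy)
    qed (use xy P in auto)
    then show "T x = y" by (rule T)
  qed (use RT R_bound in blast)
qed

text \<open>The arguments are extended one at a time: bounded linearity settles the first, and
  conjugate symmetry turns the second into a first. The factor \<open>m\<close> is 0 or 1 for the
  creation operators and an inner product of wandering vectors for the operators
  \<open>Ty y\<close>.\<close>

lemma ip_ops_eq_if_total:
  assumes S: "S \<in> bdd_ops V W" and T: "T \<in> bdd_ops V W" and D: "htotal V D"
    and eq: "\<And>d d'. d \<in> D \<Longrightarrow> d' \<in> D \<Longrightarrow> hip W (S d) (T d') = m * hip V d d'"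
    and x: "x \<in> hcarrier V" and y: "y \<in> hcarrier V"
  shows "hip W (S x) (T y) = m * hip V x y"
proof -
  have DC: "d \<in> hcarrier V" if "d \<in> D" for d using D that by (auto simp: htotal_def)
  note mem = bdd_opsD(1)[OF S] bdd_opsD(1)[OF T]
  have 1: "hip W (S x) (T d) = m * hip V x d" if d: "d \<in> D" for d
    by (rule V.bf_eq_if_total[OF bf_ip_op[OF S] V.bf_cmult[OF V.bf_ip] D _ x])
      (use eq d DC mem in auto)
  have "hip W (T y) (S x) = cnj m * hip V y x"
  proof (rule V.bf_eq_if_total[OF bf_ip_op[OF T] V.bf_cmult[OF V.bf_ip] D _ y])
    fix d assume d: "d \<in> D"
    show "hip W (T d) (S x) = cnj m * hip V d x"
      using 1[OF d] W.ip_cnj[of "T d" "S x"] V.ip_cnj[of d x] mem DC[OF d] x by simp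
  qed (use mem x in auto)
  then show ?thesis
    using W.ip_cnj[of "S x" "T y"] V.ip_cnj[of x y] mem x y by simp
qed

text \<open>The relation between inner products extends to the linear hull, where it yields the norm
  bound with constant \<open>\<bar>r\<bar>\<close>. The scale admits wandering vectors of any
  length, zero included.\<close>

lemma scaled_isometry_extension:
  assumes P: "P \<subseteq> hcarrier V \<times> hcarrier W" and total: "htotal V (fst ` P)"
    and iso: "\<And>x y x' y'. (x, y) \<in> P \<Longrightarrow> (x', y') \<in> P \<Longrightarrow> hip W y y' = of_real (r\<^sup>2) * hip V x x'"
  obtains T where "T \<in> bdd_ops V W" "\<And>x y. (x, y) \<in> P \<Longrightarrow> T x = y"
proof -
  note car = lin_rel_carrier[OF _ P]
  have 1: "hip W v y' = of_real (r\<^sup>2) * hip V u x'" if "lin_rel V W P u v" "(x', y') \<in> P" for u v x' y'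
    using that
  proof (induction rule: lin_rel.induct)
    case zero
    then show ?case using P by auto
  next
    case (step x y u v c)
    moreover have "x \<in> hcarrier V" "y \<in> hcarrier W" "x' \<in> hcarrier V" "y' \<in> hcarrier W"
      using step P by auto
    moreover have "u \<in> hcarrier V" "v \<in> hcarrier W" using car[OF step(2)] by auto
    moreover have "hip W y y' = of_real (r\<^sup>2) * hip V x x'" using iso step by blast
    ultimately show ?case
      by (simp add: V.ip_add W.ip_add V.ip_scale W.ip_scale distrib_left)
  qed
  have 2: "hip W v' v = of_real (r\<^sup>2) * hip V u' u" if "lin_rel V W P u v" "lin_rel V W P u' v'" for u v u' v'
    using that
  proof (induction rule: lin_rel.induct)
    case zero
    then show ?case using car by auto
  next
    case (step x y u v c)
    moreover have "x \<in> hcarrier V" "y \<in> hcarrier W" using step P by auto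
    moreover have "u \<in> hcarrier V" "v \<in> hcarrier W" "u' \<in> hcarrier V" "v' \<in> hcarrier W"
      using car[OF step(2)] car[OF step.prems] by auto
    moreover have "hip W v' y = of_real (r\<^sup>2) * hip V u' x" using 1 step by blast
    ultimately show ?case
      by (simp add: V.ip_add_right W.ip_add_right V.ip_scale_right W.ip_scale_right distrib_left)
  qed
  have "hnorm W v \<le> \<bar>r\<bar> * hnorm V u" if "lin_rel V W P u v" for u v
  proof -
    have "(hnorm W v)\<^sup>2 = (\<bar>r\<bar> * hnorm V u)\<^sup>2"
      using 2[OF that that] car[OF that] by (simp add: W.hnorm_sq V.hnorm_sq power_mult_distrib
          flip: of_real_power)
    then show ?thesis using car[OF that] by (simp add: power2_eq_iff_nonneg)
  qed
  then show ?thesis using lin_rel_extension[OF P total abs_ge_zero[of r]] that by blast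
qed

text \<open>Nested balls replace a category argument. Without a common bound, balls can be chosen so
  that some \<open>T n\<close> has norm at least \<open>k\<close> on the whole ball of index
  \<open>Suc k\<close>; their common point contradicts \<open>pt\<close>.\<close>

theorem uniform_boundedness:
  fixes T :: "nat \<Rightarrow> 'a \<Rightarrow> 'b"
  assumes T: "\<And>n. T n \<in> bdd_ops V W"
    and pt: "\<And>x. x \<in> hcarrier V \<Longrightarrow> \<exists>M. \<forall>n. hnorm W (T n x) \<le> M"
  shows "\<exists>C\<ge>0. \<forall>n. \<forall>x\<in>hcarrier V. hnorm W (T n x) \<le> C * hnorm V x"
proof (rule ccontr)
  assume "\<not> ?thesis"
  then have unb: "\<exists>n. \<exists>z\<in>hcarrier V. hnorm W (T n z) > C * hnorm V z" if "C \<ge> 0" for C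
    using that by (meson not_le)
  have step: "\<exists>x' r' n. x' \<in> hcarrier V \<and> 0 < r' \<and> r' \<le> r / 2 \<and> hnorm V (x' - x) \<le> r / 2 \<and>
      (\<forall>y\<in>hcarrier V. hnorm V (y - x') \<le> r' \<longrightarrow> real k \<le> hnorm W (T n y))"
    if x: "x \<in> hcarrier V" and r: "0 < r" for x r k
  proof -
    \<comment> \<open>With this constant the vector \<open>w\<close> of length \<open>r / 2\<close>
      along \<open>z\<close> has an image of norm at least \<open>k + 1\<close>.\<close>
    define C where "C = (real k + 1) / (r / 2)"
    have C: "C \<ge> 0" using r by (simp add: C_def)
    obtain n z where z: "z \<in> hcarrier V" "hnorm W (T n z) > C * hnorm V z" using unb[OF C] by blast
    have z0: "hnorm V z > 0"
      using z ops_zero[OF T[of n]] V.hnorm_pos[OF z(1)] by (cases "z = 0") auto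
    define w where "w = hscale V (of_real (r / 2 / hnorm V z)) z"
    have w: "w \<in> hcarrier V" using z by (simp add: w_def)
    have nw: "hnorm V w = r / 2" using z z0 r by (simp add: w_def V.hnorm_scale norm_divide norm_mult)
    have "hnorm W (T n w) = (r / 2 / hnorm V z) * hnorm W (T n z)"
      using z z0 r bdd_opsD(1)[OF T z(1)] by (simp add: w_def bdd_opsD(3)[OF T] W.hnorm_scale norm_divide norm_mult)
    also have "\<dots> \<ge> (r / 2 / hnorm V z) * (C * hnorm V z)"
      using z z0 r by (intro mult_left_mono) auto
    also have "(r / 2 / hnorm V z) * (C * hnorm V z) = real k + 1" using z0 r by (simp add: C_def)
    finally have Tw: "hnorm W (T n w) \<ge> real k + 1" .
    have mem: "T n x \<in> hcarrier W" "T n w \<in> hcarrier W" using T x w by (auto intro: bdd_opsD(1))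
    \<comment> \<open>Twice \<open>T n w\<close> is the difference of the values at
      \<open>x + w\<close> and \<open>x - w\<close>, so one of these two values has norm at least
      \<open>k + 1\<close>, whatever \<open>T n x\<close> is.\<close>
    have "hscale W 2 (T n w) = T n w + T n w"
      using W.scale_left_distrib[of 1 1 "T n w"] by simp
    also have "\<dots> = T n (x + w) - T n (x - w)"
      using x w by (simp add: bdd_opsD(2)[OF T] ops_diff[OF T])
    finally have "2 * hnorm W (T n w) = hnorm W (T n (x + w) - T n (x - w))"
      using mem by (metis W.hnorm_scale norm_numeral)
    also have "\<dots> \<le> hnorm W (T n (x + w)) + hnorm W (T n (x - w))"
      using x w by (intro W.hnorm_triangle_diff bdd_opsD(1)[OF T]) auto
    finally have "real k + 1 \<le> hnorm W (T n (x + w)) \<or> real k + 1 \<le> hnorm W (T n (x - w))"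
      using Tw by linarith
    then obtain x' where x': "x' \<in> hcarrier V" "hnorm V (x' - x) \<le> r / 2" "real k + 1 \<le> hnorm W (T n x')"
    proof
      assume "real k + 1 \<le> hnorm W (T n (x + w))"
      then show thesis using x w nw by (intro that[of "x + w"]) auto
    next
      assume "real k + 1 \<le> hnorm W (T n (x - w))"
      then show thesis using x w nw by (intro that[of "x - w"]) auto
    qed
    obtain D where D: "0 \<le> D" "\<And>x. x \<in> hcarrier V \<Longrightarrow> hnorm W (T n x) \<le> D * hnorm V x"
      using bdd_ops_bound[OF T] by blast
    \<comment> \<open>The term \<open>1 / (D + 1)\<close> limits the variation of \<open>T n\<close>
      on the new ball to 1, which accounts for the drop from \<open>k + 1\<close> to
      \<open>k\<close>. The term \<open>r / 2\<close> keeps the new ball inside the old one.\<close>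
    define r' where "r' = min (r / 2) (1 / (D + 1))"
    have "D * r' \<le> D * (1 / (D + 1))" using D(1) by (intro mult_left_mono) (auto simp: r'_def)
    also have "\<dots> \<le> 1" using D(1) by simp
    finally have Dr: "D * r' \<le> 1" .
    have "real k \<le> hnorm W (T n y)" if y: "y \<in> hcarrier V" "hnorm V (y - x') \<le> r'" for y
    proof -
      have "hnorm W (T n x' - T n y) \<le> D * hnorm V (x' - y)"
        using D(2)[of "x' - y"] ops_diff[OF T x'(1) y(1)] x' y by simp
      also have "\<dots> \<le> D * r'"
        using y(2) V.hnorm_minus_commute[OF x'(1) y(1)] D(1) by (intro mult_left_mono) auto
      finally have "hnorm W (T n x' - T n y) \<le> 1" using Dr by simp
      then show ?thesis
        using W.hnorm_diff_abs[OF bdd_opsD(1)[OF T x'(1)] bdd_opsD(1)[OF T y(1)], of n n] x'(3)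
        by linarith
    qed
    moreover have "0 < r'" using r D(1) by (simp add: r'_def)
    moreover have "r' \<le> r / 2" by (simp add: r'_def)
    ultimately show ?thesis using x' by blast
  qed
  define Q where "Q k = (\<lambda>(x, r) (x', r'). r' \<le> r / 2 \<and> hnorm V (x' - x) \<le> r / 2 \<and>
      (\<exists>n. \<forall>y\<in>hcarrier V. hnorm V (y - x') \<le> r' \<longrightarrow> real k \<le> hnorm W (T n y)))" for k :: nat
  have "\<exists>p. \<forall>k. (case p k of (x, r) \<Rightarrow> x \<in> hcarrier V \<and> 0 < r) \<and> Q k (p k) (p (Suc k))"
  proof (rule dependent_nat_choice)
    show "\<exists>p. case p of (x, r::real) \<Rightarrow> x \<in> hcarrier V \<and> 0 < r" by (intro exI[of _ "(0, 1)"]) auto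
    fix p :: "'a \<times> real" and k
    assume "case p of (x, r) \<Rightarrow> x \<in> hcarrier V \<and> 0 < r"
    then obtain x r where p: "p = (x, r)" "x \<in> hcarrier V" "0 < r" by auto
    from step[OF p(2,3), of k] obtain x' r' where "x' \<in> hcarrier V" "0 < r'" "Q k (x, r) (x', r')"
      unfolding Q_def by auto
    then show "\<exists>q. (case q of (x, r) \<Rightarrow> x \<in> hcarrier V \<and> 0 < r) \<and> Q k p q"
      using p(1) by (intro exI[of _ "(x', r')"]) auto
  qed
  then obtain p where "\<forall>k. (case p k of (x, r) \<Rightarrow> x \<in> hcarrier V \<and> 0 < r) \<and> Q k (p k) (p (Suc k))" ..
  then have p: "case p k of (x, r) \<Rightarrow> x \<in> hcarrier V \<and> 0 < r" "Q k (p k) (p (Suc k))" for k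
    by simp_all
  define x where "x k = fst (p k)" for k
  define r where "r k = snd (p k)" for k
  have x: "x k \<in> hcarrier V" and r0: "0 < r k" for k
    using p(1)[of k] by (auto simp: x_def r_def split: prod.splits)
  have rr: "r (Suc k) \<le> r k / 2" and xx: "hnorm V (x (Suc k) - x k) \<le> r k / 2"
    and big: "\<exists>n. \<forall>y\<in>hcarrier V. hnorm V (y - x (Suc k)) \<le> r (Suc k) \<longrightarrow> real k \<le> hnorm W (T n y)" for k
    using p(2)[of k] by (auto simp: x_def r_def Q_def split: prod.splits)
  \<comment> \<open>Since the radii at least halve, \<open>r k / 2\<close> is at most
    \<open>r k - r (Suc k)\<close>, and the step lengths telescope.\<close>
  have nest: "hnorm V (x (k + j) - x k) \<le> r k - r (k + j)" for k j
  proof (induction j)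
    case (Suc j)
    have "hnorm V (x (k + Suc j) - x k) \<le> hnorm V (x (Suc (k + j)) - x (k + j)) + hnorm V (x (k + j) - x k)"
      using V.hnorm_triangle_via[of "x (k + Suc j)" "x (k + j)" "x k"] x by simp
    then show ?case using Suc xx[of "k + j"] rr[of "k + j"] by simp
  qed (use x in simp)
  have r_le: "r k \<le> r 0 * (1/2) ^ k" for k
  proof (induction k)
    case (Suc k) then show ?case using rr[of k] by simp
  qed simp
  have "(\<lambda>k. r 0 * (1/2) ^ k) \<longlonglongrightarrow> 0"
    using tendsto_mult_left[OF LIMSEQ_power_zero[of "1/2::real"], of "r 0"] by simp
  then have rlim: "r \<longlonglongrightarrow> 0"
    by (rule Lim_null_comparison[rotated]) (use r0 r_le in \<open>auto simp: less_imp_le\<close>)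
  have "\<exists>l\<in>hcarrier V. (\<lambda>k. hnorm V (x k - l)) \<longlonglongrightarrow> 0"
  proof (rule V.complete[OF x])
    fix e :: real assume "0 < e"
    then obtain M where M: "r M < e / 2"
      using order_tendstoD(2)[OF rlim, of "e/2"] by (auto simp: eventually_sequentially)
    have near: "hnorm V (x j - x M) < e / 2" if "M \<le> j" for j
      using nest[of M "j - M"] that M r0[of j] by simp
    show "\<exists>M. \<forall>j\<ge>M. \<forall>k\<ge>M. hnorm V (x j - x k) < e"
    proof (intro exI allI impI)
      fix j k assume "M \<le> j" "M \<le> k"
      then show "hnorm V (x j - x k) < e"
        using near[of j] near[of k] V.hnorm_triangle_via[of "x j" "x M" "x k"] x
          V.hnorm_minus_commute[of "x M" "x k"] by simp
    qed
  qed
  then obtain l where l: "l \<in> hcarrier V" "(\<lambda>k. hnorm V (x k - l)) \<longlonglongrightarrow> 0" by blast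
  have lball: "hnorm V (l - x k) \<le> r k" for k
  proof -
    have "(\<lambda>j. hnorm V (x (j + k) - x k - (l - x k))) \<longlonglongrightarrow> 0"
      using LIMSEQ_ignore_initial_segment[OF l(2), of k] by simp
    from V.hnorm_tendsto[OF _ _ this]
    have lim: "(\<lambda>j. hnorm V (x (j + k) - x k)) \<longlonglongrightarrow> hnorm V (l - x k)" using x l by simp
    have "hnorm V (x (j + k) - x k) \<le> r k" for j
      using nest[of k j] r0[of "k + j"] by (simp add: add.commute)
    then show ?thesis using LIMSEQ_le_const2[OF lim] by blast
  qed
  obtain M where M: "\<And>n. hnorm W (T n l) \<le> M" using pt[OF l(1)] by blast
  obtain k where "real k > M" using reals_Archimedean2 by blast
  moreover obtain n where "real k \<le> hnorm W (T n l)" using big[of k] lball[of "Suc k"] l(1) by blast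
  ultimately show False using M[of n] by simp
qed

text \<open>The common bound \<open>C\<close> makes the set of vectors with vanishing limit a closed
  subspace.\<close>

lemma ops_tendsto_zero_if_total:
  assumes T: "\<And>m. T m \<in> bdd_ops V W"
    and C: "\<And>m x. x \<in> hcarrier V \<Longrightarrow> hnorm W (T m x) \<le> C * hnorm V x"
    and D: "htotal V D" and lim: "\<And>d. d \<in> D \<Longrightarrow> (\<lambda>m::nat. hnorm W (T m d)) \<longlonglongrightarrow> 0"
    and x: "x \<in> hcarrier V"
  shows "(\<lambda>m. hnorm W (T m x)) \<longlonglongrightarrow> 0"
proof -
  define N where "N = {x \<in> hcarrier V. (\<lambda>m. hnorm W (T m x)) \<longlonglongrightarrow> 0}"
  note mem = bdd_opsD(1)[OF T]
  have "V.subspace N"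
  proof (rule V.subspaceI)
    show "0 \<in> N" using ops_zero[OF T] by (simp add: N_def)
  next
    fix x y assume xy: "x \<in> N" "y \<in> N"
    have "(\<lambda>m. hnorm W (T m (x + y))) \<longlonglongrightarrow> 0"
    proof (rule Lim_null_comparison)
      show "(\<lambda>m. hnorm W (T m x) + hnorm W (T m y)) \<longlonglongrightarrow> 0"
        using xy tendsto_add[of "\<lambda>m. hnorm W (T m x)" 0 sequentially "\<lambda>m. hnorm W (T m y)" 0] by (simp add: N_def)
      show "\<forall>\<^sub>F m in sequentially. norm (hnorm W (T m (x + y))) \<le> hnorm W (T m x) + hnorm W (T m y)"
        using xy mem W.hnorm_triangle by (simp add: N_def bdd_opsD(2)[OF T])
    qed
    then show "x + y \<in> N" using xy by (simp add: N_def)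
  next
    fix c x assume "x \<in> N"
    then show "hscale V c x \<in> N"
      using mem tendsto_mult_left[of "\<lambda>m. hnorm W (T m x)" 0 sequentially "cmod c"]
      by (simp add: N_def bdd_opsD(3)[OF T] W.hnorm_scale)
  qed
  moreover have "l \<in> N" if s: "\<And>k. s k \<in> N" and l: "l \<in> hcarrier V"
      and sl: "(\<lambda>k. hnorm V (s k - l)) \<longlonglongrightarrow> 0" for s l
  proof -
    have "(\<lambda>m. hnorm W (T m l)) \<longlonglongrightarrow> 0"
    proof (rule LIMSEQ_I)
      fix e :: real assume e: "0 < e"
      have "(\<lambda>k. C * hnorm V (s k - l)) \<longlonglongrightarrow> 0" using tendsto_mult_left[OF sl, of C] by simp
      then obtain k where k: "C * hnorm V (s k - l) < e / 2"
        using order_tendstoD(2)[of _ 0 sequentially "e/2"] e by (auto simp: eventually_sequentially)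
      obtain M where M: "\<And>m. m \<ge> M \<Longrightarrow> hnorm W (T m (s k)) < e / 2"
        using order_tendstoD(2)[of "\<lambda>m. hnorm W (T m (s k))" 0 sequentially "e/2"] s[of k] e
        by (auto simp: N_def eventually_sequentially)
      have sk: "s k \<in> hcarrier V" using s[of k] by (simp add: N_def)
      have "norm (hnorm W (T m l) - 0) < e" if "m \<ge> M" for m
      proof -
        have "hnorm W (T m l) \<le> hnorm W (T m (s k)) + hnorm W (T m (s k - l))"
          using W.hnorm_triangle_diff[of "T m (s k)" "T m (s k - l)"] mem sk l by (simp add: ops_diff[OF T])
        then show ?thesis using M[OF that] k C[of "s k - l" m] sk l mem[OF l] by simp
      qed
      then show "\<exists>M. \<forall>m\<ge>M. norm (hnorm W (T m l) - 0) < e" by blast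
    qed
    then show ?thesis using l by (simp add: N_def)
  qed
  ultimately have "closed_subspace V N" unfolding closed_subspace_def N_def by blast
  moreover have "D \<subseteq> N" using D lim by (auto simp: htotal_def N_def)
  ultimately show ?thesis using htotalD[OF D _ _ x] by (auto simp: N_def)
qed

section \<open>Operator norm and uniqueness of strong limits\<close>

lemma op_norm_le:
  "0 \<le> C \<Longrightarrow> (\<And>x. x \<in> hcarrier V \<Longrightarrow> hnorm W (T x) \<le> C * hnorm V x) \<Longrightarrow> op_norm V W T \<le> C"
  unfolding op_norm_def by (rule cInf_lower) (auto intro: bdd_belowI[of _ 0])

lemma op_norm_nonneg:
  assumes "T \<in> bdd_ops V W" shows "0 \<le> op_norm V W T"
proof -
  obtain C where "0 \<le> C" "\<And>x. x \<in> hcarrier V \<Longrightarrow> hnorm W (T x) \<le> C * hnorm V x"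
    using bdd_ops_bound[OF assms] by blast
  then show ?thesis unfolding op_norm_def by (intro cInf_greatest) auto
qed

lemma op_norm_bound:
  assumes T: "T \<in> bdd_ops V W" and x: "x \<in> hcarrier V"
  shows "hnorm W (T x) \<le> op_norm V W T * hnorm V x"
proof (cases "x = 0")
  case False
  then have x0: "hnorm V x > 0" using V.hnorm_pos[OF x] by simp
  obtain C where C: "0 \<le> C" "\<And>x. x \<in> hcarrier V \<Longrightarrow> hnorm W (T x) \<le> C * hnorm V x"
    using bdd_ops_bound[OF T] by blast
  have "hnorm W (T x) / hnorm V x \<le> op_norm V W T"
    unfolding op_norm_def using C x x0 by (intro cInf_greatest) (auto simp: divide_le_eq)
  then show ?thesis using x0 by (simp add: divide_le_eq)
qed (use ops_zero[OF T] in simp)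

end

text \<open>\<open>eval_SOT\<close> and \<open>eval_rad\<close> are defined by \<open>THE\<close>;
  uniqueness lets them be computed from any limit at hand.\<close>

lemma (in hilbert_space) sot_tendsto_unique:
  assumes T: "\<And>t. T t \<in> bdd_ops V V" and L: "sot_tendsto V T F L" and L': "sot_tendsto V T F L'" and F: "F \<noteq> bot"
  shows "L = L'"
proof
  fix x show "L x = L' x"
  proof (cases "x \<in> hcarrier V")
    case True
    then show ?thesis
      using hlim_unique[of "\<lambda>t. T t x" "L x" "L' x" F] bdd_opsD(1)[OF T True] L L' F
      by (auto simp: sot_tendsto_def bdd_opsD(1))
  next
    case False
    have "L \<in> bdd_ops V V" "L' \<in> bdd_ops V V" using L L' by (simp_all add: sot_tendsto_def)
    then show ?thesis using False bdd_opsD(4)[of L V V x] bdd_opsD(4)[of L' V V x] by simp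
  qed
qed

lemma (in hilbert_space) sot_tendsto_if_norm_tendsto:
  assumes T: "\<And>m. T m \<in> bdd_ops V V" and L: "norm_tendsto V T L"
  shows "sot_tendsto V T sequentially L"
proof -
  interpret hilbert_pair V V by (simp add: hilbert_pair_def hilbert_space_axioms)
  have LB: "L \<in> bdd_ops V V" using L by (simp add: norm_tendsto_def)
  have "(\<lambda>m. hnorm V (T m x - L x)) \<longlonglongrightarrow> 0" if x: "x \<in> hcarrier V" for x
  proof (rule Lim_null_comparison)
    show "(\<lambda>m. op_norm V V (T m - L) * hnorm V x) \<longlonglongrightarrow> 0"
      using L tendsto_mult_right[of "\<lambda>m. op_norm V V (T m - L)" 0 sequentially "hnorm V x"]
      by (simp add: norm_tendsto_def)
    show "\<forall>\<^sub>F m in sequentially. norm (hnorm V (T m x - L x)) \<le> op_norm V V (T m - L) * hnorm V x"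
      using op_norm_bound[OF ops_minus[OF T LB] x] bdd_opsD(1)[OF T x] bdd_opsD(1)[OF LB x] by simp
  qed
  then show ?thesis using LB by (simp add: sot_tendsto_def)
qed

section \<open>Ampliations\<close>

locale tensor_product = K: hilbert_space K + H: hilbert_space H + T: hilbert_space T
  for K :: "('k::ab_group_add) hilb" and H :: "('h::ab_group_add) hilb" and T :: "('t::ab_group_add) hilb" +
  fixes \<tau> :: "'k \<Rightarrow> 'h \<Rightarrow> 't"
  assumes tensor: "hilbert_tensor K H T \<tau>"
begin

sublocale KK: hilbert_pair K K ..
sublocale KT: hilbert_pair K T ..
sublocale TT: hilbert_pair T T ..

lemma \<tau>_carrier [simp]: "x \<in> hcarrier K \<Longrightarrow> h \<in> hcarrier H \<Longrightarrow> \<tau> x h \<in> hcarrier T"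
  and \<tau>_add: "x \<in> hcarrier K \<Longrightarrow> y \<in> hcarrier K \<Longrightarrow> h \<in> hcarrier H \<Longrightarrow> \<tau> (x + y) h = \<tau> x h + \<tau> y h"
  and \<tau>_add_right: "x \<in> hcarrier K \<Longrightarrow> h \<in> hcarrier H \<Longrightarrow> k \<in> hcarrier H \<Longrightarrow> \<tau> x (h + k) = \<tau> x h + \<tau> x k"
  and \<tau>_scale: "x \<in> hcarrier K \<Longrightarrow> h \<in> hcarrier H \<Longrightarrow> \<tau> (hscale K c x) h = hscale T c (\<tau> x h)"
  and \<tau>_scale_right: "x \<in> hcarrier K \<Longrightarrow> h \<in> hcarrier H \<Longrightarrow> \<tau> x (hscale H c h) = hscale T c (\<tau> x h)"
  and \<tau>_ip: "x \<in> hcarrier K \<Longrightarrow> y \<in> hcarrier K \<Longrightarrow> h \<in> hcarrier H \<Longrightarrow> k \<in> hcarrier H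
      \<Longrightarrow> hip T (\<tau> x h) (\<tau> y k) = hip K x y * hip H h k"
  using tensor by (auto simp: hilbert_tensor_def)

lemma \<tau>_total: "htotal T {\<tau> x h |x h. x \<in> hcarrier K \<and> h \<in> hcarrier H}"
  by (rule T.htotal_if_hdense) (use tensor in \<open>simp add: hilbert_tensor_def hspan_def\<close>)

lemma \<tau>_zero_right [simp]: "x \<in> hcarrier K \<Longrightarrow> \<tau> x 0 = 0"
  using \<tau>_scale_right[of x 0 0] by simp

lemma \<tau>_norm: "x \<in> hcarrier K \<Longrightarrow> h \<in> hcarrier H \<Longrightarrow> hnorm T (\<tau> x h) = hnorm K x * hnorm H h"
proof -
  assume "x \<in> hcarrier K" "h \<in> hcarrier H"
  then have "hip T (\<tau> x h) (\<tau> x h) = of_real ((hnorm K x * hnorm H h)\<^sup>2)"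
    by (simp add: \<tau>_ip K.ip_self H.ip_self power_mult_distrib)
  then show ?thesis using \<open>x \<in> hcarrier K\<close> \<open>h \<in> hcarrier H\<close> by (simp add: hnorm_def[of T])
qed

lemma \<tau>_left_op: "h \<in> hcarrier H \<Longrightarrow> on_carrier K (\<lambda>x. \<tau> x h) \<in> bdd_ops K T"
  by (rule bdd_opsI[where C = "hnorm H h"])
    (auto simp: on_carrier_def \<tau>_add \<tau>_scale \<tau>_norm mult.commute)

text \<open>For fixed \<open>h\<close> and \<open>z\<close>, pairing \<open>\<tau> x h\<close> with
  \<open>z\<close> is a bounded functional of \<open>x\<close>, so its vanishing spreads from
  \<open>D\<close> to all of \<open>K\<close>.\<close>

lemma \<tau>_total_if_total:
  assumes D: "htotal K D"
  shows "htotal T {\<tau> d h |d h. d \<in> D \<and> h \<in> hcarrier H}"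
proof (rule T.htotal_if_orthogonal_trivial)
  have DC: "d \<in> hcarrier K" if "d \<in> D" for d using D that by (auto simp: htotal_def)
  show "{\<tau> d h |d h. d \<in> D \<and> h \<in> hcarrier H} \<subseteq> hcarrier T" using DC by auto
  fix z assume z: "z \<in> hcarrier T" and orth: "\<And>d. d \<in> {\<tau> d h |d h. d \<in> D \<and> h \<in> hcarrier H} \<Longrightarrow> hip T z d = 0"
  have "hip T (\<tau> x h) z = 0" if x: "x \<in> hcarrier K" and h: "h \<in> hcarrier H" for x h
  proof -
    have "hip T (on_carrier K (\<lambda>x. \<tau> x h) x) z = 0"
    proof (rule K.bf_zero_if_total[OF KT.bf_ip_op[OF \<tau>_left_op[OF h] z] D _ x])
      fix d assume d: "d \<in> D"
      have "hip T z (\<tau> d h) = 0" using orth d h by blast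
      then show "hip T (on_carrier K (\<lambda>x. \<tau> x h) d) z = 0"
        using T.ip_commute_zero[of z "\<tau> d h"] d DC h z by (simp add: on_carrier_def)
    qed
    then show ?thesis using x by (simp add: on_carrier_def)
  qed
  then show "z = 0" by (intro T.htotal_ip_zero[OF \<tau>_total z]) auto
qed

text \<open>A list represents a tensor in a non-unique way. Working with the list allows
  \<open>f \<otimes> I\<close> to be applied term by term before it is known to be well
  defined.\<close>

definition tsum :: "('k \<Rightarrow> 'k) \<Rightarrow> ('k \<times> 'h) list \<Rightarrow> 't" where
  "tsum f xs = (\<Sum>(x, h)\<leftarrow>xs. \<tau> (f x) h)"

lemma tsum_carrier:
  "f \<in> bdd_ops K K \<Longrightarrow> set xs \<subseteq> hcarrier K \<times> hcarrier H \<Longrightarrow> tsum f xs \<in> hcarrier T"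
  by (induction xs) (auto simp: tsum_def bdd_opsD(1))

text \<open>Each \<open>h\<close> is written as \<open>c h\<close> times \<open>h1\<close> plus a
  remainder. The coefficients do not depend on \<open>f\<close>, so the same regrouping serves for
  an operator and for the identity, which can then be compared.\<close>

lemma tsum_split:
  assumes f: "f \<in> bdd_ops K K" and h1: "h1 \<in> hcarrier H"
  shows "set xs \<subseteq> hcarrier K \<times> hcarrier H \<Longrightarrow>
    (\<Sum>(x, h)\<leftarrow>xs. hscale K (c h) x) \<in> hcarrier K \<and>
    tsum f xs = \<tau> (f (\<Sum>(x, h)\<leftarrow>xs. hscale K (c h) x)) h1 +
      tsum f (map (\<lambda>(x, h). (x, h - hscale H (c h) h1)) xs)"
proof (induction xs)
  case Nil
  then show ?case using h1 \<tau>_scale[of 0 h1 0] by (simp add: tsum_def KK.ops_zero[OF f])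
next
  case (Cons p xs)
  obtain x h where p: "p = (x, h)" by force
  define z where "z = (\<Sum>(x, h)\<leftarrow>xs. hscale K (c h) x)"
  define t where "t = tsum f (map (\<lambda>(x, h). (x, h - hscale H (c h) h1)) xs)"
  have m: "x \<in> hcarrier K" "h \<in> hcarrier H" using Cons.prems p by auto
  have fx: "f x \<in> hcarrier K" using f m by (auto intro: bdd_opsD(1))
  have IH: "z \<in> hcarrier K" "tsum f xs = \<tau> (f z) h1 + t"
    using Cons.IH Cons.prems by (auto simp: z_def t_def)
  have fz: "f z \<in> hcarrier K" using f IH by (auto intro: bdd_opsD(1))
  have e: "f (hscale K (c h) x + z) = hscale K (c h) (f x) + f z"
    using m IH by (simp add: bdd_opsD(2,3)[OF f])
  have "\<tau> (f x) h = \<tau> (f x) (hscale H (c h) h1 + (h - hscale H (c h) h1))" by simp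
  also have "\<dots> = hscale T (c h) (\<tau> (f x) h1) + \<tau> (f x) (h - hscale H (c h) h1)"
    using fx m h1 by (simp only: \<tau>_add_right H.carrier_scale H.carrier_diff \<tau>_scale_right)
  finally have "\<tau> (f x) h + tsum f xs =
      \<tau> (f (hscale K (c h) x + z)) h1 + (\<tau> (f x) (h - hscale H (c h) h1) + t)"
    unfolding e using IH fx fz h1 by (simp add: \<tau>_add \<tau>_scale)
  then show ?case using p m IH by (simp add: tsum_def z_def t_def)
qed

text \<open>Splitting off the direction of the first second component is a Gram-Schmidt step: the
  two parts are orthogonal both before and after applying M.\<close>

lemma tsum_bound:
  assumes M: "M \<in> bdd_ops K K" and C: "0 \<le> C" "\<And>x. x \<in> hcarrier K \<Longrightarrow> hnorm K (M x) \<le> C * hnorm K x"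
  shows "set xs \<subseteq> hcarrier K \<times> hcarrier H \<Longrightarrow>
    hnorm T (tsum M xs) \<le> C * hnorm T (tsum (on_carrier K (\<lambda>x. x)) xs)"
proof (induction xs rule: length_induct)
  case (1 xs)
  show ?case
  proof (cases xs)
    case Nil
    then show ?thesis by (simp add: tsum_def)
  next
    case (Cons p ys)
    obtain x1 h1 where p: "p = (x1, h1)" by force
    have m: "x1 \<in> hcarrier K" "h1 \<in> hcarrier H" and ys: "set ys \<subseteq> hcarrier K \<times> hcarrier H"
      using "1.prems" Cons p by auto
    let ?id = "on_carrier K (\<lambda>x. x)"
    show ?thesis
    \<comment> \<open>The coefficient \<open>c\<close> divides by \<open>hip H h1 h1\<close>; a zero
      second component contributes nothing and is dropped from the list instead.\<close>
    proof (cases "h1 = 0")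
      case True
      have "tsum f xs = tsum f ys" if "f \<in> bdd_ops K K" for f
        using Cons p True m bdd_opsD(1)[OF that] by (simp add: tsum_def)
      then show ?thesis using "1.IH" Cons ys M K.ops_id by simp
    next
      case False
      define c where "c h = hip H h h1 / hip H h1 h1" for h
      define z where "z = x1 + (\<Sum>(x, h)\<leftarrow>ys. hscale K (c h) x)"
      define zs where "zs = map (\<lambda>(x, h). (x, h - hscale H (c h) h1)) ys"
      have nz: "hip H h1 h1 \<noteq> 0" using False m by (simp add: H.ip_self_eq_0_iff)
      have zs: "set zs \<subseteq> hcarrier K \<times> hcarrier H" using ys m by (auto simp: zs_def)
      have z: "z \<in> hcarrier K" using tsum_split[OF M m(2) ys] m by (simp add: z_def)
      have orth: "\<forall>(x, h)\<in>set zs. hip H h1 h = 0"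
      proof -
        have "hip H h1 (h - hscale H (c h) h1) = 0" if "h \<in> hcarrier H" for h
          using that m nz H.ip_cnj[of h1 h] H.ip_cnj[of h1 h1]
          by (simp add: H.ip_diff_right H.ip_scale_right c_def)
        then show ?thesis using ys by (auto simp: zs_def)
      qed
      have split: "(hnorm T (tsum f xs))\<^sup>2 = (hnorm K (f z))\<^sup>2 * (hnorm H h1)\<^sup>2 + (hnorm T (tsum f zs))\<^sup>2"
        if f: "f \<in> bdd_ops K K" for f
      proof -
        note s = tsum_split[OF f m(2) ys, of c, folded zs_def]
        note fz = bdd_opsD(1)[OF f z]
        have "tsum f xs = \<tau> (f x1) h1 + tsum f ys" using Cons p by (simp add: tsum_def)
        also have "\<dots> = \<tau> (f z) h1 + tsum f zs"
          using s m bdd_opsD(1)[OF f] by (simp add: z_def bdd_opsD(2)[OF f] \<tau>_add)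
        finally have e: "tsum f xs = \<tau> (f z) h1 + tsum f zs" .
        have "hip T (\<tau> (f z) h1) (tsum f ws) = 0"
          if "set ws \<subseteq> hcarrier K \<times> hcarrier H" "\<forall>(x, h)\<in>set ws. hip H h1 h = 0" for ws
          using that
        proof (induction ws)
          case (Cons w ws)
          obtain x h where w: "w = (x, h)" by force
          have "tsum f ws \<in> hcarrier T" using Cons.prems f by (intro tsum_carrier) auto
          then show ?case using Cons w fz m bdd_opsD(1)[OF f, of x]
            by (auto simp: tsum_def T.ip_add_right \<tau>_ip)
        qed (use fz m in \<open>simp add: tsum_def\<close>)
        then have "hip T (\<tau> (f z) h1) (tsum f zs) = 0" using zs orth by blast
        then show ?thesis unfolding e
          using T.pythagoras[of "\<tau> (f z) h1" "tsum f zs"] fz m tsum_carrier[OF f zs]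
          by (simp add: \<tau>_norm power_mult_distrib)
      qed
      have len: "length zs < length xs" using Cons by (simp add: zs_def)
      have IH: "hnorm T (tsum M zs) \<le> C * hnorm T (tsum ?id zs)" using "1.IH" len zs by blast
      have tc: "tsum M zs \<in> hcarrier T" "tsum ?id xs \<in> hcarrier T"
        using tsum_carrier M K.ops_id zs "1.prems" by blast+
      have "(hnorm T (tsum M xs))\<^sup>2 = (hnorm K (M z))\<^sup>2 * (hnorm H h1)\<^sup>2 + (hnorm T (tsum M zs))\<^sup>2"
        by (rule split[OF M])
      also have "\<dots> \<le> (C * hnorm K z)\<^sup>2 * (hnorm H h1)\<^sup>2 + (C * hnorm T (tsum ?id zs))\<^sup>2"
        using C z IH tc bdd_opsD(1)[OF M z]
        by (intro add_mono mult_right_mono power_mono) auto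
      also have "\<dots> = (C * hnorm T (tsum ?id xs))\<^sup>2"
        unfolding power_mult_distrib split[OF K.ops_id] using z by (simp add: on_carrier_def distrib_left)
      finally show ?thesis
        by (rule power2_le_imp_le) (use C tc in simp)
    qed
  qed
qed

text \<open>Pairs in the linear hull are pairs of \<open>tsum\<close>s over one list, with scalars
  absorbed into first components, so \<open>tsum_bound\<close> is the bound that the extension
  theorem asks for. Keeping the constant \<open>C\<close> is essential when a sequence of
  ampliations must be bounded uniformly.\<close>

lemma ampliation_ex:
  assumes M: "M \<in> bdd_ops K K" and C: "0 \<le> C" "\<And>x. x \<in> hcarrier K \<Longrightarrow> hnorm K (M x) \<le> C * hnorm K x"
  shows "\<exists>A\<in>bdd_ops T T. (\<forall>x\<in>hcarrier K. \<forall>h\<in>hcarrier H. A (\<tau> x h) = \<tau> (M x) h) \<and>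
    (\<forall>z\<in>hcarrier T. hnorm T (A z) \<le> C * hnorm T z)"
proof -
  let ?id = "on_carrier K (\<lambda>x. x)"
  define P where "P = {(\<tau> x h, \<tau> (M x) h) |x h. x \<in> hcarrier K \<and> h \<in> hcarrier H}"
  have P: "P \<subseteq> hcarrier T \<times> hcarrier T" using bdd_opsD(1)[OF M] by (auto simp: P_def)
  have "fst ` P = {\<tau> x h |x h. x \<in> hcarrier K \<and> h \<in> hcarrier H}" by (force simp: P_def)
  then have total: "htotal T (fst ` P)" using \<tau>_total by simp
  have rep: "\<exists>xs. set xs \<subseteq> hcarrier K \<times> hcarrier H \<and> u = tsum ?id xs \<and> v = tsum M xs"
    if "lin_rel T T P u v" for u v
    using that
  proof (induction rule: lin_rel.induct)
    case zero
    then show ?case by (intro exI[of _ "[]"]) (simp add: tsum_def)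
  next
    case (step a b u v c)
    obtain xs where xs: "set xs \<subseteq> hcarrier K \<times> hcarrier H" "u = tsum ?id xs" "v = tsum M xs"
      using step by blast
    obtain x h where xh: "a = \<tau> x h" "b = \<tau> (M x) h" "x \<in> hcarrier K" "h \<in> hcarrier H"
      using step by (auto simp: P_def)
    show ?case
      using xs xh bdd_opsD(1,3)[OF M, of x]
      by (intro exI[of _ "(hscale K c x, h) # xs"]) (auto simp: tsum_def on_carrier_def \<tau>_scale)
  qed
  have bound: "hnorm T v \<le> C * hnorm T u" if "lin_rel T T P u v" for u v
    using rep[OF that] tsum_bound[OF M C] by blast
  obtain A where "A \<in> bdd_ops T T" "\<And>x y. (x, y) \<in> P \<Longrightarrow> A x = y"
    "\<And>z. z \<in> hcarrier T \<Longrightarrow> hnorm T (A z) \<le> C * hnorm T z"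
    using TT.lin_rel_extension[OF P total C(1) bound] by blast
  then show ?thesis by (intro bexI[of _ A]) (auto simp: P_def)
qed

lemma ampliation_unique:
  assumes "A \<in> bdd_ops T T" "A' \<in> bdd_ops T T"
    "\<And>x h. x \<in> hcarrier K \<Longrightarrow> h \<in> hcarrier H \<Longrightarrow> A (\<tau> x h) = A' (\<tau> x h)"
  shows "A = A'"
  by (rule TT.ops_eq_if_total[OF assms(1,2) \<tau>_total]) (use assms(3) in auto)

lemma ampliation_eqI:
  assumes A: "A \<in> bdd_ops T T" "\<And>x h. x \<in> hcarrier K \<Longrightarrow> h \<in> hcarrier H \<Longrightarrow> A (\<tau> x h) = \<tau> (M x) h"
  shows "ampliation K H T \<tau> M = A"
  unfolding ampliation_def by (rule the_equality) (use A ampliation_unique in auto)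

lemma ampliation_op:
  assumes M: "M \<in> bdd_ops K K"
  shows "ampliation K H T \<tau> M \<in> bdd_ops T T"
    and "x \<in> hcarrier K \<Longrightarrow> h \<in> hcarrier H \<Longrightarrow> ampliation K H T \<tau> M (\<tau> x h) = \<tau> (M x) h"
    and "0 \<le> C \<Longrightarrow> (\<And>x. x \<in> hcarrier K \<Longrightarrow> hnorm K (M x) \<le> C * hnorm K x) \<Longrightarrow> z \<in> hcarrier T
      \<Longrightarrow> hnorm T (ampliation K H T \<tau> M z) \<le> C * hnorm T z"
proof -
  obtain D where D: "0 \<le> D" "\<And>x. x \<in> hcarrier K \<Longrightarrow> hnorm K (M x) \<le> D * hnorm K x"
    using KK.bdd_ops_bound[OF M] by blast
  obtain A where A: "A \<in> bdd_ops T T" "\<And>x h. x \<in> hcarrier K \<Longrightarrow> h \<in> hcarrier H \<Longrightarrow> A (\<tau> x h) = \<tau> (M x) h"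
    using ampliation_ex[OF M D] by blast

  note e = ampliation_eqI[OF A(1,2)]
  show "ampliation K H T \<tau> M \<in> bdd_ops T T" using e A by simp
  show "x \<in> hcarrier K \<Longrightarrow> h \<in> hcarrier H \<Longrightarrow> ampliation K H T \<tau> M (\<tau> x h) = \<tau> (M x) h"
    using e A by simp
  show "hnorm T (ampliation K H T \<tau> M z) \<le> C * hnorm T z"
    if C: "0 \<le> C" "\<And>x. x \<in> hcarrier K \<Longrightarrow> hnorm K (M x) \<le> C * hnorm K x" "z \<in> hcarrier T"
  proof -
    \<comment> \<open>The operator built with this particular \<open>C\<close> is the ampliation by
      uniqueness, so every bound for \<open>M\<close> is inherited and not only the one chosen
      above.\<close>
    obtain A' where A': "A' \<in> bdd_ops T T" "\<And>x h. x \<in> hcarrier K \<Longrightarrow> h \<in> hcarrier H \<Longrightarrow> A' (\<tau> x h) = \<tau> (M x) h"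
      "\<And>z. z \<in> hcarrier T \<Longrightarrow> hnorm T (A' z) \<le> C * hnorm T z"
      using ampliation_ex[OF M C(1,2)] by blast
    show ?thesis using A'(3)[OF C(3)] ampliation_eqI[OF A'(1,2)] by simp
  qed
qed

end

text \<open>Closure under limits is part of the induction, so limits of limits are included. The
  radial calculus needs this: each value at a scaled tuple is already a limit.\<close>

inductive_set sot_alg :: "('a::ab_group_add) hilb \<Rightarrow> ('n \<Rightarrow> 'a \<Rightarrow> 'a) \<Rightarrow> ('a \<Rightarrow> 'a) set"
  for V X where
  ident: "on_carrier V (\<lambda>x. x) \<in> sot_alg V X"
| var: "X i \<in> sot_alg V X"
| add: "S \<in> sot_alg V X \<Longrightarrow> T \<in> sot_alg V X \<Longrightarrow> (\<lambda>x. S x + T x) \<in> sot_alg V X"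
| scale: "S \<in> sot_alg V X \<Longrightarrow> (\<lambda>x. hscale V c (S x)) \<in> sot_alg V X"
| comp: "S \<in> sot_alg V X \<Longrightarrow> T \<in> sot_alg V X \<Longrightarrow> S \<circ> T \<in> sot_alg V X"
| lim: "(\<And>m::nat. T m \<in> sot_alg V X) \<Longrightarrow> sot_tendsto V T sequentially L \<Longrightarrow> L \<in> sot_alg V X"

lemma (in hilbert_space) sot_alg_bdd_ops:
  assumes X: "\<And>i. X i \<in> bdd_ops V V"
  shows "A \<in> sot_alg V X \<Longrightarrow> A \<in> bdd_ops V V"
proof (induction rule: sot_alg.induct)
  case (comp S T)
  then show ?case using ops_comp hilbert_space_axioms by blast
qed (use X hilbert_pair.ops_add[of V V] hilbert_pair.ops_scale[of V V] ops_id hilbert_space_axioms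
    in \<open>auto simp: hilbert_pair_def sot_tendsto_def\<close>)

text \<open>The uniform boundedness principle is what lets strong limits pass to the ampliations.\<close>

lemma (in tensor_product) sot_alg_invariant:
  assumes N: "closed_subspace T N" and X: "\<And>i. X i \<in> bdd_ops K K"
    and inv: "\<And>i z. z \<in> N \<Longrightarrow> ampliation K H T \<tau> (X i) z \<in> N"
  shows "A \<in> sot_alg K X \<Longrightarrow> z \<in> N \<Longrightarrow> ampliation K H T \<tau> A z \<in> N"
proof (induction arbitrary: z rule: sot_alg.induct)
  case ident
  have "ampliation K H T \<tau> (on_carrier K (\<lambda>x. x)) = on_carrier T (\<lambda>x. x)"
    by (rule ampliation_eqI[OF T.ops_id]) (simp add: on_carrier_def)
  then show ?case using ident T.closed_subspaceD(3)[OF N] by (simp add: on_carrier_def)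
next
  case (var i)
  then show ?case by (rule inv)
next
  case (add A B)
  note a = K.sot_alg_bdd_ops[OF X add(1)] and b = K.sot_alg_bdd_ops[OF X add(2)]
  have "ampliation K H T \<tau> (\<lambda>x. A x + B x) = (\<lambda>z. ampliation K H T \<tau> A z + ampliation K H T \<tau> B z)"
    by (rule ampliation_eqI[OF TT.ops_add]) (auto simp: ampliation_op a b \<tau>_add bdd_opsD(1)[OF a] bdd_opsD(1)[OF b])
  then show ?case using add T.subspace_add[OF T.closed_subspaceD(1)[OF N]] by simp
next
  case (scale A c)
  note a = K.sot_alg_bdd_ops[OF X scale(1)]
  have "ampliation K H T \<tau> (\<lambda>x. hscale K c (A x)) = (\<lambda>z. hscale T c (ampliation K H T \<tau> A z))"
    by (rule ampliation_eqI[OF TT.ops_scale]) (auto simp: ampliation_op a \<tau>_scale bdd_opsD(1)[OF a])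
  then show ?case using scale T.subspace_scale[OF T.closed_subspaceD(1)[OF N]] by simp
next
  case (comp A B)
  note a = K.sot_alg_bdd_ops[OF X comp(1)] and b = K.sot_alg_bdd_ops[OF X comp(2)]
  have "ampliation K H T \<tau> (A \<circ> B) = ampliation K H T \<tau> A \<circ> ampliation K H T \<tau> B"
  proof (rule ampliation_eqI)
    show "ampliation K H T \<tau> A \<circ> ampliation K H T \<tau> B \<in> bdd_ops T T"
      using ops_comp T.hilbert_space_axioms ampliation_op(1) a b by blast
  qed (auto simp: ampliation_op a b bdd_opsD(1)[OF a] bdd_opsD(1)[OF b])
  then show ?case using comp.IH comp.prems by (simp add: o_def)
next
  case (lim S L)
  note s = K.sot_alg_bdd_ops[OF X lim(1)]
  have L: "L \<in> bdd_ops K K" and sl: "\<And>x. x \<in> hcarrier K \<Longrightarrow> (\<lambda>m. hnorm K (S m x - L x)) \<longlonglongrightarrow> 0"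
    using lim.hyps(2) by (auto simp: sot_tendsto_def)
  define D where "D m = S m - L" for m
  have D: "D m \<in> bdd_ops K K" for m unfolding D_def using s L by (rule KK.ops_minus)
  have "\<exists>C\<ge>0. \<forall>n. \<forall>x\<in>hcarrier K. hnorm K (D n x) \<le> C * hnorm K x"
  proof (rule KK.uniform_boundedness[OF D])
    fix x assume "x \<in> hcarrier K"
    then have "Bseq (\<lambda>m. hnorm K (D m x))"
      using sl by (auto simp: D_def intro!: convergent_imp_Bseq convergentI)
    then show "\<exists>M. \<forall>n. hnorm K (D n x) \<le> M" unfolding Bseq_def by (metis abs_le_D1 real_norm_def)
  qed
  then obtain C where C: "0 \<le> C" "\<And>n x. x \<in> hcarrier K \<Longrightarrow> hnorm K (D n x) \<le> C * hnorm K x" by blast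
  note aD = ampliation_op[OF D]
  have zT: "z \<in> hcarrier T" using T.closed_subspaceD(3)[OF N] lim.prems .
  \<comment> \<open>The ampliations of \<open>D m\<close> share the bound \<open>C\<close>, so only
    elementary tensors have to be tested; there the claim is strong convergence in \<open>K\<close>
    multiplied by \<open>hnorm H h\<close>.\<close>
  have "(\<lambda>m. hnorm T (ampliation K H T \<tau> (D m) z)) \<longlonglongrightarrow> 0"
  proof (rule TT.ops_tendsto_zero_if_total[OF aD(1) aD(3)[OF C] \<tau>_total _ zT])
    fix d assume "d \<in> {\<tau> x h |x h. x \<in> hcarrier K \<and> h \<in> hcarrier H}"
    then obtain x h where xh: "d = \<tau> x h" "x \<in> hcarrier K" "h \<in> hcarrier H" by blast
    have "(\<lambda>m. hnorm K (D m x) * hnorm H h) \<longlonglongrightarrow> 0"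
      using tendsto_mult_right[OF sl[OF xh(2)], of "hnorm H h"] by (simp add: D_def)
    then show "(\<lambda>m. hnorm T (ampliation K H T \<tau> (D m) d)) \<longlonglongrightarrow> 0"
      using xh bdd_opsD(1)[OF D] by (simp add: aD(2) \<tau>_norm)
  qed
  moreover have "ampliation K H T \<tau> (D m) = ampliation K H T \<tau> (S m) - ampliation K H T \<tau> L" for m
  proof (rule ampliation_eqI[OF TT.ops_minus])
    fix x h assume xh: "x \<in> hcarrier K" "h \<in> hcarrier H"
    note mem = bdd_opsD(1)[OF s xh(1), of m] bdd_opsD(1)[OF L xh(1)]
    have "\<tau> (S m x) h = \<tau> (D m x) h + \<tau> (L x) h"
      using \<tau>_add[of "D m x" "L x" h] mem xh bdd_opsD(1)[OF D xh(1)] by (simp add: D_def)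
    then show "(ampliation K H T \<tau> (S m) - ampliation K H T \<tau> L) (\<tau> x h) = \<tau> (D m x) h"
      using xh by (simp add: ampliation_op(2)[OF s] ampliation_op(2)[OF L])
  qed (auto simp: ampliation_op s L)
  ultimately have "(\<lambda>m. hnorm T (ampliation K H T \<tau> (S m) z - ampliation K H T \<tau> L z)) \<longlonglongrightarrow> 0" by simp
  moreover have "ampliation K H T \<tau> L z \<in> hcarrier T" using bdd_opsD(1)[OF ampliation_op(1)[OF L] zT] .
  ultimately show ?case
    using T.closed_subspaceD(4)[OF N, of "\<lambda>m. ampliation K H T \<tau> (S m) z"] lim.IH lim.prems by blast
qed

text \<open>Intertwining turns the ampliation on \<open>KH\<close>, applied to a value of
  \<open>\<Psi>\<close>, into a value of \<open>\<Psi>\<close> at another vector of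
  \<open>KE\<close>.\<close>

lemma beurling_rep_invariant:
  assumes K: "hilbert_space K" and MZ: "\<And>i. MZ i \<in> bdd_ops K K" and rep: "beurling_rep K MZ H KH \<tau> N E KE \<sigma> \<Psi>"
  shows "invariant_under_ampliations K MZ H KH \<tau> N"
proof -
  have E: "hilbert_space E" "hilbert_tensor K E KE \<sigma>" and N: "N = \<Psi> ` hcarrier KE"
    and comm: "\<And>i x. x \<in> hcarrier KE \<Longrightarrow>
      \<Psi> (ampliation K E KE \<sigma> (MZ i) x) = ampliation K H KH \<tau> (MZ i) (\<Psi> x)"
    using rep by (auto simp: beurling_rep_def inner_multi_analytic_def multi_analytic_def)
  interpret tensor_product K E KE \<sigma>
    using K E by (simp add: tensor_product_def tensor_product_axioms_def hilbert_tensor_def)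
  show ?thesis
    unfolding invariant_under_ampliations_def N
    using comm bdd_opsD(1)[OF ampliation_op(1)[OF MZ]] by (force simp flip: comm)
qed

section \<open>Invariant subspaces and wandering subspaces\<close>

context hilbert_space
begin

lemma closed_subspace_INT:
  assumes "\<And>a. a \<in> A \<Longrightarrow> closed_subspace V (N a)"
  shows "closed_subspace V {x \<in> hcarrier V. \<forall>a\<in>A. x \<in> N a}"
  unfolding closed_subspace_def
proof (intro conjI allI impI)
  show "subspace {x \<in> hcarrier V. \<forall>a\<in>A. x \<in> N a}"
    using closed_subspaceD(1)[OF assms]
    by (intro subspaceI) (auto intro: subspace_0 subspace_add subspace_scale)
  fix s l assume "(\<forall>k. s k \<in> {x \<in> hcarrier V. \<forall>a\<in>A. x \<in> N a}) \<and> l \<in> hcarrier V \<and>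
    (\<lambda>k. hnorm V (s k - l)) \<longlonglongrightarrow> 0"
  then show "l \<in> {x \<in> hcarrier V. \<forall>a\<in>A. x \<in> N a}"
    using closed_subspaceD(4)[OF assms, of _ s l] by blast
qed auto

lemma closed_subspace_Int:
  assumes "closed_subspace V M" "closed_subspace V N"
  shows "closed_subspace V (M \<inter> N)"
proof -
  have "M \<inter> N = {x \<in> hcarrier V. \<forall>b\<in>UNIV. x \<in> (if b then M else N)}"
    using closed_subspaceD(2)[OF assms(1)] by (auto simp: all_bool_eq)
  also have "closed_subspace V \<dots>" by (rule closed_subspace_INT) (use assms in auto)
  finally show ?thesis .
qed

lemma closed_subspace_orth:
  assumes "A \<subseteq> hcarrier V"
  shows "closed_subspace V {x \<in> hcarrier V. \<forall>a\<in>A. hip V x a = 0}"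
proof -
  have "{x \<in> hcarrier V. \<forall>a\<in>A. hip V x a = 0} = {x \<in> hcarrier V. \<forall>a\<in>A. x \<in> {x \<in> hcarrier V. hip V x a = 0}}"
    by blast
  also have "closed_subspace V \<dots>"
    by (rule closed_subspace_INT, rule closed_subspace_kernel, rule bf_ip) (use assms in auto)
  finally show ?thesis .
qed

text \<open>A closed subspace is its own double orthogonal complement. Membership thereby becomes
  the vanishing of bounded functionals, which can be tested on a basis.\<close>

lemma mem_closed_subspaceI:
  assumes N: "closed_subspace V N" and v: "v \<in> hcarrier V"
    and orth: "\<And>q. q \<in> hcarrier V \<Longrightarrow> (\<And>n. n \<in> N \<Longrightarrow> hip V n q = 0) \<Longrightarrow> hip V v q = 0"
  shows "v \<in> N"
proof -
  obtain p where p: "p \<in> N" "\<And>n. n \<in> N \<Longrightarrow> hip V (v - p) n = 0" using projection[OF N v] by blast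
  have pC: "p \<in> hcarrier V" and q: "v - p \<in> hcarrier V" using p v closed_subspaceD(3)[OF N] by auto
  have *: "hip V n (v - p) = 0" if "n \<in> N" for n
    using p(2)[OF that] ip_commute_zero q closed_subspaceD(3)[OF N that] by blast
  have "hip V (v - p) (v - p) = hip V v (v - p) - hip V p (v - p)" using v pC by (simp add: ip_diff)
  then have "hip V (v - p) (v - p) = 0" using orth[OF q *] *[OF p(1)] by simp
  then have "v - p = 0" using q ip_self_eq_0_iff by blast
  then show ?thesis using p by simp
qed

end

text \<open>An isometry reflects Cauchy sequences. Closedness of the images is what permits
  projecting onto the subspaces \<open>R j N\<close>.\<close>

lemma (in hilbert_pair) closed_subspace_isometric_image:
  assumes T: "T \<in> bdd_ops V W" and N: "closed_subspace V N"
    and iso: "\<And>x. x \<in> hcarrier V \<Longrightarrow> hnorm W (T x) = hnorm V x"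
  shows "closed_subspace W (T ` N)"
  unfolding closed_subspace_def
proof (intro conjI allI impI)
  note mem = V.closed_subspaceD(3)[OF N] and sub = V.closed_subspaceD(1)[OF N]
  show "W.subspace (T ` N)"
  proof (rule W.subspaceI)
    show "0 \<in> T ` N" using ops_zero[OF T] V.subspace_0[OF sub] by force
    fix x y assume "x \<in> T ` N" "y \<in> T ` N"
    then obtain a b where "a \<in> N" "b \<in> N" "x = T a" "y = T b" by blast
    then show "x + y \<in> T ` N"
      using bdd_opsD(2)[OF T, of a b] mem V.subspace_add[OF sub] by (intro image_eqI[of _ _ "a + b"]) auto
  next
    fix c x assume "x \<in> T ` N"
    then obtain a where "a \<in> N" "x = T a" by blast
    then show "hscale W c x \<in> T ` N"
      using bdd_opsD(3)[OF T, of a c] mem V.subspace_scale[OF sub] by (intro image_eqI[of _ _ "hscale V c a"]) auto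
  qed
  show "T ` N \<subseteq> hcarrier W" using mem bdd_opsD(1)[OF T] by blast
  fix s l assume a: "(\<forall>k. s k \<in> T ` N) \<and> l \<in> hcarrier W \<and> (\<lambda>k. hnorm W (s k - l)) \<longlonglongrightarrow> 0"
  then have "\<forall>k. \<exists>n. n \<in> N \<and> s k = T n" by blast
  then obtain t where t: "\<And>k. t k \<in> N" "\<And>k. s k = T (t k)" by metis
  have l: "l \<in> hcarrier W" "(\<lambda>k. hnorm W (s k - l)) \<longlonglongrightarrow> 0" using a by auto
  have tC: "t k \<in> hcarrier V" for k using t mem by blast
  have sC: "s k \<in> hcarrier W" for k using t(2) bdd_opsD(1)[OF T tC] by simp
  have d: "hnorm V (t j - t k) = hnorm W (s j - s k)" for j k
    using iso[of "t j - t k"] tC by (simp add: t(2) ops_diff[OF T])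
  have "\<exists>n\<in>hcarrier V. (\<lambda>k. hnorm V (t k - n)) \<longlonglongrightarrow> 0"
  proof (rule V.complete[OF tC])
    fix r :: real assume "0 < r"
    then obtain M where M: "\<And>k. k \<ge> M \<Longrightarrow> hnorm W (s k - l) < r / 2"
      using order_tendstoD(2)[OF l(2), of "r/2"] by (auto simp: eventually_sequentially)
    show "\<exists>M. \<forall>j\<ge>M. \<forall>k\<ge>M. hnorm V (t j - t k) < r"
    proof (intro exI allI impI)
      fix j k assume "M \<le> j" "M \<le> k"
      then show "hnorm V (t j - t k) < r" unfolding d
        using M[of j] M[of k] W.hnorm_triangle_via[of "s j" l "s k"] W.hnorm_minus_commute[of l "s k"] l sC by simp
    qed
  qed
  then obtain n where n: "n \<in> hcarrier V" "(\<lambda>k. hnorm V (t k - n)) \<longlonglongrightarrow> 0" by blast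
  have nN: "n \<in> N" using V.closed_subspaceD(4)[OF N, of t n] t n by blast
  have "(\<lambda>k. hnorm W (s k - T n)) \<longlonglongrightarrow> 0"
  proof -
    have "hnorm W (s k - T n) = hnorm V (t k - n)" for k
      using iso[of "t k - n"] tC n by (simp add: t(2) ops_diff[OF T])
    then show ?thesis using n(2) by simp
  qed
  then have "l = T n" using W.hlim_unique[OF sC l(1) bdd_opsD(1)[OF T n(1)] l(2)] by simp
  then show "l \<in> T ` N" using nN by blast
qed

text \<open>The vectors e are the copies of the \<open>f\<^sub>\<alpha>\<close>, and S consists of the left multiplications by the
  \<open>f\<^sub>j\<close>.  The last two assumptions say that \<open>MZ i\<close> commutes with the right creation operators
  \<open>e\<^sub>\<alpha> \<mapsto> e\<^bsub>\<alpha>\<gamma>\<^esub>\<close>.\<close>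

locale creation_model = K: hilbert_space K
  for K :: "('k::ab_group_add) hilb" and MZ :: "'n::finite \<Rightarrow> 'k \<Rightarrow> 'k" +
  fixes e :: "'n list \<Rightarrow> 'k" and S :: "'n \<Rightarrow> 'k \<Rightarrow> 'k"
  assumes MZ: "\<And>i. MZ i \<in> bdd_ops K K"
    and S_alg: "\<And>j. S j \<in> sot_alg K MZ"
    and S_e: "\<And>j w. S j (e w) = e (j # w)"
    and e_carrier [simp]: "\<And>w. e w \<in> hcarrier K"
    and e_ip: "\<And>v w. hip K (e v) (e w) = (if v = w then 1 else 0)"
    and e_total: "htotal K (range e)"
    and MZ_shift: "\<And>i \<alpha> \<beta> \<gamma>. hip K (MZ i (e (\<beta> @ \<gamma>))) (e (\<alpha> @ \<gamma>)) = hip K (MZ i (e \<beta>)) (e \<alpha>)"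
    and MZ_zero: "\<And>i \<beta> \<gamma> \<delta>. (\<nexists>\<alpha>. \<delta> = \<alpha> @ \<gamma>) \<Longrightarrow> hip K (MZ i (e (\<beta> @ \<gamma>))) (e \<delta>) = 0"

section \<open>Wold decomposition of an invariant subspace\<close>

locale creation_model_invariant =
  creation_model K MZ e S + tensor_product K H T \<tau>
  for K :: "('k::ab_group_add) hilb" and MZ :: "'n::finite \<Rightarrow> 'k \<Rightarrow> 'k" and e S
    and H :: "('h::ab_group_add) hilb" and T :: "('t::ab_group_add) hilb" and \<tau> +
  fixes N :: "'t set"
  assumes N: "closed_subspace T N"
    and N_inv: "invariant_under_ampliations K MZ H T \<tau> N"
begin

abbreviation D :: "'n \<Rightarrow> 't \<Rightarrow> 't" where "D i \<equiv> ampliation K H T \<tau> (MZ i)"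
abbreviation R :: "'n \<Rightarrow> 't \<Rightarrow> 't" where "R j \<equiv> ampliation K H T \<tau> (S j)"

primrec Rw :: "'n list \<Rightarrow> 't \<Rightarrow> 't" where
  "Rw [] = on_carrier T (\<lambda>z. z)"
| "Rw (j # w) = R j \<circ> Rw w"

lemma S_op: "S j \<in> bdd_ops K K"
  using K.sot_alg_bdd_ops[OF MZ S_alg] .

lemmas R_op = ampliation_op(1)[OF S_op]
  and D_op = ampliation_op(1)[OF MZ]

lemma R_e: "h \<in> hcarrier H \<Longrightarrow> R j (\<tau> (e w) h) = \<tau> (e (j # w)) h"
  by (simp add: ampliation_op(2)[OF S_op] S_e)

lemma NT: "z \<in> N \<Longrightarrow> z \<in> hcarrier T"
  using T.closed_subspaceD(3)[OF N] .

lemma D_N: "z \<in> N \<Longrightarrow> D i z \<in> N"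
  using N_inv by (auto simp: invariant_under_ampliations_def)

lemma R_N: "z \<in> N \<Longrightarrow> R j z \<in> N"
  using sot_alg_invariant[OF N MZ D_N S_alg] .

definition eh :: "'t set" where "eh = {\<tau> (e w) h |w h. h \<in> hcarrier H}"

lemma eh_total: "htotal T eh"
proof -
  have "eh = {\<tau> d h |d h. d \<in> range e \<and> h \<in> hcarrier H}" by (auto simp: eh_def)
  then show ?thesis using \<tau>_total_if_total[OF e_total] by simp
qed

lemma eq_if_coeffs:
  assumes "z \<in> hcarrier T" "z' \<in> hcarrier T"
    and "\<And>w h. h \<in> hcarrier H \<Longrightarrow> hip T z (\<tau> (e w) h) = hip T z' (\<tau> (e w) h)"
  shows "z = z'"
proof -
  have "z - z' = 0"
  proof (rule T.htotal_ip_zero[OF eh_total])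
    fix d assume "d \<in> eh"
    then obtain w h where d: "d = \<tau> (e w) h" "h \<in> hcarrier H" by (auto simp: eh_def)
    then have "hip T (z - z') d = 0" using assms by (simp add: T.ip_diff)
    then show "hip T d (z - z') = 0" using T.ip_commute_zero[of "z - z'" d] assms d by simp
  qed (use assms in simp)
  then show ?thesis by simp
qed

text \<open>On the tensors \<open>\<tau> (e w) h\<close> this is orthonormality of the basis after
  one more letter has been put in front. It says that the \<open>R j\<close> are isometries with
  mutually orthogonal ranges.\<close>

lemma R_ip:
  assumes "z \<in> hcarrier T" "z' \<in> hcarrier T"
  shows "hip T (R i z) (R j z') = (if i = j then 1 else 0) * hip T z z'"
proof (rule TT.ip_ops_eq_if_total[OF R_op R_op eh_total _ assms])
  fix d d' assume "d \<in> eh" "d' \<in> eh"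
  then show "hip T (R i d) (R j d') = (if i = j then 1 else 0) * hip T d d'"
    by (auto simp: eh_def R_e \<tau>_ip e_ip)
qed

text \<open>Every basis vector reached by \<open>S j\<close> carries at least one letter. This is
  the property that later rules out a unitary part in the Wold decomposition.\<close>

lemma R_ip_nil:
  assumes z: "z \<in> hcarrier T" and h: "h \<in> hcarrier H"
  shows "hip T (R j z) (\<tau> (e []) h) = 0"
  by (rule T.bf_zero_if_total[OF TT.bf_ip_op[OF R_op] eh_total _ z])
    (use h in \<open>auto simp: eh_def R_e \<tau>_ip e_ip\<close>)

lemma R_ip_Cons:
  assumes z: "z \<in> hcarrier T" and h: "h \<in> hcarrier H"
  shows "hip T (R i z) (\<tau> (e (j # w)) h) = (if i = j then hip T z (\<tau> (e w) h) else 0)"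
  using R_ip[OF z, of "\<tau> (e w) h" i j] h by (simp add: R_e)

lemma Rw_op: "Rw w \<in> bdd_ops T T"
  by (induction w) (auto intro!: T.ops_id ops_comp[OF _ _ _ R_op] T.hilbert_space_axioms simp del: comp_apply)

lemma Rw_N: "z \<in> N \<Longrightarrow> Rw w z \<in> N"
  by (induction w) (auto simp: R_N on_carrier_def NT)

lemma Rw_e: "h \<in> hcarrier H \<Longrightarrow> Rw v (\<tau> (e w) h) = \<tau> (e (v @ w)) h"
  by (induction v) (auto simp: on_carrier_def R_e)

text \<open>\<open>Rw v\<close> prepends \<open>v\<close> to each basis word, so the coefficient at
  \<open>w\<close> is read from \<open>z\<close> after cancelling the prefix, and is zero if
  \<open>v\<close> is not a prefix.\<close>

lemma Rw_coeff:
  assumes z: "z \<in> hcarrier T" and h: "h \<in> hcarrier H"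
  shows "hip T (Rw v z) (\<tau> (e w) h) =
    (if take (length v) w = v then hip T z (\<tau> (e (drop (length v) w)) h) else 0)"
proof (induction v arbitrary: w)
  case Nil
  then show ?case using z by (simp add: on_carrier_def)
next
  case (Cons j v)
  have m: "Rw v z \<in> hcarrier T" using bdd_opsD(1)[OF Rw_op z] .
  show ?case by (cases w) (auto simp: R_ip_nil[OF m h] R_ip_Cons[OF m h] Cons)
qed

definition wand :: "'t set" where
  "wand = N \<inter> {y \<in> hcarrier T. \<forall>a\<in>{R j z |j z. z \<in> N}. hip T y a = 0}"

lemma wand_closed: "closed_subspace T wand"
  unfolding wand_def
  by (intro T.closed_subspace_Int N T.closed_subspace_orth) (auto intro: NT R_N)

lemma wandD: "y \<in> wand \<Longrightarrow> y \<in> N" "y \<in> wand \<Longrightarrow> z \<in> N \<Longrightarrow> hip T y (R j z) = 0"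
  "y \<in> wand \<Longrightarrow> y \<in> hcarrier T"
  by (auto simp: wand_def)

text \<open>Equal first letters cancel and distinct ones give orthogonal ranges. When one word runs
  out before the other, the remaining vector lies in some \<open>R j N\<close>, to which wandering
  vectors are orthogonal.\<close>

lemma wand_ip:
  assumes y: "y \<in> wand" and y': "y' \<in> wand"
  shows "hip T (Rw v y) (Rw w y') = (if v = w then hip T y y' else 0)"
proof (induction v arbitrary: w)
  case Nil
  show ?case
    using wandD(3)[OF y] wandD(3)[OF y'] wandD(2)[OF y] Rw_N[OF wandD(1)[OF y']]
    by (cases w) (auto simp: on_carrier_def)
next
  case (Cons i v)
  have m: "Rw u x \<in> hcarrier T" "Rw u x \<in> N" if "x \<in> wand" for u x
    using Rw_N[OF wandD(1)[OF that]] NT by auto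
  show ?case
  proof (cases w)
    case Nil
    have "hip T y' (R i (Rw v y)) = 0" using wandD(2)[OF y'] m[OF y] by blast
    then show ?thesis
      using Nil T.ip_commute_zero[of y' "R i (Rw v y)"] wandD(3)[OF y'] NT[OF R_N[OF m(2)[OF y]]]
      by (simp add: on_carrier_def)
  next
    case (Cons j u)
    then show ?thesis using R_ip[OF m(1)[OF y] m(1)[OF y'], of i v j u] Cons.IH by simp
  qed
qed

text \<open>For wandering \<open>y\<close> this is the slice of \<open>\<Psi>\<close> that sends
  \<open>x\<close> to the image of \<open>x \<otimes> y\<close>. Slices can be defined on
  \<open>K\<close> before any tensor product with \<open>E\<close> is available.\<close>

definition Ty :: "'t \<Rightarrow> 'k \<Rightarrow> 't" where
  "Ty y = (SOME A. A \<in> bdd_ops K T \<and> (\<forall>w. A (e w) = Rw w y))"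

lemma Ty:
  assumes y: "y \<in> wand"
  shows "Ty y \<in> bdd_ops K T" "Ty y (e w) = Rw w y"
proof -
  define P where "P = {(e w, Rw w y) |w. True}"
  have P: "P \<subseteq> hcarrier K \<times> hcarrier T" using NT[OF Rw_N[OF wandD(1)[OF y]]] by (auto simp: P_def)
  have "fst ` P = range e" by (force simp: P_def)
  then have total: "htotal K (fst ` P)" using e_total by simp
  have yT: "y \<in> hcarrier T" using wandD(3)[OF y] .
  have iso: "hip T b b' = of_real ((hnorm T y)\<^sup>2) * hip K a a'" if "(a, b) \<in> P" "(a', b') \<in> P" for a b a' b'
    using that by (auto simp: P_def wand_ip[OF y y] e_ip T.ip_self[OF yT])
  obtain A where "A \<in> bdd_ops K T" "\<And>a b. (a, b) \<in> P \<Longrightarrow> A a = b"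
    using KT.scaled_isometry_extension[OF P total iso] by blast
  then have "\<exists>A. A \<in> bdd_ops K T \<and> (\<forall>w. A (e w) = Rw w y)" by (auto simp: P_def)
  from someI_ex[OF this] show "Ty y \<in> bdd_ops K T" "Ty y (e w) = Rw w y" by (auto simp: Ty_def)
qed

lemma Ty_ip:
  assumes y: "y \<in> wand" and y': "y' \<in> wand" and x: "x \<in> hcarrier K" "x' \<in> hcarrier K"
  shows "hip T (Ty y x) (Ty y' x') = hip K x x' * hip T y y'"
proof -
  have "hip T (Ty y x) (Ty y' x') = hip T y y' * hip K x x'"
    by (rule KT.ip_ops_eq_if_total[OF Ty(1)[OF y] Ty(1)[OF y'] e_total _ x])
      (auto simp: Ty y y' wand_ip e_ip)
  then show ?thesis by (simp add: mult.commute)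
qed

text \<open>A vector orthogonal to \<open>N\<close> annihilates every \<open>Rw w y\<close>, hence
  the whole range of \<open>Ty y\<close>.\<close>

lemma Ty_N:
  assumes y: "y \<in> wand" and x: "x \<in> hcarrier K"
  shows "Ty y x \<in> N"
proof (rule T.mem_closed_subspaceI[OF N])
  show "Ty y x \<in> hcarrier T" using bdd_opsD(1)[OF Ty(1)[OF y] x] .
  fix q assume q: "q \<in> hcarrier T" "\<And>n. n \<in> N \<Longrightarrow> hip T n q = 0"
  show "hip T (Ty y x) q = 0"
    by (rule K.bf_zero_if_total[OF KT.bf_ip_op[OF Ty(1)[OF y] q(1)] e_total _ x])
      (use Ty(2)[OF y] q(2) Rw_N[OF wandD(1)[OF y]] in auto)
qed

text \<open>\<open>Ty\<close> is obtained by choice, but its values on the basis determine it, so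
  linearity in \<open>y\<close> is inherited from \<open>Rw w\<close>.\<close>

lemma Ty_add:
  assumes y: "y \<in> wand" "y' \<in> wand"
  shows "Ty (y + y') x = Ty y x + Ty y' x"
proof -
  have s: "y + y' \<in> wand" using T.subspace_add[OF T.closed_subspaceD(1)[OF wand_closed] y] .
  have "Ty (y + y') = (\<lambda>x. Ty y x + Ty y' x)"
    by (rule KT.ops_eq_if_total[OF Ty(1)[OF s] KT.ops_add[OF Ty(1)[OF y(1)] Ty(1)[OF y(2)]] e_total])
      (use Ty(2) s y bdd_opsD(2)[OF Rw_op] wandD(3) in auto)
  then show ?thesis by simp
qed

lemma Ty_scale:
  assumes y: "y \<in> wand"
  shows "Ty (hscale T c y) x = hscale T c (Ty y x)"
proof -
  have s: "hscale T c y \<in> wand" using T.subspace_scale[OF T.closed_subspaceD(1)[OF wand_closed] y] .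
  have "Ty (hscale T c y) = (\<lambda>x. hscale T c (Ty y x))"
    by (rule KT.ops_eq_if_total[OF Ty(1)[OF s] KT.ops_scale[OF Ty(1)[OF y]] e_total])
      (use Ty(2) s y bdd_opsD(3)[OF Rw_op] wandD(3) in auto)
  then show ?thesis by simp
qed

text \<open>Both sides are bounded functionals of \<open>x\<close>. At \<open>x = e \<beta>\<close>
  only the cut of \<open>\<delta>\<close> after \<open>length \<beta>\<close> letters can
  contribute, and only if \<open>\<beta>\<close> is a prefix.\<close>

lemma Ty_coeff:
  assumes y: "y \<in> wand" and x: "x \<in> hcarrier K" and h: "h \<in> hcarrier H"
  shows "hip T (Ty y x) (\<tau> (e \<delta>) h) =
    (\<Sum>k\<le>length \<delta>. hip K x (e (take k \<delta>)) * hip T y (\<tau> (e (drop k \<delta>)) h))"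
proof (rule K.bf_eq_if_total[OF KT.bf_ip_op[OF Ty(1)[OF y]] K.bf_sum e_total _ x])
  fix k show "(\<lambda>x. hip K x (e (take k \<delta>)) * hip T y (\<tau> (e (drop k \<delta>)) h)) \<in> bdd_functionals K"
    using K.bf_cmult[OF K.bf_ip[OF e_carrier], of "hip T y (\<tau> (e (drop k \<delta>)) h)" "take k \<delta>"] by (simp add: mult.commute)
next
  fix d assume "d \<in> range e"
  then obtain \<beta> where d: "d = e \<beta>" by blast
  have "(\<Sum>k\<le>length \<delta>. hip K (e \<beta>) (e (take k \<delta>)) * hip T y (\<tau> (e (drop k \<delta>)) h))
      = (\<Sum>k\<le>length \<delta>. if k = length \<beta> \<and> take (length \<beta>) \<delta> = \<beta> then hip T y (\<tau> (e (drop (length \<beta>) \<delta>)) h) else 0)"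
    by (rule sum.cong) (auto simp: e_ip min_def)
  also have "\<dots> = (if take (length \<beta>) \<delta> = \<beta> then hip T y (\<tau> (e (drop (length \<beta>) \<delta>)) h) else 0)"
    by (cases "take (length \<beta>) \<delta> = \<beta>") (auto simp: sum.delta dest: arg_cong[of _ _ length])
  finally show "hip T (Ty y d) (\<tau> (e \<delta>) h) =
      (\<Sum>k\<le>length \<delta>. hip K d (e (take k \<delta>)) * hip T y (\<tau> (e (drop k \<delta>)) h))"
    using d Ty(2)[OF y] Rw_coeff[OF wandD(3)[OF y] h] by simp
qed (use h in simp)

text \<open>Both sides are bounded functionals of \<open>y\<close>, tested at
  \<open>y = \<tau> (e \<gamma>) h'\<close>. If \<open>\<delta>\<close> ends in
  \<open>\<gamma>\<close>, then \<open>MZ_shift\<close> cancels that suffix and one cut of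
  \<open>\<delta>\<close> survives; otherwise \<open>MZ_zero\<close> makes everything
  vanish.\<close>

lemma D_Rw_coeff:
  assumes y: "y \<in> hcarrier T" and h: "h \<in> hcarrier H"
  shows "hip T (D i (Rw \<beta> y)) (\<tau> (e \<delta>) h) =
    (\<Sum>k\<le>length \<delta>. hip K (MZ i (e \<beta>)) (e (take k \<delta>)) * hip T y (\<tau> (e (drop k \<delta>)) h))"
proof -
  have DR: "D i \<circ> Rw \<beta> \<in> bdd_ops T T"
    using ops_comp[OF T.hilbert_space_axioms T.hilbert_space_axioms T.hilbert_space_axioms D_op Rw_op] .
  have "hip T ((D i \<circ> Rw \<beta>) y) (\<tau> (e \<delta>) h) =
    (\<Sum>k\<le>length \<delta>. hip K (MZ i (e \<beta>)) (e (take k \<delta>)) * hip T y (\<tau> (e (drop k \<delta>)) h))"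
  proof (rule T.bf_eq_if_total[OF TT.bf_ip_op[OF DR] T.bf_sum[OF T.bf_cmult[OF T.bf_ip]] eh_total _ y])
    fix d assume "d \<in> eh"
    then obtain \<gamma> h' where d: "d = \<tau> (e \<gamma>) h'" "h' \<in> hcarrier H" by (auto simp: eh_def)
    have m: "MZ i (e w) \<in> hcarrier K" for w using bdd_opsD(1)[OF MZ e_carrier] .
    have l: "hip T ((D i \<circ> Rw \<beta>) d) (\<tau> (e \<delta>) h) = hip K (MZ i (e (\<beta> @ \<gamma>))) (e \<delta>) * hip H h' h"
      using d h m by (simp add: Rw_e ampliation_op(2)[OF MZ] \<tau>_ip)
    have r: "hip T d (\<tau> (e w) h) = (if \<gamma> = w then hip H h' h else 0)" for w
      using d h by (simp add: \<tau>_ip e_ip)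
    show "hip T ((D i \<circ> Rw \<beta>) d) (\<tau> (e \<delta>) h) =
        (\<Sum>k\<le>length \<delta>. hip K (MZ i (e \<beta>)) (e (take k \<delta>)) * hip T d (\<tau> (e (drop k \<delta>)) h))"
    proof (cases "\<exists>\<alpha>. \<delta> = \<alpha> @ \<gamma>")
      case True
      then obtain \<alpha> where \<alpha>: "\<delta> = \<alpha> @ \<gamma>" by blast
      have "(\<Sum>k\<le>length \<delta>. hip K (MZ i (e \<beta>)) (e (take k \<delta>)) * hip T d (\<tau> (e (drop k \<delta>)) h))
          = (\<Sum>k\<le>length \<delta>. if k = length \<alpha> then hip K (MZ i (e \<beta>)) (e \<alpha>) * hip H h' h else 0)"
      proof (rule sum.cong)
        fix k assume k: "k \<in> {..length \<delta>}"
        have "k = length \<alpha>" if "\<gamma> = drop k \<delta>"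
        proof -
          have "length \<gamma> = length (drop k \<delta>)" using that by simp
          then show ?thesis using k \<alpha> by simp
        qed
        then show "hip K (MZ i (e \<beta>)) (e (take k \<delta>)) * hip T d (\<tau> (e (drop k \<delta>)) h) =
            (if k = length \<alpha> then hip K (MZ i (e \<beta>)) (e \<alpha>) * hip H h' h else 0)"
          using \<alpha> by (cases "k = length \<alpha>") (simp_all add: r, metis)
      qed simp
      then show ?thesis unfolding l using \<alpha> by (simp add: MZ_shift)
    next
      case False
      have "hip T d (\<tau> (e (drop k \<delta>)) h) = 0" for k
        unfolding r using False append_take_drop_id[of k \<delta>] by metis
      then show ?thesis unfolding l using MZ_zero[OF False] by simp
    qed
  qed (use h in auto)
  then show ?thesis by simp
qed

text \<open>At a basis vector \<open>e \<beta>\<close>, \<open>Ty_coeff\<close> with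
  \<open>x = MZ i (e \<beta>)\<close> and \<open>D_Rw_coeff\<close> give the same finite sum for
  every coefficient. This is the intertwining relation for \<open>\<Psi>\<close>, slice by
  slice.\<close>

lemma Ty_MZ:
  assumes y: "y \<in> wand" and x: "x \<in> hcarrier K"
  shows "Ty y (MZ i x) = D i (Ty y x)"
proof -
  note hs = K.hilbert_space_axioms T.hilbert_space_axioms
  have "Ty y \<circ> MZ i = D i \<circ> Ty y"
  proof (rule KT.ops_eq_if_total[OF _ _ e_total])
    show "Ty y \<circ> MZ i \<in> bdd_ops K T" using ops_comp[OF hs(1,1,2) Ty(1)[OF y] MZ] .
    show "D i \<circ> Ty y \<in> bdd_ops K T" using ops_comp[OF hs(1,2,2) D_op Ty(1)[OF y]] .
    fix d assume "d \<in> range e"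
    then obtain \<beta> where d: "d = e \<beta>" by blast
    have m: "MZ i d \<in> hcarrier K" using d bdd_opsD(1)[OF MZ e_carrier] by simp
    have "Ty y (MZ i d) = D i (Rw \<beta> y)"
    proof (rule eq_if_coeffs)
      show "Ty y (MZ i d) \<in> hcarrier T" using bdd_opsD(1)[OF Ty(1)[OF y] m] .
      show "D i (Rw \<beta> y) \<in> hcarrier T" using bdd_opsD(1)[OF D_op bdd_opsD(1)[OF Rw_op wandD(3)[OF y]]] .
      show "hip T (Ty y (MZ i d)) (\<tau> (e w) h) = hip T (D i (Rw \<beta> y)) (\<tau> (e w) h)"
        if "h \<in> hcarrier H" for w h
        using Ty_coeff[OF y m that] D_Rw_coeff[OF wandD(3)[OF y] that] d by simp
    qed
    then show "(Ty y \<circ> MZ i) d = (D i \<circ> Ty y) d" using d Ty(2)[OF y] by simp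
  qed
  then show ?thesis by (simp add: fun_eq_iff)
qed

text \<open>\<open>R j (g j)\<close> is the projection of \<open>z\<close> on \<open>R j N\<close>.
  After subtracting all of them the residual is a wandering vector; it is orthogonal to
  \<open>z\<close> by hypothesis and to the projections by construction, hence zero.\<close>

lemma N_decomposition:
  assumes z: "z \<in> N" and orth: "\<And>y. y \<in> wand \<Longrightarrow> hip T z y = 0"
  shows "\<exists>g. (\<forall>j. g j \<in> N) \<and> z = (\<Sum>j\<in>UNIV. R j (g j))"
proof -
  have iso: "hnorm T (R j x) = hnorm T x" if "x \<in> hcarrier T" for j x
    using R_ip[OF that that, of j j] by (simp add: hnorm_def)
  have "\<exists>n\<in>N. \<forall>m\<in>N. hip T (z - R j n) (R j m) = 0" for j
    using T.projection[OF TT.closed_subspace_isometric_image[OF R_op N iso] NT[OF z], of j] by blast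
  then obtain g where g: "\<And>j. g j \<in> N" "\<And>j m. m \<in> N \<Longrightarrow> hip T (z - R j (g j)) (R j m) = 0"
    by metis
  define p where "p = (\<Sum>j\<in>UNIV. R j (g j))"
  have RC: "R j m \<in> hcarrier T" if "m \<in> N" for j m using NT[OF R_N[OF that]] .
  have pN: "p \<in> N" unfolding p_def
    by (intro T.subspace_sum[OF T.closed_subspaceD(1)[OF N]] R_N g(1))
  have zp: "z - p \<in> N" using T.subspace_diff[OF T.closed_subspaceD(1)[OF N] z pN] .
  have orth_R: "hip T (z - p) (R j m) = 0" if m: "m \<in> N" for j m
  proof -
    have "hip T p (R j m) = (\<Sum>i\<in>UNIV. hip T (R i (g i)) (R j m))"
      unfolding p_def using RC g(1) m by (intro T.ip_sum) auto
    also have "\<dots> = (\<Sum>i\<in>UNIV. if i = j then hip T (R j (g j)) (R j m) else 0)"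
      using R_ip[OF NT[OF g(1)] NT[OF m]] by (intro sum.cong) auto
    also have "\<dots> = hip T (R j (g j)) (R j m)" by simp
    finally show ?thesis
      using g(2)[OF m, of j] RC[OF g(1)] RC[OF m] NT[OF z] NT[OF pN] by (simp add: T.ip_diff)
  qed
  then have w: "z - p \<in> wand" using zp NT[OF zp] by (auto simp: wand_def)
  have "hip T p (z - p) = 0"
  proof -
    have "hip T (R j (g j)) (z - p) = 0" for j
      using orth_R[OF g(1)] T.ip_commute_zero[OF NT[OF zp] RC[OF g(1)]] by blast
    then show ?thesis unfolding p_def
      using RC g(1) NT[OF zp] by (subst T.ip_sum) (auto simp: p_def)
  qed
  then have "hip T (z - p) (z - p) = 0"
    using orth[OF w] NT[OF z] NT[OF pN] by (simp add: T.ip_diff)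
  then have "z = p" using T.ip_self_eq_0_iff[OF NT[OF zp]] by simp
  then show ?thesis using g(1) p_def by blast
qed

text \<open>Each use of \<open>N_decomposition\<close> strips one letter from the word at which a
  coefficient is read, and \<open>R_ip_nil\<close> ends the descent at the empty word. The induction
  varies \<open>z\<close> because the components \<open>g i\<close> take its place.\<close>

lemma wand_generates:
  assumes "z \<in> N" and "\<And>y v. y \<in> wand \<Longrightarrow> hip T z (Rw v y) = 0"
  shows "z = 0"
proof -
  have "hip T z (\<tau> (e w) h) = 0"
    if "z \<in> N" "\<And>y v. y \<in> wand \<Longrightarrow> hip T z (Rw v y) = 0" "h \<in> hcarrier H" for z w h
    using that
  proof (induction w arbitrary: z)
    case Nil
    have "hip T z y = 0" if "y \<in> wand" for y
      using Nil(2)[OF that, of "[]"] wandD(3)[OF that] by (simp add: on_carrier_def)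
    then obtain g where g: "\<And>j. g j \<in> N" "z = (\<Sum>j\<in>UNIV. R j (g j))"
      using N_decomposition[OF Nil(1)] by blast
    show ?case unfolding g(2)
      using NT[OF R_N[OF g(1)]] R_ip_nil[OF NT[OF g(1)] Nil(3)] Nil(3) by (subst T.ip_sum) auto
  next
    case (Cons i w)
    have "hip T z y = 0" if "y \<in> wand" for y
      using Cons.prems(2)[OF that, of "[]"] wandD(3)[OF that] by (simp add: on_carrier_def)
    then obtain g where g: "\<And>j. g j \<in> N" "z = (\<Sum>j\<in>UNIV. R j (g j))"
      using N_decomposition[OF Cons.prems(1)] by blast
    \<comment> \<open>Pairing \<open>z\<close> with \<open>Rw (i # v) y\<close> isolates the summand
      with index \<open>i\<close>, so \<open>g i\<close> inherits the hypothesis on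
      \<open>z\<close>.\<close>
    have "hip T (g i) (Rw v y) = 0" if y: "y \<in> wand" for v y
    proof -
      have m: "Rw v y \<in> hcarrier T" using NT[OF Rw_N[OF wandD(1)[OF y]]] .
      have "0 = hip T z (Rw (i # v) y)" using Cons.prems(2)[OF y, of "i # v"] by simp
      also have "\<dots> = (\<Sum>j\<in>UNIV. hip T (R j (g j)) (R i (Rw v y)))"
        unfolding g(2) Rw.simps comp_apply using NT[OF R_N[OF g(1)]] bdd_opsD(1)[OF R_op m] by (subst T.ip_sum) auto
      also have "\<dots> = (\<Sum>j\<in>UNIV. if j = i then hip T (g i) (Rw v y) else 0)"
        using R_ip[OF NT[OF g(1)] m] by (intro sum.cong) auto
      finally show ?thesis by simp
    qed
    then have IH: "hip T (g i) (\<tau> (e w) h) = 0" using Cons.IH g(1) Cons.prems(3) by blast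
    have "hip T z (\<tau> (e (i # w)) h) = (\<Sum>j\<in>UNIV. hip T (R j (g j)) (\<tau> (e (i # w)) h))"
      unfolding g(2) using NT[OF R_N[OF g(1)]] Cons.prems(3) by (subst T.ip_sum) auto
    also have "\<dots> = 0"
      using R_ip_Cons[OF NT[OF g(1)] Cons.prems(3)] IH by (intro sum.neutral) auto
    finally show ?case .
  qed
  then show ?thesis using assms eq_if_coeffs[of z 0] NT by simp
qed

text \<open>\<open>H\<^sup>2(f) \<otimes> E\<close> is realized on a copy of N, consisting of constant functions, in which
  \<open>x \<otimes> y\<close> is \<open>Ty y x\<close>.\<close>

definition constN :: "('n list \<Rightarrow> 't) set" where "constN = (\<lambda>v _. v) ` N"

text \<open>The functions in the carrier are constant, so evaluation at \<open>[]\<close> recovers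
  the vector of \<open>N\<close>, and the inner product is that of \<open>T\<close>.\<close>

definition KE :: "('n list \<Rightarrow> 't) hilb" where
  "KE = \<lparr>hcarrier = constN, hscale = (\<lambda>c g w. hscale T c (g w)), hip = (\<lambda>g g'. hip T (g []) (g' []))\<rparr>"

lemma KE_simps [simp]: "hcarrier KE = constN" "hscale KE = (\<lambda>c g w. hscale T c (g w))"
  "hip KE g g' = hip T (g []) (g' [])" "hnorm KE g = hnorm T (g [])"
  by (simp_all add: KE_def hnorm_def)

lemma constN_iff: "g \<in> constN \<longleftrightarrow> g [] \<in> N \<and> g = (\<lambda>_. g [])"
  by (auto simp: constN_def)

lemma constN_mem: "g \<in> constN \<Longrightarrow> g [] \<in> N" "g \<in> constN \<Longrightarrow> g [] \<in> hcarrier T"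
  using constN_iff NT by blast+

lemma constN_I: "v \<in> N \<Longrightarrow> (\<lambda>_. v) \<in> constN"
  by (auto simp: constN_def)

lemma KE_hilbert: "hilbert_space KE"
proof -
  note sub = T.closed_subspaceD(1)[OF N]
  have vs: "vector_space (hscale KE)"
    by unfold_locales (auto simp: fun_eq_iff T.scale_right_distrib T.scale_left_distrib)
  interpret KE: vector_space "hscale KE" by (rule vs)
  have KE_sub: "KE.subspace constN"
    by (rule KE.subspaceI)
      (auto simp: constN_def zero_fun_def plus_fun_def intro: T.subspace_0[OF sub] T.subspace_add[OF sub] T.subspace_scale[OF sub])
  show ?thesis
  proof (intro hilbert_space.intro hilbert_space_axioms.intro vs)
    show "KE.subspace (hcarrier KE)" using KE_sub by simp
  next
    fix g g' assume "g \<in> hcarrier KE" "g' \<in> hcarrier KE"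
    then show "hip KE g g' = cnj (hip KE g' g)"
      using T.ip_cnj[OF constN_mem(2) constN_mem(2), of g g'] by simp
  next
    fix g assume g: "g \<in> hcarrier KE" "g \<noteq> 0"
    then have "g [] \<noteq> 0" using constN_iff[of g] by (auto simp: zero_fun_def)
    then show "0 < Re (hip KE g g)" using g constN_mem(2) T.ip_pos by simp
  next
    fix s :: "nat \<Rightarrow> 'n list \<Rightarrow> 't"
    assume s: "\<And>k. s k \<in> hcarrier KE" and c: "\<And>r. 0 < r \<Longrightarrow> \<exists>M. \<forall>j\<ge>M. \<forall>k\<ge>M. hnorm KE (s j - s k) < r"
    have s': "\<And>k. s k \<in> constN" using s by simp
    have "\<exists>l\<in>hcarrier T. (\<lambda>k. hnorm T (s k [] - l)) \<longlonglongrightarrow> 0"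
      by (rule T.complete) (use constN_mem(2)[OF s'] c in auto)
    then obtain l where l: "l \<in> hcarrier T" "(\<lambda>k. hnorm T (s k [] - l)) \<longlonglongrightarrow> 0" by blast
    have "l \<in> N" using T.closed_subspaceD(4)[OF N, of "\<lambda>k. s k []" l] constN_mem(1)[OF s'] l by blast
    then show "\<exists>l\<in>hcarrier KE. (\<lambda>k. hnorm KE (s k - l)) \<longlonglongrightarrow> 0"
      using l(2) constN_I by (intro bexI[of _ "\<lambda>_. l"]) auto
  qed (simp_all add: constN_mem T.ip_add T.ip_scale)
qed

definition E :: "'t hilb" where "E = T\<lparr>hcarrier := wand\<rparr>"

lemma E_hilbert: "hilbert_space E"
  unfolding E_def by (rule T.closed_subspace_restrict[OF wand_closed])

lemma E_simps [simp]: "hcarrier E = wand" "hscale E = hscale T" "hip E = hip T"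
  by (simp_all add: E_def)

definition \<sigma> :: "'k \<Rightarrow> 't \<Rightarrow> 'n list \<Rightarrow> 't" where "\<sigma> x y = (\<lambda>_. Ty y x)"

text \<open>The product formula for inner products is \<open>Ty_ip\<close>, and density is
  \<open>wand_generates\<close>, because \<open>Ty y (e v)\<close> is \<open>Rw v y\<close>.\<close>

lemma tensor_KE: "hilbert_tensor K E KE \<sigma>"
proof -
  interpret KE: hilbert_space KE by (rule KE_hilbert)
  have total: "htotal KE {\<sigma> x y |x y. x \<in> hcarrier K \<and> y \<in> hcarrier E}"
  proof (rule KE.htotal_if_orthogonal_trivial)
    show "{\<sigma> x y |x y. x \<in> hcarrier K \<and> y \<in> hcarrier E} \<subseteq> hcarrier KE"
      by (auto simp: \<sigma>_def intro: constN_I Ty_N)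
    fix g assume g: "g \<in> hcarrier KE"
      and o: "\<And>d. d \<in> {\<sigma> x y |x y. x \<in> hcarrier K \<and> y \<in> hcarrier E} \<Longrightarrow> hip KE g d = 0"
    have "g [] = 0"
    proof (rule wand_generates)
      show "g [] \<in> N" using g constN_mem by simp
      fix y v assume y: "y \<in> wand"
      have "\<sigma> (e v) y \<in> {\<sigma> x y |x y. x \<in> hcarrier K \<and> y \<in> hcarrier E}"
        by (intro CollectI exI[of _ "e v"] exI[of _ y]) (simp add: y)
      from o[OF this] show "hip T (g []) (Rw v y) = 0" by (simp add: \<sigma>_def Ty(2)[OF y])
    qed
    then show "g = 0" using g constN_iff[of g] by (simp add: zero_fun_def)
  qed
  have "hdense KE (hspan KE {\<sigma> x y |x y. x \<in> hcarrier K \<and> y \<in> hcarrier E})"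
    using KE.hdense_if_total[OF total] by (simp only: hspan_def)
  then show ?thesis
    unfolding hilbert_tensor_def
    by (auto simp: KE_hilbert \<sigma>_def fun_eq_iff Ty_ip Ty_add Ty_scale bdd_opsD(2,3)[OF Ty(1)] intro: constN_I Ty_N)
qed

text \<open>\<open>Ty_MZ\<close> and uniqueness identify the ampliation on \<open>KE\<close> with
  \<open>D i\<close> acting on the constant value. Reading off that value is then an intertwining
  isometry onto \<open>N\<close>.\<close>

theorem beurling_rep_ex:
  "\<exists>(E :: 't hilb) (KE :: ('n list \<Rightarrow> 't) hilb) \<sigma> \<Psi>. beurling_rep K MZ H T \<tau> N E KE \<sigma> \<Psi>"
proof -
  interpret KE: hilbert_space KE by (rule KE_hilbert)
  interpret E: hilbert_space E by (rule E_hilbert)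
  interpret TE: tensor_product K E KE \<sigma>
    by unfold_locales (rule tensor_KE)
  define A where "A i g = (if g \<in> constN then (\<lambda>_::'n list. D i (g [])) else 0)" for i g
  have A_op: "A i \<in> bdd_ops KE KE" for i
  proof -
    obtain C where C: "\<And>x. x \<in> hcarrier T \<Longrightarrow> hnorm T (D i x) \<le> C * hnorm T x"
      using TT.bdd_ops_bound[OF D_op] by blast
    show ?thesis
    proof (rule bdd_opsI[where C = C])
      fix g g' assume g: "g \<in> hcarrier KE" "g' \<in> hcarrier KE"
      then have "g + g' \<in> constN" using KE.carrier_add by simp
      then show "A i (g + g') = A i g + A i g'"
        using g constN_mem(2) by (simp add: A_def fun_eq_iff bdd_opsD(2)[OF D_op])
    next
      fix c g assume g: "g \<in> hcarrier KE"
      then have "hscale KE c g \<in> constN" using KE.carrier_scale[OF g] by simp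
      then show "A i (hscale KE c g) = hscale KE c (A i g)"
        using g constN_mem(2) by (simp add: A_def fun_eq_iff bdd_opsD(3)[OF D_op])
    qed (use constN_mem C in \<open>auto simp: A_def intro: constN_I D_N\<close>)
  qed
  have amp: "ampliation K E KE \<sigma> (MZ i) = A i" for i
    by (rule TE.ampliation_eqI[OF A_op])
      (auto simp: A_def \<sigma>_def Ty_MZ constN_I[OF Ty_N])
  define \<Psi> where "\<Psi> g = (if g \<in> constN then g [] else 0)" for g :: "'n list \<Rightarrow> 't"
  have \<Psi>_op: "\<Psi> \<in> bdd_ops KE T"
  proof (rule bdd_opsI[where C = 1])
    fix g g' assume g: "g \<in> hcarrier KE" "g' \<in> hcarrier KE"
    then have "g + g' \<in> constN" using KE.carrier_add by simp
    then show "\<Psi> (g + g') = \<Psi> g + \<Psi> g'" using g by (simp add: \<Psi>_def)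
  next
    fix c g assume g: "g \<in> hcarrier KE"
    then have "hscale KE c g \<in> constN" using KE.carrier_scale[OF g] by simp
    then show "\<Psi> (hscale KE c g) = hscale T c (\<Psi> g)" using g by (simp add: \<Psi>_def)
  qed (use constN_mem in \<open>auto simp: \<Psi>_def\<close>)
  have "\<Psi> (A i g) = D i (\<Psi> g)" if "g \<in> constN" for i g
    using that constN_I[OF D_N[OF constN_mem(1)[OF that]]] by (simp add: A_def \<Psi>_def)
  then have "multi_analytic K MZ E KE \<sigma> H T \<tau> \<Psi>"
    unfolding multi_analytic_def amp using \<Psi>_op by simp
  moreover have "partial_isometry KE T \<Psi>"
    unfolding partial_isometry_def using \<Psi>_op by (auto simp: \<Psi>_def)
  moreover have "\<Psi> ` hcarrier KE = N"
    using constN_mem(1) constN_I by (auto simp: \<Psi>_def intro!: image_eqI[OF _ constN_I])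
  ultimately have "beurling_rep K MZ H T \<tau> N E KE \<sigma> \<Psi>"
    unfolding beurling_rep_def inner_multi_analytic_def
    using E_hilbert tensor_KE by simp
  then show ?thesis by blast
qed

end

section \<open>Noncommutative series and polynomial automorphisms\<close>

interpretation nc: vector_space nc_scale
  by unfold_locales (auto simp: nc_scale_def fun_eq_iff algebra_simps)

lemma nc_scale_apply: "nc_scale c p w = c * p w"
  by (simp add: nc_scale_def)

lemma sum_fun_apply: "sum f A x = (\<Sum>i\<in>A. f i x)"
  by (induction A rule: infinite_finite_induct) auto

lemma nc_mult_add: "nc_mult (p + q) r = nc_mult p r + nc_mult q r"
  and nc_mult_add_right: "nc_mult p (q + r) = nc_mult p q + nc_mult p r"
  and nc_mult_scale: "nc_mult (nc_scale c p) r = nc_scale c (nc_mult p r)"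
  and nc_mult_scale_right: "nc_mult p (nc_scale c r) = nc_scale c (nc_mult p r)"
  and nc_mult_zero [simp]: "nc_mult 0 r = 0"
  and nc_mult_zero_right [simp]: "nc_mult p 0 = 0"
  by (simp_all add: nc_mult_def nc_scale_apply fun_eq_iff algebra_simps sum.distrib sum_distrib_left)

lemma nc_mult_sum: "nc_mult (sum f A) r = (\<Sum>i\<in>A. nc_mult (f i) r)"
  unfolding nc_mult_def fun_eq_iff sum_fun_apply by (subst sum.swap) (simp add: sum_distrib_right)

lemma nc_mult_Nil: "nc_mult p q [] = p [] * q []"
  by (simp add: nc_mult_def)

lemma nc_mult_Cons: "nc_mult p q (a # w) = p [] * q (a # w) + nc_mult (\<lambda>v. p (a # v)) q w"
  by (simp add: nc_mult_def sum.atMost_Suc_shift del: sum.atMost_Suc)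

lemma nc_mult_one [simp]: "nc_mult nc_one p = p"
proof
  fix w
  have "nc_mult nc_one p w = (\<Sum>k\<le>length w. if k = 0 then p w else 0)"
    unfolding nc_mult_def by (rule sum.cong) (auto simp: nc_one_def)
  then show "nc_mult nc_one p w = p w" by simp
qed

text \<open>Removing the first letter of the word obeys a Leibniz-like rule,
  \<open>nc_mult_Cons\<close>, which replaces the manipulation of a triple sum by an induction in
  which \<open>p\<close> varies.\<close>

lemma nc_mult_assoc: "nc_mult (nc_mult p q) r = nc_mult p (nc_mult q r)"
proof
  fix w show "nc_mult (nc_mult p q) r w = nc_mult p (nc_mult q r) w"
  proof (induction w arbitrary: p)
    case (Cons a w)
    have "(\<lambda>v. nc_mult p q (a # v)) = nc_scale (p []) (\<lambda>v. q (a # v)) + nc_mult (\<lambda>v. p (a # v)) q"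
      by (simp add: fun_eq_iff nc_mult_Cons nc_scale_apply)
    then show ?case
      by (simp add: nc_mult_Cons[of "nc_mult p q"] nc_mult_Cons[of p] nc_mult_Cons[of q] nc_mult_Nil
          nc_scale_apply nc_mult_add nc_mult_scale Cons.IH algebra_simps)
  qed (simp add: nc_mult_Nil)
qed

lemma nc_word_append: "nc_word f (\<alpha> @ \<beta>) = nc_mult (nc_word f \<alpha>) (nc_word f \<beta>)"
  by (induction \<alpha>) (simp_all add: nc_mult_assoc)

lemma nc_mult_var: "nc_mult (nc_var i) p w = (case w of [] \<Rightarrow> 0 | j # v \<Rightarrow> if j = i then p v else 0)"
proof (cases w)
  case Nil
  then show ?thesis by (simp add: nc_mult_Nil nc_var_def)
next
  case (Cons j v)
  have "(\<lambda>u. nc_var i (j # u)) = (if j = i then nc_one else 0)"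
    by (auto simp: nc_var_def nc_one_def fun_eq_iff)
  then show ?thesis using Cons by (simp add: nc_mult_Cons) (simp add: nc_var_def)
qed

text \<open>\<open>nc_word nc_var \<alpha>\<close> is thus the unit sequence at
  \<open>\<alpha>\<close>. It plays two parts below: the monomial with word \<open>\<alpha>\<close>,
  and the coefficient sequence of the basis vector belonging to
  \<open>f\<^sub>\<alpha>\<close>.\<close>

lemma nc_word_var: "nc_word nc_var \<alpha> w = (if w = \<alpha> then 1 else 0)"
  by (induction \<alpha> arbitrary: w) (auto simp: nc_one_def nc_mult_var split: list.splits)

lemma nc_polys_add: "p \<in> nc_polys \<Longrightarrow> q \<in> nc_polys \<Longrightarrow> p + q \<in> nc_polys"
  unfolding nc_polys_def
  by (auto intro: finite_subset[of _ "{w. p w \<noteq> 0} \<union> {w. q w \<noteq> 0}"])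

lemma nc_polys_scale: "p \<in> nc_polys \<Longrightarrow> nc_scale c p \<in> nc_polys"
  unfolding nc_polys_def nc_scale_apply by (auto intro: finite_subset[of _ "{w. p w \<noteq> 0}"])

lemma nc_polys_zero: "0 \<in> nc_polys"
  by (simp add: nc_polys_def)

lemma nc_polys_one: "nc_one \<in> nc_polys"
  unfolding nc_polys_def nc_one_def by (auto intro: finite_subset[of _ "{[]}"])

lemma nc_polys_mult:
  assumes "p \<in> nc_polys" "q \<in> nc_polys"
  shows "nc_mult p q \<in> nc_polys"
proof -
  have "{w. nc_mult p q w \<noteq> 0} \<subseteq> (\<lambda>(u, v). u @ v) ` ({w. p w \<noteq> 0} \<times> {w. q w \<noteq> 0})"
  proof
    fix w assume "w \<in> {w. nc_mult p q w \<noteq> 0}"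
    then obtain k where "p (take k w) * q (drop k w) \<noteq> 0"
      unfolding nc_mult_def by (auto elim: sum.not_neutral_contains_not_neutral)
    then show "w \<in> (\<lambda>(u, v). u @ v) ` ({w. p w \<noteq> 0} \<times> {w. q w \<noteq> 0})"
      by (intro image_eqI[of _ _ "(take k w, drop k w)"]) auto
  qed
  then show ?thesis using assms unfolding nc_polys_def
    by (auto intro: finite_subset)
qed

lemma nc_polys_word: "(\<And>i. f i \<in> nc_polys) \<Longrightarrow> nc_word f \<alpha> \<in> nc_polys"
  by (induction \<alpha>) (auto intro: nc_polys_one nc_polys_mult)

lemma nc_var_poly: "nc_var i \<in> nc_polys"
  unfolding nc_polys_def nc_var_def by (auto intro: finite_subset[of _ "{[i]}"])

lemma nc_poly_expansion:
  assumes "p \<in> nc_polys"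
  shows "p = (\<Sum>w | p w \<noteq> 0. nc_scale (p w) (nc_word nc_var w))"
proof
  fix v
  have "(\<Sum>w | p w \<noteq> 0. nc_scale (p w) (nc_word nc_var w)) v = (\<Sum>w | p w \<noteq> 0. if w = v then p v else 0)"
    unfolding sum_fun_apply by (rule sum.cong) (auto simp: nc_word_var nc_scale_apply)
  also have "\<dots> = p v" using assms by (simp add: nc_polys_def sum.delta)
  finally show "p v = (\<Sum>w | p w \<noteq> 0. nc_scale (p w) (nc_word nc_var w)) v" by simp
qed

lemma nc_subst_sum: "nc_subst p f = (\<Sum>\<alpha> | p \<alpha> \<noteq> 0. nc_scale (p \<alpha>) (nc_word f \<alpha>))"
  by (simp add: nc_subst_def fun_eq_iff sum_fun_apply nc_scale_apply)

lemma nc_mult_span: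
  assumes "p \<in> nc.span (range (nc_word f))" "q \<in> nc.span (range (nc_word f))"
  shows "nc_mult p q \<in> nc.span (range (nc_word f))"
  using assms(1)
proof (induction rule: nc.span_induct_alt)
  case (step c x y)
  then obtain \<alpha> where x: "x = nc_word f \<alpha>" by blast
  have "nc_mult x q \<in> nc.span (range (nc_word f))" using assms(2)
  proof (induction rule: nc.span_induct_alt)
    case (step d u v)
    then obtain \<beta> where "u = nc_word f \<beta>" by blast
    then have "nc_mult x u = nc_word f (\<alpha> @ \<beta>)" by (simp add: x nc_word_append)
    then show "nc_mult x (nc_scale d u + v) \<in> nc.span (range (nc_word f))" using step.IH
      by (simp add: nc_mult_add_right nc_mult_scale_right nc.span_add nc.span_scale nc.span_base)
  next
    case base
    show "nc_mult x 0 \<in> nc.span (range (nc_word f))" by (simp add: nc.span_zero)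
  qed
  then show "nc_mult (nc_scale c x + y) q \<in> nc.span (range (nc_word f))"
    using step.IH by (simp add: nc_mult_add nc_mult_scale nc.span_add nc.span_scale)
next
  case base
  show "nc_mult 0 q \<in> nc.span (range (nc_word f))" by (simp add: nc.span_zero)
qed

text \<open>The span of the words in \<open>f\<close> contains the unit and is closed under
  products, so the variables generate all polynomials inside it.\<close>

lemma nc_polys_span_if_vars:
  assumes "\<And>i. nc_var i \<in> nc.span (range (nc_word f))" "p \<in> nc_polys"
  shows "p \<in> nc.span (range (nc_word f))"
proof -
  have "nc_word nc_var w \<in> nc.span (range (nc_word f))" for w
  proof (induction w)
    case Nil
    have "nc_word f [] \<in> nc.span (range (nc_word f))" by (intro nc.span_base rangeI)
    then show "nc_word nc_var [] \<in> nc.span (range (nc_word f))" by simp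
  next
    case (Cons i w)
    then show "nc_word nc_var (i # w) \<in> nc.span (range (nc_word f))"
      using assms(1) by (simp add: nc_mult_span)
  qed
  then show ?thesis
    by (subst nc_poly_expansion[OF assms(2)]) (intro nc.span_sum nc.span_scale)
qed

section \<open>From polynomial models to creation operators\<close>

context hilbert_space
begin

lemma sot_alg_sum: "(\<And>i. i \<in> A \<Longrightarrow> S i \<in> sot_alg V X) \<Longrightarrow> (\<lambda>x. \<Sum>i\<in>A. S i x) \<in> sot_alg V X"
proof (induction A rule: infinite_finite_induct)
  case (insert i A)
  then show ?case using sot_alg.add[of "S i" V X "\<lambda>x. \<Sum>i\<in>A. S i x"] by simp
qed (use sot_alg.scale[OF sot_alg.ident, of V 0 X] in auto)

lemma word_op_sot_alg: "(\<And>i. Y i \<in> sot_alg V X) \<Longrightarrow> word_op V Y \<alpha> \<in> sot_alg V X"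
proof (induction \<alpha>)
  case (Cons i \<alpha>)
  then show ?case using sot_alg.comp[of "Y i" V X "word_op V Y \<alpha>"] by (simp add: o_def)
qed (simp add: sot_alg.ident)

end

text \<open>The hypotheses say that \<open>MZ i (e \<beta>)\<close> has coefficient
  \<open>A i \<alpha>\<close> at \<open>e (\<alpha> @ \<beta>)\<close> and none at other words.
  Appending \<open>\<gamma>\<close> to both words leaves the cofactor \<open>\<alpha>\<close>
  unchanged, which is the translation rule of the locale.\<close>

lemma creation_modelI:
  assumes "hilbert_space K" "\<And>i. MZ i \<in> bdd_ops K K" "\<And>j. S j \<in> sot_alg K MZ"
    "\<And>j w. S j (e w) = e (j # w)" "\<And>w. e w \<in> hcarrier K"
    "\<And>v w. hip K (e v) (e w) = (if v = w then 1 else 0)" "htotal K (range e)"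
    and shift: "\<And>i \<alpha> \<beta>. hip K (MZ i (e \<beta>)) (e (\<alpha> @ \<beta>)) = A i \<alpha>"
    and zero: "\<And>i \<beta> \<delta>. (\<nexists>\<alpha>. \<delta> = \<alpha> @ \<beta>) \<Longrightarrow> hip K (MZ i (e \<beta>)) (e \<delta>) = 0"
  shows "creation_model K MZ e S"
proof -
  have "hip K (MZ i (e (\<beta> @ \<gamma>))) (e (\<alpha> @ \<gamma>)) = hip K (MZ i (e \<beta>)) (e \<alpha>)" for i \<alpha> \<beta> \<gamma>
  proof (cases "\<exists>\<alpha>'. \<alpha> = \<alpha>' @ \<beta>")
    case True
    then obtain \<alpha>' where "\<alpha> = \<alpha>' @ \<beta>" by blast
    then show ?thesis using shift[of i "\<beta> @ \<gamma>" \<alpha>'] shift[of i \<beta> \<alpha>'] by simp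
  next
    case False
    then show ?thesis using zero[of \<alpha> \<beta> i] zero[of "\<alpha> @ \<gamma>" "\<beta> @ \<gamma>" i] by simp
  qed
  moreover have "hip K (MZ i (e (\<beta> @ \<gamma>))) (e \<delta>) = 0" if "\<nexists>\<alpha>. \<delta> = \<alpha> @ \<gamma>" for i \<beta> \<gamma> \<delta>
    using that zero[of \<delta> "\<beta> @ \<gamma>" i] by (metis append.assoc)
  ultimately show ?thesis
    using assms(1-7) unfolding creation_model_def creation_model_axioms_def by blast
qed

text \<open>The inverse \<open>g\<close> supplies the coefficients: substituting \<open>f\<close>
  into \<open>g i\<close> gives the variable, so \<open>g i\<close> lists the expansion of the
  variable in words of \<open>f\<close>. The shifts are the polynomials \<open>f j\<close> in the
  tuple \<open>MZ\<close>, and no limits occur.\<close>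

theorem model_A_creation_model:
  fixes f :: "'n::finite \<Rightarrow> 'n ncseries" and K :: "('k::ab_group_add) hilb"
  assumes A: "model_A f" and \<iota>: "H2_A f K \<iota>" and MZ: "\<And>i. MZ i \<in> bdd_ops K K"
    and MZ_\<iota>: "\<And>i p. p \<in> nc_polys \<Longrightarrow> MZ i (\<iota> p) = \<iota> (nc_mult (nc_var i) p)"
  shows "\<exists>e S. creation_model K MZ e S"
proof -
  interpret K: hilbert_space K using \<iota> by (simp add: H2_A_def)
  have \<iota>_add: "\<iota> (p + q) = \<iota> p + \<iota> q" if "p \<in> nc_polys" "q \<in> nc_polys" for p q
    using \<iota> that by (simp add: H2_A_def)
  have \<iota>_scale: "\<iota> (nc_scale c p) = hscale K c (\<iota> p)" if "p \<in> nc_polys" for c p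
    using \<iota> that by (simp add: H2_A_def)
  have \<iota>_0: "\<iota> 0 = 0" using \<iota>_scale[OF nc_polys_zero, of 0] by simp
  have \<iota>_sum: "\<iota> (\<Sum>i\<in>I. nc_scale (c i) (p i)) = (\<Sum>i\<in>I. hscale K (c i) (\<iota> (p i))) \<and>
      (\<Sum>i\<in>I. nc_scale (c i) (p i)) \<in> nc_polys"
    if "\<And>i. i \<in> I \<Longrightarrow> p i \<in> nc_polys" for I :: "'n list set" and c p
    using that
    by (induction I rule: infinite_finite_induct)
      (auto simp: \<iota>_0 \<iota>_add \<iota>_scale nc_polys_zero nc_polys_add nc_polys_scale)
  have dense: "hdense K (\<iota> ` nc_polys)" using \<iota> by (simp add: H2_A_def)
  have \<iota>_C: "\<iota> p \<in> hcarrier K" if "p \<in> nc_polys" for p using dense that by (auto simp: hdense_def)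
  obtain g where f: "\<And>i. f i \<in> nc_polys" and g: "\<And>i. g i \<in> nc_polys" "\<And>i. nc_subst (g i) f = nc_var i"
    using A by (auto simp: model_A_def)
  have fw: "nc_word f \<alpha> \<in> nc_polys" for \<alpha> using f by (rule nc_polys_word)
  define e where "e w = \<iota> (nc_word f w)" for w
  have e_C: "e w \<in> hcarrier K" for w using \<iota>_C fw by (simp add: e_def)
  have e_ip: "hip K (e v) (e w) = (if v = w then 1 else 0)" for v w
    using \<iota> by (simp add: H2_A_def e_def)
  have "nc_var i \<in> nc.span (range (nc_word f))" for i
    unfolding g(2)[symmetric] nc_subst_sum by (intro nc.span_sum nc.span_scale nc.span_base) auto
  note span = nc_polys_span_if_vars[OF this]
  have "\<iota> p \<in> K.span (range e)" if "p \<in> nc_polys" for p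
  proof -
    \<comment> \<open>Membership in \<open>nc_polys\<close> is carried through the induction because
      \<open>\<iota>\<close> is only known to be linear on polynomials.\<close>
    have "\<iota> p \<in> K.span (range e) \<and> p \<in> nc_polys" using span[OF that]
    proof (induction rule: nc.span_induct_alt)
      case base
      show "\<iota> 0 \<in> K.span (range e) \<and> 0 \<in> nc_polys" by (simp add: \<iota>_0 K.span_zero nc_polys_zero)

    next
      case (step c x y)
      then obtain \<alpha> where "x = nc_word f \<alpha>" by blast
      then have "x \<in> nc_polys" "\<iota> x \<in> K.span (range e)" using fw by (auto simp: e_def intro: K.span_base)
      then show "\<iota> (nc_scale c x + y) \<in> K.span (range e) \<and> nc_scale c x + y \<in> nc_polys" using step.IH
        by (simp add: \<iota>_add \<iota>_scale nc_polys_add nc_polys_scale K.span_add K.span_scale)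
    qed
    then show ?thesis by simp
  qed
  then have sub: "\<iota> ` nc_polys \<subseteq> K.span (range e)" by blast
  have "K.span (range e) \<subseteq> hcarrier K" by (rule K.span_minimal) (use e_C K.carrier_subspace in auto)
  then have "hdense K (K.span (range e))" using dense sub unfolding hdense_def by blast
  then have total: "htotal K (range e)" by (rule K.htotal_if_hdense)
  have word: "word_op K MZ \<alpha> (\<iota> p) = \<iota> (nc_mult (nc_word nc_var \<alpha>) p)" if p: "p \<in> nc_polys" for \<alpha> p
  proof (induction \<alpha>)
    case (Cons i \<alpha>)
    have "nc_mult (nc_word nc_var \<alpha>) p \<in> nc_polys"
      using p nc_polys_word[of nc_var, OF nc_var_poly] by (rule nc_polys_mult[rotated])
    then show ?case using Cons MZ_\<iota> by (simp add: nc_mult_assoc)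
  qed (use \<iota>_C[OF p] in \<open>simp add: on_carrier_def\<close>)
  define S where "S j x = (\<Sum>\<alpha> | f j \<alpha> \<noteq> 0. hscale K (f j \<alpha>) (word_op K MZ \<alpha> x))" for j x
  have S_alg: "S j \<in> sot_alg K MZ" for j
    unfolding S_def by (intro K.sot_alg_sum sot_alg.scale K.word_op_sot_alg sot_alg.var)
  have S_\<iota>: "S j (\<iota> p) = \<iota> (nc_mult (f j) p)" if p: "p \<in> nc_polys" for j p
  proof -
    have m: "nc_mult (nc_word nc_var \<alpha>) p \<in> nc_polys" for \<alpha>
      using p nc_polys_word[of nc_var, OF nc_var_poly] by (rule nc_polys_mult[rotated])
    have "nc_mult (f j) p = (\<Sum>\<alpha> | f j \<alpha> \<noteq> 0. nc_scale (f j \<alpha>) (nc_mult (nc_word nc_var \<alpha>) p))"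
      by (subst nc_poly_expansion[OF f]) (simp only: nc_mult_sum nc_mult_scale)
    then show ?thesis using \<iota>_sum[of _ "\<lambda>\<alpha>. nc_mult (nc_word nc_var \<alpha>) p", OF m]
      by (simp add: S_def word[OF p])
  qed
  have S_e: "S j (e w) = e (j # w)" for j w using S_\<iota>[OF fw] by (simp add: e_def)
  have MZ_e: "MZ i (e \<beta>) = (\<Sum>\<alpha> | g i \<alpha> \<noteq> 0. hscale K (g i \<alpha>) (e (\<alpha> @ \<beta>)))" for i \<beta>
  proof -
    have "nc_mult (nc_var i) (nc_word f \<beta>) = (\<Sum>\<alpha> | g i \<alpha> \<noteq> 0. nc_scale (g i \<alpha>) (nc_word f (\<alpha> @ \<beta>)))"
      unfolding g(2)[symmetric] nc_subst_sum nc_mult_sum nc_mult_scale nc_word_append ..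
    then show ?thesis using \<iota>_sum[of _ "\<lambda>\<alpha>. nc_word f (\<alpha> @ \<beta>)", OF fw] MZ_\<iota>[OF fw] by (simp add: e_def)
  qed
  have MZ_ip: "hip K (MZ i (e \<beta>)) (e \<delta>) = (\<Sum>\<alpha> | g i \<alpha> \<noteq> 0. g i \<alpha> * (if \<alpha> @ \<beta> = \<delta> then 1 else 0))" for i \<beta> \<delta>
    unfolding MZ_e using e_C by (subst K.ip_sum) (auto simp: K.ip_scale e_ip intro!: sum.cong)
  have fin: "finite {\<alpha>. g i \<alpha> \<noteq> 0}" for i using g(1) by (simp add: nc_polys_def)
  have "creation_model K MZ e S"
  proof (rule creation_modelI[where A = g])
    fix i \<alpha> \<beta>
    have "hip K (MZ i (e \<beta>)) (e (\<alpha> @ \<beta>)) = (\<Sum>\<alpha>' | g i \<alpha>' \<noteq> 0. if \<alpha>' = \<alpha> then g i \<alpha> else 0)"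
      unfolding MZ_ip by (rule sum.cong) auto
    then show "hip K (MZ i (e \<beta>)) (e (\<alpha> @ \<beta>)) = g i \<alpha>" using fin by (simp add: sum.delta)
  next
    fix i :: 'n and \<beta> \<delta> :: "'n list" assume "\<nexists>\<alpha>. \<delta> = \<alpha> @ \<beta>"
    then show "hip K (MZ i (e \<beta>)) (e \<delta>) = 0" unfolding MZ_ip by (intro sum.neutral) auto
  qed (use MZ S_alg S_e e_C e_ip total K.hilbert_space_axioms in auto)
  then show ?thesis by blast
qed

section \<open>Model spaces parametrized by square-summable coefficients\<close>

lemma H2_ball_zero: "0 \<in> H2_ball"
  by (simp add: H2_ball_def)

lemma H2_ball_scale: "a \<in> H2_ball \<Longrightarrow> nc_scale c a \<in> H2_ball"
  unfolding H2_ball_def by (simp add: nc_scale_apply norm_mult power_mult_distrib summable_on_cmult_right)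

lemma H2_ball_add:
  assumes "a \<in> H2_ball" "b \<in> H2_ball"
  shows "a + b \<in> H2_ball"
proof -
  have "(\<lambda>\<alpha>. 2 * (cmod (a \<alpha>))\<^sup>2 + 2 * (cmod (b \<alpha>))\<^sup>2) summable_on UNIV"
    using assms by (intro summable_on_add summable_on_cmult_right) (auto simp: H2_ball_def)
  moreover have "(cmod ((a + b) \<alpha>))\<^sup>2 \<le> 2 * (cmod (a \<alpha>))\<^sup>2 + 2 * (cmod (b \<alpha>))\<^sup>2" for \<alpha>
  proof -
    have "(cmod ((a + b) \<alpha>))\<^sup>2 \<le> (cmod (a \<alpha>) + cmod (b \<alpha>))\<^sup>2"
      by (intro power_mono) (auto intro: norm_triangle_ineq)
    also have "\<dots> \<le> 2 * (cmod (a \<alpha>))\<^sup>2 + 2 * (cmod (b \<alpha>))\<^sup>2"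
      using sum_squares_bound[of "cmod (a \<alpha>)" "cmod (b \<alpha>)"] by (simp add: power2_sum)
    finally show ?thesis .
  qed
  ultimately show ?thesis
    unfolding H2_ball_def by (auto intro: summable_on_comparison_test)
qed

lemma H2_ball_diff: "a \<in> H2_ball \<Longrightarrow> b \<in> H2_ball \<Longrightarrow> a - b \<in> H2_ball"
  using H2_ball_add[OF _ H2_ball_scale[of b "-1"], of a] by simp

lemma H2_ball_word: "nc_word nc_var w \<in> H2_ball"
proof -
  have "(\<lambda>\<alpha>. (cmod (nc_word nc_var w \<alpha>))\<^sup>2) summable_on {w}" by simp
  then have "(\<lambda>\<alpha>. (cmod (nc_word nc_var w \<alpha>))\<^sup>2) summable_on UNIV"
    by (rule summable_on_cong_neutral[THEN iffD1, rotated -1]) (auto simp: nc_word_var)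
  then show ?thesis by (simp add: H2_ball_def)
qed

lemma H2_ball_ip_word: "H2_ball_ip b (nc_word nc_var w) = b w"
proof -
  have "H2_ball_ip b (nc_word nc_var w) = infsum (\<lambda>\<alpha>. b \<alpha> * cnj (nc_word nc_var w \<alpha>)) {w}"
    unfolding H2_ball_ip_def by (rule infsum_cong_neutral) (auto simp: nc_word_var)
  then show ?thesis by (simp add: nc_word_var)
qed

lemma nc_mult_word_append: "nc_mult p (nc_word nc_var \<beta>) (\<alpha> @ \<beta>) = p \<alpha>"
proof -
  have "k = length \<alpha>" if "drop k (\<alpha> @ \<beta>) = \<beta>" "k \<le> length (\<alpha> @ \<beta>)" for k
    using arg_cong[OF that(1), of length] that(2) by simp
  then have "nc_mult p (nc_word nc_var \<beta>) (\<alpha> @ \<beta>) =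
      (\<Sum>k\<le>length (\<alpha> @ \<beta>). if k = length \<alpha> then p \<alpha> else 0)"
    unfolding nc_mult_def nc_word_var by (intro sum.cong) auto
  then show ?thesis by simp
qed

lemma nc_mult_word_zero:
  assumes "\<nexists>\<alpha>. w = \<alpha> @ \<beta>"
  shows "nc_mult p (nc_word nc_var \<beta>) w = 0"
proof -
  have "drop k w \<noteq> \<beta>" for k using assms append_take_drop_id[of k w] by metis
  then show ?thesis unfolding nc_mult_def nc_word_var by (intro sum.neutral) auto
qed

text \<open>Right multiplication by a monomial only relabels coefficients, moving the one at
  \<open>\<alpha>\<close> to \<open>\<alpha> @ \<beta>\<close>.\<close>

lemma H2_ball_mult_word:
  assumes "p \<in> H2_ball"
  shows "nc_mult p (nc_word nc_var \<beta>) \<in> H2_ball"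
proof -
  let ?q = "\<lambda>w. (cmod (nc_mult p (nc_word nc_var \<beta>) w))\<^sup>2"
  have "?q \<circ> (\<lambda>\<alpha>. \<alpha> @ \<beta>) = (\<lambda>\<alpha>. (cmod (p \<alpha>))\<^sup>2)" by (simp add: fun_eq_iff nc_mult_word_append)
  then have "?q summable_on range (\<lambda>\<alpha>. \<alpha> @ \<beta>)"
    using assms by (subst summable_on_reindex) (auto simp: H2_ball_def inj_on_def)
  then have "?q summable_on UNIV"
    by (rule summable_on_cong_neutral[THEN iffD1, rotated -1]) (auto intro!: nc_mult_word_zero)
  then show ?thesis by (simp add: H2_ball_def)
qed

section \<open>Functional calculus and transport along unitaries\<close>

context hilbert_space
begin

lemma nc_psum_sot_alg:
  assumes "\<And>i. Y i \<in> sot_alg V X"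
  shows "nc_psum V c Y m \<in> sot_alg V X"
  unfolding nc_psum_def using assms by (intro sot_alg_sum sot_alg.scale word_op_sot_alg)

lemma norm_limit_sot_alg:
  assumes X: "\<And>i. X i \<in> bdd_ops V V" and Y: "\<And>i. Y i \<in> sot_alg V X"
    and L: "norm_tendsto V (nc_psum V c Y) L"
  shows "nc_eval V c Y = L" "L \<in> sot_alg V X"
proof -
  note ps = nc_psum_sot_alg[OF Y, of c]
  note psb = sot_alg_bdd_ops[OF X ps]
  have uq: "L' = L" if "norm_tendsto V (nc_psum V c Y) L'" for L'
    using sot_tendsto_unique[OF psb sot_tendsto_if_norm_tendsto[OF psb that]
        sot_tendsto_if_norm_tendsto[OF psb L]] by simp
  show "nc_eval V c Y = L" unfolding nc_eval_def by (rule the_equality) (rule L, erule uq)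
  show "L \<in> sot_alg V X" using sot_alg.lim[OF ps sot_tendsto_if_norm_tendsto[OF psb L]] .
qed

text \<open>The partial sums are polynomials in \<open>X\<close>. The SOT calculus adds one limit;
  the radial calculus adds a norm limit for each scaled tuple and then a strong limit along a
  sequence of radii.\<close>

theorem calculus_condition_sot_alg:
  assumes X: "\<And>i. X i \<in> bdd_ops V V" and calc: "calculus_condition V f X M"
  shows "M j \<in> sot_alg V X"
  using calc unfolding calculus_condition_def
proof (elim disjE conjE)
  assume "X \<in> conv_SOT V f" and M: "\<forall>j. eval_SOT V (f j) X = M j"
  then obtain L where L: "sot_tendsto V (nc_psum V (f j) X) sequentially L"
    unfolding conv_SOT_def by blast
  have ps: "nc_psum V (f j) X m \<in> sot_alg V X" for m by (intro nc_psum_sot_alg sot_alg.var)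
  have uq: "L' = L" if "sot_tendsto V (nc_psum V (f j) X) sequentially L'" for L'
    using sot_tendsto_unique[OF sot_alg_bdd_ops[OF X ps] that L] by simp
  have "eval_SOT V (f j) X = L" unfolding eval_SOT_def by (rule the_equality) (rule L, erule uq)
  then show ?thesis using M sot_alg.lim[OF ps L] by simp
next
  assume "X \<in> conv_rad V f" and M: "\<forall>j. eval_rad V (f j) X = M j"
  then obtain \<delta> L where \<delta>: "0 < \<delta>" "\<delta> < 1"
    and nl: "\<And>r. \<delta> < r \<Longrightarrow> r < 1 \<Longrightarrow> \<exists>L. norm_tendsto V (nc_psum V (f j) (tuple_scale V r X)) L"
    and L: "sot_tendsto V (\<lambda>r. nc_eval V (f j) (tuple_scale V r X)) (at_left 1) L"
    unfolding conv_rad_def by blast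
  \<comment> \<open>A sequence replaces the filter \<open>at_left 1\<close> because
    \<open>sot_alg\<close> is closed under sequential limits. The denominator starts at 2, since 1
    would give the inadmissible radius \<open>\<delta>\<close>.\<close>
  define r where "r m = 1 - (1 - \<delta>) * (1 / real (Suc (Suc m)))" for m
  have r: "\<delta> < r m" "r m < 1" for m
  proof -
    have "(1 - \<delta>) * (1 / real (Suc (Suc m))) < (1 - \<delta>) * 1"
      using \<delta> by (intro mult_strict_left_mono) auto
    then show "\<delta> < r m" by (simp add: r_def)
    show "r m < 1" using \<delta> by (simp add: r_def)
  qed
  have "r \<longlonglongrightarrow> 1 - (1 - \<delta>) * 0"
    unfolding r_def by (intro tendsto_intros LIMSEQ_Suc[OF LIMSEQ_Suc[OF lim_1_over_n]])
  then have r_lim: "filterlim r (at_left 1) sequentially"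
    using r(2) by (auto simp: filterlim_at less_imp_neq)
  have ts: "tuple_scale V t X i \<in> sot_alg V X" for t i
    unfolding tuple_scale_def by (intro sot_alg.scale sot_alg.var)
  define T where "T m = nc_eval V (f j) (tuple_scale V (r m) X)" for m
  have T: "T m \<in> sot_alg V X" for m
  proof -
    obtain L' where "norm_tendsto V (nc_psum V (f j) (tuple_scale V (r m) X)) L'" using nl[OF r] by blast
    from norm_limit_sot_alg[OF X ts this] show ?thesis by (simp add: T_def)
  qed
  have sub: "sot_tendsto V T sequentially L'"
    if "sot_tendsto V (\<lambda>r. nc_eval V (f j) (tuple_scale V r X)) (at_left 1) L'" for L'
    using that filterlim_compose[OF _ r_lim] unfolding sot_tendsto_def T_def by blast
  have uq: "L' = L" if "sot_tendsto V (\<lambda>r. nc_eval V (f j) (tuple_scale V r X)) (at_left 1) L'" for L'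
    using sot_tendsto_unique[OF sot_alg_bdd_ops[OF X T] sub[OF that] sub[OF L]] by simp
  have "eval_rad V (f j) X = L" unfolding eval_rad_def by (rule the_equality) (rule L, erule uq)
  then show ?thesis using M sot_alg.lim[OF T sub[OF L]] by simp
qed

end

text \<open>Conjugation by \<open>U\<close> respects every rule that generates
  \<open>sot_alg\<close>; strong limits are preserved because \<open>U\<close> is isometric.
  \<open>W\<close> in the proof is the inverse of \<open>U\<close>, extended by zero.\<close>

theorem unitary_sot_alg:
  assumes V: "hilbert_space V" and K: "hilbert_space K" and U: "unitary_op V K U"
    and X: "\<And>i. X i \<in> bdd_ops V V" and Y: "\<And>i. Y i \<in> bdd_ops K K"
    and UX: "\<And>i h. h \<in> hcarrier V \<Longrightarrow> Y i (U h) = U (X i h)"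
    and A: "A \<in> sot_alg V X"
  shows "\<exists>A'\<in>sot_alg K Y. \<forall>h\<in>hcarrier V. A' (U h) = U (A h)"
proof -
  interpret V: hilbert_space V by (rule V)
  interpret K: hilbert_space K by (rule K)
  interpret VK: hilbert_pair V K ..
  interpret KV: hilbert_pair K V ..
  have Uop: "U \<in> bdd_ops V K" and Usurj: "U ` hcarrier V = hcarrier K"
    and Uip: "\<And>x y. x \<in> hcarrier V \<Longrightarrow> y \<in> hcarrier V \<Longrightarrow> hip K (U x) (U y) = hip V x y"
    using U by (auto simp: unitary_op_def)
  have Unorm: "hnorm K (U x) = hnorm V x" if "x \<in> hcarrier V" for x
    using Uip[OF that that] by (simp add: hnorm_def)
  have Uinj: "x = y" if "x \<in> hcarrier V" "y \<in> hcarrier V" "U x = U y" for x y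
    using Unorm[of "x - y"] VK.ops_diff[OF Uop that(1,2)] V.hnorm_eq_0_iff[of "x - y"] that by simp
  define W where "W y = (if y \<in> hcarrier K then SOME x. x \<in> hcarrier V \<and> U x = y else 0)" for y
  have W: "W y \<in> hcarrier V" "U (W y) = y" if "y \<in> hcarrier K" for y
  proof -
    have "\<exists>x. x \<in> hcarrier V \<and> U x = y" using that unfolding Usurj[symmetric] by blast
    from someI_ex[OF this] have "W y \<in> hcarrier V \<and> U (W y) = y" by (simp only: W_def that if_True)
    then show "W y \<in> hcarrier V" "U (W y) = y" by simp_all
  qed
  have UC: "U x \<in> hcarrier K" if "x \<in> hcarrier V" for x using bdd_opsD(1)[OF Uop that] .
  have WU: "W (U x) = x" if "x \<in> hcarrier V" for x using Uinj[OF W(1) that W(2)] UC[OF that] by blast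
  have Wop: "W \<in> bdd_ops K V"
  proof (rule bdd_opsI[where C = 1])
    fix x y assume xy: "x \<in> hcarrier K" "y \<in> hcarrier K"
    have "U (W x + W y) = x + y" using W xy by (simp add: bdd_opsD(2)[OF Uop])
    then show "W (x + y) = W x + W y" using WU[of "W x + W y"] W xy by simp
  next
    fix c x assume x: "x \<in> hcarrier K"
    have "U (hscale V c (W x)) = hscale K c x" using W x by (simp add: bdd_opsD(3)[OF Uop])
    then show "W (hscale K c x) = hscale V c (W x)" using WU[of "hscale V c (W x)"] W x by simp
  next
    fix x assume "x \<in> hcarrier K"
    then show "hnorm V (W x) \<le> 1 * hnorm K x" using Unorm[OF W(1)] W(2) by simp
  qed (use W in \<open>auto simp: W_def\<close>)
  note XB = V.sot_alg_bdd_ops[OF X]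
  have tr_op: "(\<lambda>y. U (B (W y))) \<in> bdd_ops K K" if "B \<in> bdd_ops V V" for B
    using ops_comp[OF K V K Uop ops_comp[OF K V V that Wop]] by (simp add: o_def)
  \<comment> \<open>Elements of \<open>sot_alg K Y\<close> are compared as functions on the whole
    type, so the conjugated operators must also agree off the carrier, where they vanish.\<close>
  have off: "B (W y) = 0" "U (B (W y)) = 0" if "y \<notin> hcarrier K" "B \<in> bdd_ops V V" for B y
    using that VK.ops_zero[OF Uop] hilbert_pair.ops_zero[of V V B] V by (auto simp: W_def hilbert_pair_def)
  have "(\<lambda>y. U (A (W y))) \<in> sot_alg K Y" using A
  proof (induction rule: sot_alg.induct)
    case ident
    have "(\<lambda>y. U (on_carrier V (\<lambda>x. x) (W y))) = on_carrier K (\<lambda>x. x)"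
      using W off[OF _ V.ops_id] by (auto simp: on_carrier_def fun_eq_iff)
    then show ?case using sot_alg.ident[of K Y] by simp
  next
    case (var i)
    have "(\<lambda>y. U (X i (W y))) = Y i"
    proof
      fix y show "U (X i (W y)) = Y i y"
        using W UX[of "W y" i] off(2)[OF _ X] bdd_opsD(4)[OF Y] by (cases "y \<in> hcarrier K") auto
    qed
    then show ?case using sot_alg.var[of Y i K] by simp
  next
    case (add B C)
    note b = XB[OF add(1)] and c = XB[OF add(2)]
    have "U (B (W y) + C (W y)) = U (B (W y)) + U (C (W y))" for y
      using W(1) bdd_opsD(1,4)[OF b, of "W y"] bdd_opsD(1,4)[OF c, of "W y"] bdd_opsD(2)[OF Uop]
      by (cases "y \<in> hcarrier K") (simp_all add: off b c VK.ops_zero[OF Uop])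
    then show ?case using sot_alg.add[OF add.IH] by simp
  next
    case (scale B c)
    note b = XB[OF scale(1)]
    have "U (hscale V c (B (W y))) = hscale K c (U (B (W y)))" for y
      using W(1) bdd_opsD(1)[OF b, of "W y"] bdd_opsD(3)[OF Uop]
      by (cases "y \<in> hcarrier K") (simp_all add: off b VK.ops_zero[OF Uop])
    then show ?case using sot_alg.scale[OF scale.IH, of c] by simp
  next
    case (comp B C)
    note b = XB[OF comp(1)] and c = XB[OF comp(2)]
    have "(\<lambda>y. U (B (C (W y)))) = (\<lambda>y. U (B (W y))) \<circ> (\<lambda>y. U (C (W y)))"
    proof
      fix y
      have "W (U (C (W y))) = C (W y)"
        using WU W(1) bdd_opsD(1)[OF c, of "W y"] off[OF _ c] KV.ops_zero[OF Wop]
        by (cases "y \<in> hcarrier K") auto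
      then show "U (B (C (W y))) = ((\<lambda>y. U (B (W y))) \<circ> (\<lambda>y. U (C (W y)))) y" by simp
    qed
    then show ?case using sot_alg.comp[OF comp.IH] by (simp add: o_def)
  next
    case (lim B L)
    note b = XB[OF lim.hyps(1)]
    have L: "L \<in> bdd_ops V V" and sl: "\<And>x. x \<in> hcarrier V \<Longrightarrow> (\<lambda>m. hnorm V (B m x - L x)) \<longlonglongrightarrow> 0"
      using lim.hyps(2) by (auto simp: sot_tendsto_def)
    have "(\<lambda>m. hnorm K (U (B m (W y)) - U (L (W y)))) \<longlonglongrightarrow> 0" if y: "y \<in> hcarrier K" for y
    proof -
      have "hnorm K (U (B m (W y)) - U (L (W y))) = hnorm V (B m (W y) - L (W y))" for m
        using Unorm[of "B m (W y) - L (W y)"] bdd_opsD(1)[OF b W(1)[OF y], of m] bdd_opsD(1)[OF L W(1)[OF y]]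
        by (simp add: VK.ops_diff[OF Uop])
      then show ?thesis using sl[OF W(1)[OF y]] by simp
    qed
    then have "sot_tendsto K (\<lambda>m y. U (B m (W y))) sequentially (\<lambda>y. U (L (W y)))"
      using tr_op[OF L] by (simp add: sot_tendsto_def)
    with lim.IH show ?case by (rule sot_alg.lim[where T = "\<lambda>m y. U (B m (W y))"])
  qed
  moreover have "U (A (W (U h))) = U (A h)" if "h \<in> hcarrier V" for h using WU[OF that] by simp
  ultimately show ?thesis by (intro bexI[of _ "\<lambda>y. U (A (W y))"]) auto
qed

text \<open>The power series and free holomorphic models share this frame, in which
  \<open>\<Phi>\<close> sends a coefficient sequence to an element of the space. \<open>V\<close> is
  not assumed to be a Hilbert space: the axioms come from \<open>K\<close> through \<open>U\<close>,
  completeness because \<open>U\<close> is isometric and onto.\<close>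

theorem parametrized_creation_model:
  fixes V :: "('v::ab_group_add) hilb" and K :: "('k::ab_group_add) hilb" and f :: "'n::finite \<Rightarrow> 'n ncseries"
  assumes vs: "vector_space (hscale V)" and car: "hcarrier V = \<Phi> ` H2_ball"
    and \<Phi>_add: "\<And>a b. a \<in> H2_ball \<Longrightarrow> b \<in> H2_ball \<Longrightarrow> \<Phi> (a + b) = \<Phi> a + \<Phi> b"
    and \<Phi>_scale: "\<And>c a. a \<in> H2_ball \<Longrightarrow> \<Phi> (nc_scale c a) = hscale V c (\<Phi> a)"
    and \<Phi>_ip: "\<And>a b. a \<in> H2_ball \<Longrightarrow> b \<in> H2_ball \<Longrightarrow> hip V (\<Phi> a) (\<Phi> b) = H2_ball_ip a b"
    and X: "\<And>i. X i \<in> bdd_ops V V"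
    and calc: "calculus_condition V f X M"
    and M_word: "\<And>j w. M j (\<Phi> (nc_word nc_var w)) = \<Phi> (nc_word nc_var (j # w))"
    and A: "\<And>i. A i \<in> H2_ball"
    and X_word: "\<And>i w. X i (\<Phi> (nc_word nc_var w)) = \<Phi> (nc_mult (A i) (nc_word nc_var w))"
    and uni: "unitarily_equiv V X K MZ"
  shows "\<exists>e S. creation_model K MZ e S"
proof -
  interpret vs: vector_space "hscale V" by (rule vs)
  have K: "hilbert_space K" and MZ: "\<And>i. MZ i \<in> bdd_ops K K"
    using uni by (auto simp: unitarily_equiv_def)
  interpret K: hilbert_space K by (rule K)
  obtain U where U: "unitary_op V K U" and MZ_U: "\<And>i h. h \<in> hcarrier V \<Longrightarrow> MZ i (U h) = U (X i h)"
    using uni by (auto simp: unitarily_equiv_def)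
  have Uop: "U \<in> bdd_ops V K" and Usurj: "U ` hcarrier V = hcarrier K"
    and Uip: "\<And>x y. x \<in> hcarrier V \<Longrightarrow> y \<in> hcarrier V \<Longrightarrow> hip K (U x) (U y) = hip V x y"
    using U by (auto simp: unitary_op_def)
  note UC = bdd_opsD(1)[OF Uop] and U_add = bdd_opsD(2)[OF Uop] and U_scale = bdd_opsD(3)[OF Uop]
  have \<Phi>_0: "\<Phi> 0 = 0" using \<Phi>_scale[OF H2_ball_zero, of 0] by simp
  have \<Phi>C: "\<Phi> a \<in> hcarrier V" if "a \<in> H2_ball" for a using car that by simp
  have sub: "vs.subspace (hcarrier V)"
  proof (rule vs.subspaceI)
    show "0 \<in> hcarrier V" using \<Phi>C[OF H2_ball_zero] \<Phi>_0 by simp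
    fix x y assume "x \<in> hcarrier V" "y \<in> hcarrier V"
    then show "x + y \<in> hcarrier V" unfolding car by (auto simp: \<Phi>_add[symmetric] intro: H2_ball_add)
  next
    fix c x assume "x \<in> hcarrier V"
    then show "hscale V c x \<in> hcarrier V" unfolding car by (auto simp: \<Phi>_scale[symmetric] intro: H2_ball_scale)
  qed
  have V0: "0 \<in> hcarrier V" using vs.subspace_0[OF sub] .
  have U0: "U 0 = 0" using U_scale[OF V0, of 0] by simp
  have U_diff: "U (x - y) = U x - U y" if "x \<in> hcarrier V" "y \<in> hcarrier V" for x y
    using U_add[of "x - y" y] vs.subspace_diff[OF sub that] that by simp
  have Unorm: "hnorm K (U x) = hnorm V x" if "x \<in> hcarrier V" for x
    using Uip[OF that that] by (simp add: hnorm_def)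
  have coeff: "hip K (U (\<Phi> b)) (U (\<Phi> (nc_word nc_var w))) = b w" if "b \<in> H2_ball" for b w
    using that by (simp add: Uip \<Phi>C \<Phi>_ip H2_ball_word H2_ball_ip_word)
  \<comment> \<open>Positivity of \<open>hip V\<close> is not yet available here. Injectivity of
    \<open>U\<close> comes instead from coefficients: pairing with the images of the unit sequences
    recovers each \<open>b w\<close>.\<close>
  have zero: "x = 0" if x: "x \<in> hcarrier V" and o: "\<And>w. hip K (U x) (U (\<Phi> (nc_word nc_var w))) = 0" for x
  proof -
    obtain b where b: "b \<in> H2_ball" "x = \<Phi> b" using x unfolding car by blast
    have "b = 0" using o coeff[OF b(1)] b(2) by (simp add: fun_eq_iff)
    then show ?thesis using b \<Phi>_0 by simp
  qed
  have V: "hilbert_space V"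
  proof (intro hilbert_space.intro hilbert_space_axioms.intro vs sub)
    fix x y z assume "x \<in> hcarrier V" "y \<in> hcarrier V" "z \<in> hcarrier V"
    then show "hip V (x + y) z = hip V x z + hip V y z"
      using vs.subspace_add[OF sub] by (simp add: Uip[symmetric] U_add UC K.ip_add)
  next
    fix c x y assume "x \<in> hcarrier V" "y \<in> hcarrier V"
    then show "hip V (hscale V c x) y = c * hip V x y"
      using vs.subspace_scale[OF sub] by (simp add: Uip[symmetric] U_scale UC K.ip_scale)
  next
    fix x y assume xy: "x \<in> hcarrier V" "y \<in> hcarrier V"
    show "hip V x y = cnj (hip V y x)"
      using K.ip_cnj[OF UC[OF xy(1)] UC[OF xy(2)]] Uip[OF xy] Uip[OF xy(2,1)] by simp
  next
    fix x assume x: "x \<in> hcarrier V" "x \<noteq> 0"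
    have "U x \<noteq> 0"
    proof
      assume "U x = 0"
      then have "x = 0" using x(1) UC \<Phi>C[OF H2_ball_word] by (intro zero) auto
      then show False using x by simp
    qed
    then show "0 < Re (hip V x x)" using K.ip_pos[OF UC[OF x(1)]] Uip[OF x(1) x(1)] by simp
  next
    fix s :: "nat \<Rightarrow> 'v"
    assume s: "\<And>k. s k \<in> hcarrier V" and c: "\<And>r. 0 < r \<Longrightarrow> \<exists>M. \<forall>j\<ge>M. \<forall>k\<ge>M. hnorm V (s j - s k) < r"
    have d: "hnorm K (U (s j) - U x) = hnorm V (s j - x)" if "x \<in> hcarrier V" for j x
      using Unorm[of "s j - x"] vs.subspace_diff[OF sub s that] U_diff[OF s that] by simp
    have "\<exists>l\<in>hcarrier K. (\<lambda>k. hnorm K (U (s k) - l)) \<longlonglongrightarrow> 0"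
      using K.complete[of "\<lambda>k. U (s k)"] UC[OF s] c by (simp add: d[OF s])
    then obtain l where "l \<in> hcarrier V" "(\<lambda>k. hnorm K (U (s k) - U l)) \<longlonglongrightarrow> 0"
      unfolding Usurj[symmetric] by blast
    then show "\<exists>l\<in>hcarrier V. (\<lambda>k. hnorm V (s k - l)) \<longlonglongrightarrow> 0" by (auto simp: d)
  qed
  interpret V: hilbert_space V by (rule V)
  define e where "e w = U (\<Phi> (nc_word nc_var w))" for w
  have eC: "e w \<in> hcarrier K" for w using UC \<Phi>C by (simp add: e_def H2_ball_word)
  have "\<exists>S. S \<in> sot_alg K MZ \<and> (\<forall>h\<in>hcarrier V. S (U h) = U (M j h))" for j
    using unitary_sot_alg[OF V K U X MZ MZ_U V.calculus_condition_sot_alg[OF X calc]] by blast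
  then obtain S where S: "\<And>j. S j \<in> sot_alg K MZ" "\<And>j h. h \<in> hcarrier V \<Longrightarrow> S j (U h) = U (M j h)"
    by metis
  have MZ_e: "hip K (MZ i (e \<beta>)) (e \<delta>) = nc_mult (A i) (nc_word nc_var \<beta>) \<delta>" for i \<beta> \<delta>
    using coeff[OF H2_ball_mult_word[OF A]] by (simp add: e_def MZ_U \<Phi>C H2_ball_word X_word)
  have "creation_model K MZ e S"
  proof (rule creation_modelI[OF K MZ S(1), where A = A])
    show "S j (e w) = e (j # w)" for j w
      using S(2)[OF \<Phi>C[OF H2_ball_word]] M_word by (simp add: e_def)
    show "hip K (e v) (e w) = (if v = w then 1 else 0)" for v w
      using coeff[OF H2_ball_word, of v w] by (auto simp: e_def nc_word_var)
    show "htotal K (range e)"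
    proof (rule K.htotal_if_orthogonal_trivial)
      fix y assume y: "y \<in> hcarrier K" and o: "\<And>d. d \<in> range e \<Longrightarrow> hip K y d = 0"
      obtain x where x: "x \<in> hcarrier V" "y = U x" using y unfolding Usurj[symmetric] by blast
      have "x = 0" using o x by (intro zero) (auto simp: e_def)
      then show "y = 0" using x U0 by simp
    qed (use eC in auto)
    show "hip K (MZ i (e \<beta>)) (e (\<alpha> @ \<beta>)) = A i \<alpha>" for i \<alpha> \<beta>
      by (simp add: MZ_e nc_mult_word_append)
    show "hip K (MZ i (e \<beta>)) (e \<delta>) = 0" if "\<nexists>\<alpha>. \<delta> = \<alpha> @ \<beta>" for i \<beta> \<delta>
      using nc_mult_word_zero[OF that] by (simp add: MZ_e)
  qed (rule eC)
  then show ?thesis by blast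
qed

section \<open>Formal power series with invertible linear part\<close>

lemma finite_words_le: "finite {\<alpha> :: 'n::finite list. length \<alpha> \<le> n}"
  using finite_lists_length_le[of "UNIV :: 'n set" n] by simp

lemma finite_words: "finite {\<alpha> :: 'n::finite list. length \<alpha> = n}"
  using finite_lists_length_eq[of "UNIV :: 'n set" n] by simp

lemma sum_words_Suc:
  "(\<Sum>\<alpha> :: 'n::finite list | length \<alpha> = Suc n. g \<alpha>) = (\<Sum>i\<in>UNIV. \<Sum>\<alpha> | length \<alpha> = n. g (i # \<alpha>))"
proof -
  have "{\<alpha> :: 'n list. length \<alpha> = Suc n} = (\<lambda>(i, \<alpha>). i # \<alpha>) ` (UNIV \<times> {\<alpha>. length \<alpha> = n})"
    by (auto simp: length_Suc_conv image_iff)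
  then have "(\<Sum>\<alpha> :: 'n list | length \<alpha> = Suc n. g \<alpha>) = (\<Sum>(i, \<alpha>)\<in>UNIV \<times> {\<alpha>. length \<alpha> = n}. g (i # \<alpha>))"
    by (simp add: sum.reindex inj_on_def case_prod_beta)
  then show ?thesis by (simp add: sum.cartesian_product)
qed

text \<open>Each factor lacks a constant term and so uses up at least one letter.\<close>

lemma nc_word_short:
  assumes "\<And>j. f j [] = 0"
  shows "length w < length \<alpha> \<Longrightarrow> nc_word f \<alpha> w = 0"
proof (induction \<alpha> arbitrary: w)
  case (Cons i \<alpha>)
  have "f i (take k w) * nc_word f \<alpha> (drop k w) = 0" for k
  proof (cases "take k w")
    case (Cons a v)
    then have "length (drop k w) < length w" by (cases k; cases w) auto
    then have "nc_word f \<alpha> (drop k w) = 0" using Cons.prems by (intro Cons.IH) simp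
    then show ?thesis by simp
  next
    case Nil
    then show ?thesis by (simp only: assms mult_zero_left)
  qed
  then show ?case unfolding nc_word.simps nc_mult_def by (intro sum.neutral) blast
qed simp

text \<open>When the degree equals the number of factors, each factor contributes exactly one
  letter, so only linear coefficients remain.\<close>

lemma nc_word_leading:
  assumes f0: "\<And>j. f j [] = 0" and len: "length v = length \<alpha>"
  shows "nc_word f (i # \<alpha>) (j # v) = f i [j] * nc_word f \<alpha> v"
proof -
  have "nc_word f (i # \<alpha>) (j # v) = nc_mult (\<lambda>u. f i (j # u)) (nc_word f \<alpha>) v"
    by (simp add: nc_mult_Cons f0)
  also have "\<dots> = (\<Sum>k\<le>length v. if k = 0 then f i [j] * nc_word f \<alpha> v else 0)"
    unfolding nc_mult_def
  proof (rule sum.cong)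
    fix k assume k: "k \<in> {..length v}"
    show "f i (j # take k v) * nc_word f \<alpha> (drop k v) = (if k = 0 then f i [j] * nc_word f \<alpha> v else 0)"
    proof (cases "k = 0")
      case False
      then have "nc_word f \<alpha> (drop k v) = 0" using k len by (intro nc_word_short f0) auto
      then show ?thesis using False by simp
    qed simp
  qed simp
  finally show ?thesis by simp
qed

text \<open>In lowest degree the words of \<open>f\<close> are governed by a tensor power of the
  Jacobian at 0. Its injectivity is shown one factor at a time: the induction hypothesis disposes of
  the tails, invertibility of the Jacobian of the first letters.\<close>

lemma leading_coeffs_zero:
  fixes f :: "'n::finite \<Rightarrow> 'n ncseries"
  assumes f0: "\<And>j. f j [] = 0" and det: "det (\<chi> i j. f i [j]) \<noteq> 0"
  shows "(\<And>w. length w = n \<Longrightarrow> (\<Sum>\<alpha> | length \<alpha> = n. b \<alpha> * nc_word f \<alpha> w) = 0)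
    \<Longrightarrow> length \<alpha> = n \<Longrightarrow> b \<alpha> = 0"
proof (induction n arbitrary: b \<alpha>)
  case 0
  then show ?case using "0.prems"(1)[of "[]"] by (simp add: nc_one_def)
next
  case (Suc n)
  obtain i0 \<alpha>' where \<alpha>: "\<alpha> = i0 # \<alpha>'" "length \<alpha>' = n" using Suc.prems(2) by (auto simp: length_Suc_conv)
  have c: "(\<Sum>i\<in>UNIV. b (i # \<beta>) * f i [j]) = 0" if \<beta>: "length \<beta> = n" for j \<beta>
  proof (rule Suc.IH[of "\<lambda>\<beta>. \<Sum>i\<in>UNIV. b (i # \<beta>) * f i [j]", OF _ \<beta>])
    fix v :: "'n list" assume v: "length v = n"
    have "0 = (\<Sum>\<alpha> | length \<alpha> = Suc n. b \<alpha> * nc_word f \<alpha> (j # v))"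
      using Suc.prems(1)[of "j # v"] v by simp
    also have "\<dots> = (\<Sum>i\<in>UNIV. \<Sum>\<alpha> | length \<alpha> = n. b (i # \<alpha>) * nc_word f (i # \<alpha>) (j # v))"
      by (rule sum_words_Suc)
    also have "\<dots> = (\<Sum>i\<in>UNIV. \<Sum>\<alpha> | length \<alpha> = n. b (i # \<alpha>) * (f i [j] * nc_word f \<alpha> v))"
      using v nc_word_leading[of f, OF f0] by (intro sum.cong refl) (metis (mono_tags, lifting) mem_Collect_eq)
    also have "\<dots> = (\<Sum>\<alpha> | length \<alpha> = n. (\<Sum>i\<in>UNIV. b (i # \<alpha>) * f i [j]) * nc_word f \<alpha> v)"
      by (subst sum.swap) (simp add: sum_distrib_right mult.assoc)
    finally show "(\<Sum>\<alpha> | length \<alpha> = n. (\<Sum>i\<in>UNIV. b (i # \<alpha>) * f i [j]) * nc_word f \<alpha> v) = 0" by simp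
  qed
  \<comment> \<open>The sum in \<open>c\<close> runs over the row index of the Jacobian, hence the
    transpose.\<close>
  define J where "J = transpose (\<chi> i j. f i [j])"
  have "invertible J" using det by (simp add: J_def invertible_det_nz)
  then have ker: "\<forall>x. J *v x = 0 \<longrightarrow> x = 0"
    unfolding invertible_def using matrix_left_invertible_ker[of J] by blast
  have "J *v (\<chi> i. b (i # \<alpha>')) = 0"
    using c[OF \<alpha>(2)] by (simp add: J_def matrix_vector_mult_def transpose_def vec_eq_iff mult.commute)
  then have "(\<chi> i. b (i # \<alpha>')) = 0" using ker by blast
  then show ?case using \<alpha> by (simp add: vec_eq_iff)
qed

text \<open>At words of length \<open>n\<close> only \<open>\<alpha>\<close> of length at most
  \<open>n\<close> contribute. The shorter coefficients vanish by induction on the degree, and the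
  leading ones by invertibility of the Jacobian.\<close>

lemma series_comb_eq_0_imp:
  fixes f :: "'n::finite \<Rightarrow> 'n ncseries"
  assumes f0: "\<And>j. f j [] = 0" and det: "det (\<chi> i j. f i [j]) \<noteq> 0" and a: "series_comb f a = 0"
  shows "a = 0"
proof
  fix \<alpha>
  have "\<forall>\<alpha>. length \<alpha> = n \<longrightarrow> a \<alpha> = 0" for n
  proof (induction n rule: less_induct)
    case (less n)
    have "(\<Sum>\<alpha> | length \<alpha> = n. a \<alpha> * nc_word f \<alpha> w) = 0" if w: "length w = n" for w
    proof -
      have "0 = (\<Sum>\<alpha> | length \<alpha> \<le> n. a \<alpha> * nc_word f \<alpha> w)"
        using fun_cong[OF a, of w] w by (simp add: series_comb_def)
      also have "\<dots> = (\<Sum>\<alpha> | length \<alpha> = n. a \<alpha> * nc_word f \<alpha> w)"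
        by (rule sum.mono_neutral_right[OF finite_words_le]) (use less in \<open>auto simp: le_less\<close>)
      finally show ?thesis by simp
    qed
    then show ?case using leading_coeffs_zero[OF f0 det, of n a] by blast
  qed
  then show "a \<alpha> = 0 \<alpha>" by simp
qed

lemma series_comb_add: "series_comb f (a + b) = series_comb f a + series_comb f b"
  by (simp add: series_comb_def fun_eq_iff distrib_right sum.distrib)

lemma series_comb_scale: "series_comb f (nc_scale c a) = nc_scale c (series_comb f a)"
  by (simp add: series_comb_def fun_eq_iff nc_scale_apply sum_distrib_left mult.assoc)

lemma series_comb_word:
  assumes "\<And>j. f j [] = 0"
  shows "series_comb f (nc_word nc_var w) = nc_word f w"
proof
  fix v
  have "series_comb f (nc_word nc_var w) v =
      (\<Sum>\<alpha> | length \<alpha> \<le> length v. if \<alpha> = w then nc_word f w v else 0)"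
    unfolding series_comb_def nc_word_var by (intro sum.cong) auto
  also have "\<dots> = (if length w \<le> length v then nc_word f w v else 0)"
    by (simp add: sum.delta finite_words_le)
  finally show "series_comb f (nc_word nc_var w) v = nc_word f w v"
    using nc_word_short[of f v w] assms by (simp add: not_le)
qed

text \<open>Both sides expand over the words \<open>\<alpha> @ \<beta>\<close>. Words of
  \<open>f\<close> vanish on shorter words, so the cut-off in \<open>series_comb\<close> can be
  enlarged to \<open>length w\<close> and reduced again without changing any sum. This gives the
  action of \<open>MZ_S\<close> on basis vectors.\<close>

lemma series_comb_mult_word:
  fixes f :: "'n::finite \<Rightarrow> 'n ncseries"
  assumes f0: "\<And>j. f j [] = 0"
  shows "nc_mult (series_comb f a) (nc_word f \<beta>) = series_comb f (nc_mult a (nc_word nc_var \<beta>))"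
proof
  fix w :: "'n list"
  have "nc_mult (series_comb f a) (nc_word f \<beta>) w =
      (\<Sum>k\<le>length w. \<Sum>\<alpha> | length \<alpha> \<le> length w. a \<alpha> * (nc_word f \<alpha> (take k w) * nc_word f \<beta> (drop k w)))"
    unfolding nc_mult_def
  proof (rule sum.cong)
    fix k
    have "series_comb f a (take k w) = (\<Sum>\<alpha> | length \<alpha> \<le> length w. a \<alpha> * nc_word f \<alpha> (take k w))"
      unfolding series_comb_def
      by (rule sum.mono_neutral_left[OF finite_words_le]) (auto intro!: nc_word_short f0)
    then show "series_comb f a (take k w) * nc_word f \<beta> (drop k w) =
        (\<Sum>\<alpha> | length \<alpha> \<le> length w. a \<alpha> * (nc_word f \<alpha> (take k w) * nc_word f \<beta> (drop k w)))"
      by (simp add: sum_distrib_right mult.assoc)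
  qed simp
  also have "\<dots> = (\<Sum>\<alpha> | length \<alpha> \<le> length w. a \<alpha> * nc_word f (\<alpha> @ \<beta>) w)"
    by (subst sum.swap) (simp add: nc_word_append nc_mult_def sum_distrib_left)
  also have "\<dots> = (\<Sum>\<alpha> | length (\<alpha> @ \<beta>) \<le> length w. a \<alpha> * nc_word f (\<alpha> @ \<beta>) w)"
    by (rule sum.mono_neutral_right[OF finite_words_le]) (auto simp: f0 intro!: nc_word_short)
  also have "\<dots> = (\<Sum>\<gamma>\<in>(\<lambda>\<alpha>. \<alpha> @ \<beta>) ` {\<alpha>. length (\<alpha> @ \<beta>) \<le> length w}.
      nc_mult a (nc_word nc_var \<beta>) \<gamma> * nc_word f \<gamma> w)"
    by (subst sum.reindex) (auto simp: inj_on_def nc_mult_word_append)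
  also have "\<dots> = series_comb f (nc_mult a (nc_word nc_var \<beta>)) w"
    unfolding series_comb_def
    by (rule sum.mono_neutral_left[OF finite_words_le]) (auto intro!: nc_mult_word_zero)
  finally show "nc_mult (series_comb f a) (nc_word f \<beta>) w =
      series_comb f (nc_mult a (nc_word nc_var \<beta>)) w" .
qed

text \<open>The nonzero determinant makes \<open>series_comb f\<close> injective, so the
  \<open>THE\<close> in \<open>series_coeffs\<close> inverts it and the inner product is that of
  coefficient sequences.\<close>

theorem model_S_creation_model:
  fixes f :: "'n::finite \<Rightarrow> 'n ncseries" and K :: "('k::ab_group_add) hilb"
  assumes S: "model_S f" and uni: "unitarily_equiv (H2_S f) (MZ_S f) K MZ"
  shows "\<exists>e S. creation_model K MZ e S"
proof -
  have f0: "\<And>j. f j [] = 0" and det: "det (\<chi> i j. f i [j]) \<noteq> 0"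
    and vars: "\<And>i. nc_var i \<in> hcarrier (H2_S f)"
    and X: "\<And>i. MZ_S f i \<in> bdd_ops (H2_S f) (H2_S f)"
    and calc: "calculus_condition (H2_S f) f (MZ_S f) (Mf_S f)"
    using S by (auto simp: model_S_def)
  have car: "hcarrier (H2_S f) = series_comb f ` H2_ball" by (simp add: H2_S_def)
  have inj: "a = b" if "series_comb f a = series_comb f b" for a b
  proof -
    have "series_comb f (a + nc_scale (-1) b) = 0"
      unfolding series_comb_add series_comb_scale that by (simp add: fun_eq_iff nc_scale_apply)
    from series_comb_eq_0_imp[OF f0 det this] show ?thesis by (simp add: fun_eq_iff nc_scale_apply)
  qed
  have coeffs: "series_coeffs f (series_comb f a) = a" if "a \<in> H2_ball" for a
    unfolding series_coeffs_def using that inj by (intro the_equality) auto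
  have "\<exists>a. a \<in> H2_ball \<and> nc_var i = series_comb f a" for i using vars[of i] unfolding car by blast
  then obtain A where A: "\<And>i. A i \<in> H2_ball" "\<And>i. nc_var i = series_comb f (A i)" by metis
  have wordC: "series_comb f (nc_word nc_var w) \<in> hcarrier (H2_S f)" for w
    unfolding car using H2_ball_word by blast
  show ?thesis
  proof (rule parametrized_creation_model[where V = "H2_S f" and \<Phi> = "series_comb f" and f = f
        and X = "MZ_S f" and M = "Mf_S f" and A = A and MZ = MZ])
    show "vector_space (hscale (H2_S f))" using nc.vector_space_axioms by (simp add: H2_S_def)
    show "series_comb f (nc_scale c a) = hscale (H2_S f) c (series_comb f a)" for c a
      by (simp add: H2_S_def series_comb_scale)
    show "hip (H2_S f) (series_comb f a) (series_comb f b) = H2_ball_ip a b"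
      if "a \<in> H2_ball" "b \<in> H2_ball" for a b
      using coeffs that by (simp add: H2_S_def)
    show "Mf_S f j (series_comb f (nc_word nc_var w)) = series_comb f (nc_word nc_var (j # w))" for j w
      using wordC by (simp add: Mf_S_def on_carrier_def series_comb_word[of f, OF f0] del: nc_word.simps)
        (simp add: nc_word.simps)
    show "MZ_S f i (series_comb f (nc_word nc_var w)) = series_comb f (nc_mult (A i) (nc_word nc_var w))" for i w
      using wordC by (simp add: MZ_S_def on_carrier_def series_comb_word[of f, OF f0] A(2)
          series_comb_mult_word[of f, OF f0])
  qed (use car X calc A(1) uni series_comb_add in auto)
qed

section \<open>Free holomorphic functions\<close>

text \<open>The degree-wise sums of squares are bounded, and the roots in \<open>nc_radius\<close>
  of a positive constant tend to 1. The nondegeneracy condition of \<open>model_F\<close> thereby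
  applies to square-summable series.\<close>

lemma H2_ball_free_holomorphic:
  assumes a: "a \<in> H2_ball"
  shows "free_holomorphic 1 (a :: 'n::finite ncseries)"
proof -
  define s where "s k = (\<Sum>\<alpha> :: 'n list | length \<alpha> = k. (cmod (a \<alpha>))\<^sup>2)" for k
  \<comment> \<open>The maximum keeps \<open>C\<close> away from 0, so that its powers with
    exponents tending to 0 converge to 1.\<close>
  define C where "C = max 1 (infsum (\<lambda>\<alpha>. (cmod (a \<alpha>))\<^sup>2) UNIV)"
  define u where "u k = ereal (s k powr (1 / (2 * real k)))" for k
  have s0: "0 \<le> s k" for k unfolding s_def by (intro sum_nonneg) auto
  have sC: "s k \<le> C" for k
    unfolding s_def C_def using a
    by (intro max.coboundedI2 finite_sum_le_infsum) (auto simp: H2_ball_def finite_words)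
  have C1: "1 \<le> C" by (simp add: C_def)
  have "(\<lambda>k. 1 / (2 * real k)) \<longlonglongrightarrow> 0"
    using tendsto_mult_left[OF lim_1_over_n, of "1/2"] by simp
  then have "(\<lambda>k. C powr (1 / (2 * real k))) \<longlonglongrightarrow> C powr 0"
    using C1 by (intro tendsto_powr tendsto_const) auto
  then have "(\<lambda>k. ereal (C powr (1 / (2 * real k)))) \<longlonglongrightarrow> 1"
    using C1 by (simp add: one_ereal_def)
  then have "limsup (\<lambda>k. ereal (C powr (1 / (2 * real k)))) = 1"
    by (intro lim_imp_Limsup) auto
  moreover have "limsup u \<le> limsup (\<lambda>k. ereal (C powr (1 / (2 * real k))))"
    unfolding u_def using s0 sC by (intro Limsup_mono always_eventually allI) (simp add: powr_mono2)
  ultimately have le: "limsup u \<le> 1" by simp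
  have "limsup (\<lambda>k::nat. 0) \<le> limsup u"
    unfolding u_def by (intro Limsup_mono always_eventually allI) simp
  then have ge: "0 \<le> limsup u" by (simp add: Limsup_const)
  have "inverse 1 \<le> inverse (limsup u)" using ereal_inverse_antimono[OF ge le] .
  then show ?thesis
    unfolding free_holomorphic_def nc_radius_def u_def s_def by (simp add: one_ereal_def)
qed

section \<open>Adjoints and convergence on the open row ball\<close>

context hilbert_space
begin

sublocale VV: hilbert_pair V V ..

lemma hlim_add:
  assumes "\<And>k. s k \<in> hcarrier V" "\<And>k. t k \<in> hcarrier V" "l \<in> hcarrier V" "m \<in> hcarrier V"
    "((\<lambda>k. hnorm V (s k - l)) \<longlongrightarrow> 0) F" "((\<lambda>k. hnorm V (t k - m)) \<longlongrightarrow> 0) F"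
  shows "((\<lambda>k. hnorm V (s k + t k - (l + m))) \<longlongrightarrow> 0) F"
proof (rule Lim_null_comparison)
  show "((\<lambda>k. hnorm V (s k - l) + hnorm V (t k - m)) \<longlongrightarrow> 0) F"
    using tendsto_add[OF assms(5,6)] by simp
  have "hnorm V (s k + t k - (l + m)) \<le> hnorm V (s k - l) + hnorm V (t k - m)" for k
    using hnorm_triangle[of "s k - l" "t k - m"] assms(1-4) by (simp add: add_diff_add)
  then show "\<forall>\<^sub>F k in F. norm (hnorm V (s k + t k - (l + m))) \<le> hnorm V (s k - l) + hnorm V (t k - m)"
    using assms(1-4) by simp
qed

lemma hlim_scale:
  assumes "\<And>k. s k \<in> hcarrier V" "l \<in> hcarrier V" "((\<lambda>k. hnorm V (s k - l)) \<longlongrightarrow> 0) F"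
  shows "((\<lambda>k. hnorm V (hscale V c (s k) - hscale V c l)) \<longlongrightarrow> 0) F"
  using tendsto_mult_left[OF assms(3), of "cmod c"] assms(1,2)
  by (simp add: hnorm_scale flip: scale_right_diff_distrib)

text \<open>Riesz representation supplies the values. Existence matters because
  \<open>row_norm\<close> is built from \<open>adj\<close>, which is defined by
  \<open>THE\<close>.\<close>

lemma adjoint_ex:
  assumes T: "T \<in> bdd_ops V V"
  shows "\<exists>S\<in>bdd_ops V V. \<forall>x\<in>hcarrier V. \<forall>y\<in>hcarrier V. hip V (T x) y = hip V x (S y)"
proof -
  have uniq: "z = z'" if "z \<in> hcarrier V" "z' \<in> hcarrier V"
    and eq: "\<And>x. x \<in> hcarrier V \<Longrightarrow> hip V x z = hip V x z'" for z z'
  proof -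
    have "hip V (z - z') (z - z') = 0"
      using eq[of "z - z'"] that(1,2) by (simp add: ip_diff_right)
    then show ?thesis using that(1,2) ip_self_eq_0_iff[of "z - z'"] by simp
  qed
  have "\<forall>y. \<exists>z. y \<in> hcarrier V \<longrightarrow> z \<in> hcarrier V \<and> (\<forall>x\<in>hcarrier V. hip V (T x) y = hip V x z)"
    using Riesz[OF VV.bf_ip_op[OF T]] by blast
  then obtain S0 where S0: "\<And>y. y \<in> hcarrier V \<Longrightarrow> S0 y \<in> hcarrier V"
    "\<And>x y. y \<in> hcarrier V \<Longrightarrow> x \<in> hcarrier V \<Longrightarrow> hip V (T x) y = hip V x (S0 y)"
    by metis
  define S where "S = on_carrier V S0"
  have SC: "S y \<in> hcarrier V" and S: "\<And>x. x \<in> hcarrier V \<Longrightarrow> hip V (T x) y = hip V x (S y)"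
    if "y \<in> hcarrier V" for y
    using S0 that by (auto simp: S_def on_carrier_def)
  note TC = bdd_opsD(1)[OF T]
  obtain C where C: "0 \<le> C" "\<And>x. x \<in> hcarrier V \<Longrightarrow> hnorm V (T x) \<le> C * hnorm V x"
    using VV.bdd_ops_bound[OF T] by blast
  have "S \<in> bdd_ops V V"
  proof (rule bdd_opsI[where C = C])
    fix x y assume xy: "x \<in> hcarrier V" "y \<in> hcarrier V"
    show "S (x + y) = S x + S y"
    proof (rule uniq)
      fix z assume z: "z \<in> hcarrier V"
      show "hip V z (S (x + y)) = hip V z (S x + S y)"
        using xy z SC TC by (simp add: S[symmetric] ip_add_right)
    qed (use xy SC in auto)
  next
    fix c x assume x: "x \<in> hcarrier V"
    show "S (hscale V c x) = hscale V c (S x)"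
    proof (rule uniq)
      fix z assume z: "z \<in> hcarrier V"
      show "hip V z (S (hscale V c x)) = hip V z (hscale V c (S x))"
        using x z SC TC by (simp add: S[symmetric] ip_scale_right)
    qed (use x SC in auto)
  next
    fix y assume y: "y \<in> hcarrier V"
    have Sy: "S y \<in> hcarrier V" using SC y .
    show "hnorm V (S y) \<le> C * hnorm V y"
    proof (cases "S y = 0")
      case False
      have "(hnorm V (S y))\<^sup>2 = Re (hip V (T (S y)) y)" using S[OF y Sy] hnorm_sq[OF Sy] by simp
      also have "\<dots> \<le> cmod (hip V (T (S y)) y)" by (rule complex_Re_le_cmod)
      also have "\<dots> \<le> hnorm V (T (S y)) * hnorm V y" using Cauchy_Schwarz[OF TC[OF Sy] y] .
      also have "\<dots> \<le> (C * hnorm V (S y)) * hnorm V y" using C(2)[OF Sy] y by (intro mult_right_mono) auto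
      finally have "hnorm V (S y) * hnorm V (S y) \<le> hnorm V (S y) * (C * hnorm V y)"
        by (simp add: power2_eq_square mult_ac)
      then show ?thesis using hnorm_pos[OF Sy False] by simp
    qed (use C y in simp)
  qed (use SC in \<open>auto simp: S_def on_carrier_def\<close>)
  then show ?thesis using S by blast
qed

lemma adj:
  assumes T: "T \<in> bdd_ops V V"
  shows "adj V T \<in> bdd_ops V V"
    and "x \<in> hcarrier V \<Longrightarrow> y \<in> hcarrier V \<Longrightarrow> hip V (T x) y = hip V x (adj V T y)"
proof -
  obtain S where S: "S \<in> bdd_ops V V" "\<And>x y. x \<in> hcarrier V \<Longrightarrow> y \<in> hcarrier V \<Longrightarrow> hip V (T x) y = hip V x (S y)"
    using adjoint_ex[OF T] by blast
  have "adj V T = S" unfolding adj_def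
  proof (rule the_equality)
    show "S \<in> bdd_ops V V \<and> (\<forall>x\<in>hcarrier V. \<forall>y\<in>hcarrier V. hip V (T x) y = hip V x (S y))" using S by blast
    fix S' assume S': "S' \<in> bdd_ops V V \<and> (\<forall>x\<in>hcarrier V. \<forall>y\<in>hcarrier V. hip V (T x) y = hip V x (S' y))"
    show "S' = S"
    proof
      fix y show "S' y = S y"
      proof (cases "y \<in> hcarrier V")
        case True
        have m: "S' y \<in> hcarrier V" "S y \<in> hcarrier V"
          using S S' True bdd_opsD(1)[of S' V V y] bdd_opsD(1)[of S V V y] by auto
        then have "hip V (S' y - S y) (S' y) = hip V (S' y - S y) (S y)"
          using S(2)[of "S' y - S y" y] S' True by (metis carrier_diff)
        then have "hip V (S' y - S y) (S' y - S y) = 0" using m by (simp add: ip_diff_right)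
        then show ?thesis using m ip_self_eq_0_iff[of "S' y - S y"] by simp
      next
        case False
        then show ?thesis using S S' bdd_opsD(4)[of S' V V y] bdd_opsD(4)[of S V V y] by auto
      qed
    qed
  qed
  then show "adj V T \<in> bdd_ops V V"
    and "x \<in> hcarrier V \<Longrightarrow> y \<in> hcarrier V \<Longrightarrow> hip V (T x) y = hip V x (adj V T y)"
    using S by simp_all
qed

text \<open>A geometric majorant makes the partial sums Cauchy at a rate proportional to
  \<open>hnorm V x\<close>. The pointwise limit is therefore bounded and is approached in operator
  norm.\<close>

lemma norm_series_converges:
  assumes P: "\<And>k. P k \<in> bdd_ops V V"
    and bound: "\<And>k x. x \<in> hcarrier V \<Longrightarrow> hnorm V (P k x) \<le> c * \<rho> ^ k * hnorm V x"
    and \<rho>: "0 \<le> \<rho>" "\<rho> < 1" and c: "0 \<le> c"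
  shows "\<exists>L. norm_tendsto V (\<lambda>m x. \<Sum>k<m. P k x) L"
proof -
  define S where "S m x = (\<Sum>k<m. P k x)" for m x
  define C where "C = c / (1 - \<rho>)"
  have C: "0 \<le> C" using c \<rho> by (simp add: C_def)
  have Sop: "S m \<in> bdd_ops V V" for m
  proof (induction m)
    case 0
    show ?case by (rule bdd_opsI[where C = 0]) (auto simp: S_def)
  next
    case (Suc m)
    have "S (Suc m) = (\<lambda>x. S m x + P m x)" by (simp add: S_def fun_eq_iff)
    then show ?case using VV.ops_add[OF Suc P] by simp
  qed
  note SC = bdd_opsD(1)[OF Sop]
  have tail: "hnorm V (S (m + j) x - S m x) \<le> C * \<rho> ^ m * hnorm V x" if x: "x \<in> hcarrier V" for m j x
  proof -
    have "S (m + j) x - S m x = (\<Sum>k<j. P (m + k) x)"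
      by (induction j) (simp_all add: S_def)
    also have "hnorm V \<dots> \<le> (\<Sum>k<j. hnorm V (P (m + k) x))"
      using bdd_opsD(1)[OF P x] by (intro hnorm_sum_le) auto
    also have "\<dots> \<le> (\<Sum>k<j. c * \<rho> ^ m * hnorm V x * \<rho> ^ k)"
    proof (rule sum_mono)
      fix k
      show "hnorm V (P (m + k) x) \<le> c * \<rho> ^ m * hnorm V x * \<rho> ^ k"
        using bound[OF x, of "m + k"] by (simp add: power_add mult_ac)
    qed
    also have "\<dots> = c * \<rho> ^ m * hnorm V x * ((1 - \<rho> ^ j) / (1 - \<rho>))"
      using \<rho> by (simp add: sum_distrib_left[symmetric] sum_gp_strict)
    also have "\<dots> \<le> c * \<rho> ^ m * hnorm V x * (1 / (1 - \<rho>))"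
      using \<rho> c x by (intro mult_left_mono divide_right_mono) auto
    finally show ?thesis by (simp add: C_def)
  qed
  have \<rho>_lim: "(\<lambda>m. C * \<rho> ^ m * t) \<longlonglongrightarrow> 0" for t
    using tendsto_mult_left[OF LIMSEQ_power_zero[of \<rho>], of "C * t"] \<rho> by (simp add: mult_ac)
  have "\<exists>l. l \<in> hcarrier V \<and> (\<lambda>m. hnorm V (S m x - l)) \<longlonglongrightarrow> 0" if x: "x \<in> hcarrier V" for x
  proof -
    have "\<exists>l\<in>hcarrier V. (\<lambda>m. hnorm V (S m x - l)) \<longlonglongrightarrow> 0"
    proof (rule complete[OF SC[OF x]])
      fix e :: real assume "0 < e"
      then obtain M where M: "C * \<rho> ^ M * hnorm V x < e / 2"
        using order_tendstoD(2)[OF \<rho>_lim[of "hnorm V x"], of "e / 2"] by (auto simp: eventually_sequentially)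
      have near: "hnorm V (S j x - S M x) < e / 2" if "M \<le> j" for j
        using tail[OF x, of M "j - M"] that M by simp
      show "\<exists>M. \<forall>j\<ge>M. \<forall>k\<ge>M. hnorm V (S j x - S k x) < e"
      proof (intro exI allI impI)
        fix j k assume "M \<le> j" "M \<le> k"
        then show "hnorm V (S j x - S k x) < e"
          using near[of j] near[of k] hnorm_triangle_via[of "S j x" "S M x" "S k x"]
            hnorm_minus_commute[of "S M x" "S k x"] SC[OF x] by simp
      qed
    qed
    then show ?thesis by blast
  qed
  then obtain L0 where L0: "\<And>x. x \<in> hcarrier V \<Longrightarrow> L0 x \<in> hcarrier V"
    "\<And>x. x \<in> hcarrier V \<Longrightarrow> (\<lambda>m. hnorm V (S m x - L0 x)) \<longlonglongrightarrow> 0"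
    by metis
  define L where "L = on_carrier V L0"
  have LC: "L x \<in> hcarrier V" and Llim: "(\<lambda>m. hnorm V (S m x - L x)) \<longlonglongrightarrow> 0" if "x \<in> hcarrier V" for x
    using L0 that by (auto simp: L_def on_carrier_def)
  \<comment> \<open>Letting \<open>j\<close> grow in \<open>tail\<close> keeps the same geometric
    constant, uniformly in \<open>x\<close>; this is the step from pointwise to norm
    convergence.\<close>
  have Lbound: "hnorm V (S m x - L x) \<le> C * \<rho> ^ m * hnorm V x" if x: "x \<in> hcarrier V" for m x
  proof -
    have "(\<lambda>j. hnorm V (S (j + m) x - S m x - (L x - S m x))) \<longlonglongrightarrow> 0"
      using LIMSEQ_ignore_initial_segment[OF Llim[OF x], of m] by simp
    from hnorm_tendsto[OF _ _ this] have lim: "(\<lambda>j. hnorm V (S (j + m) x - S m x)) \<longlonglongrightarrow> hnorm V (L x - S m x)"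
      using SC[OF x] LC[OF x] by simp
    have "hnorm V (S (j + m) x - S m x) \<le> C * \<rho> ^ m * hnorm V x" for j
      using tail[OF x, of m j] by (simp add: add.commute)
    from LIMSEQ_le_const2[OF lim] this have "hnorm V (L x - S m x) \<le> C * \<rho> ^ m * hnorm V x" by blast
    then show ?thesis using hnorm_minus_commute[OF SC[OF x] LC[OF x]] by simp
  qed
  have Lop: "L \<in> bdd_ops V V"
  proof (rule bdd_opsI[where C = C])
    fix x y assume xy: "x \<in> hcarrier V" "y \<in> hcarrier V"
    have "(\<lambda>m. hnorm V (S m (x + y) - (L x + L y))) \<longlonglongrightarrow> 0"
      using hlim_add[OF SC[OF xy(1)] SC[OF xy(2)] LC[OF xy(1)] LC[OF xy(2)] Llim[OF xy(1)] Llim[OF xy(2)]] xy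
      by (simp add: bdd_opsD(2)[OF Sop])
    then show "L (x + y) = L x + L y"
      by (rule hlim_unique[rotated 4]) (use xy SC LC Llim[of "x + y"] in auto)
  next
    fix d x assume x: "x \<in> hcarrier V"
    have "(\<lambda>m. hnorm V (S m (hscale V d x) - hscale V d (L x))) \<longlonglongrightarrow> 0"
      using hlim_scale[OF SC[OF x] LC[OF x] Llim[OF x]] x by (simp add: bdd_opsD(3)[OF Sop])
    then show "L (hscale V d x) = hscale V d (L x)"
      by (rule hlim_unique[rotated 4]) (use x SC LC Llim[of "hscale V d x"] in auto)
  next
    fix x assume x: "x \<in> hcarrier V"
    show "hnorm V (L x) \<le> C * hnorm V x"
      using Lbound[OF x, of 0] LC[OF x] by (simp add: S_def)
  qed (use LC in \<open>auto simp: L_def on_carrier_def\<close>)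
  have "(\<lambda>m. op_norm V V (S m - L)) \<longlonglongrightarrow> 0"
  proof (rule Lim_null_comparison)
    show "(\<lambda>m. C * \<rho> ^ m) \<longlonglongrightarrow> 0" using \<rho>_lim[of 1] by simp
    have "op_norm V V (S m - L) \<le> C * \<rho> ^ m" for m
      using Lbound C \<rho> by (intro VV.op_norm_le) auto
    then show "\<forall>\<^sub>F m in sequentially. norm (op_norm V V (S m - L)) \<le> C * \<rho> ^ m"
      using VV.op_norm_nonneg[OF VV.ops_minus[OF Sop Lop]] by simp
  qed
  then have "norm_tendsto V S L" using Lop by (simp add: norm_tendsto_def)
  then show ?thesis unfolding S_def by blast
qed

lemma word_op_bdd: "(\<And>i. Y i \<in> bdd_ops V V) \<Longrightarrow> word_op V Y \<alpha> \<in> bdd_ops V V"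
  using sot_alg_bdd_ops[of Y] word_op_sot_alg[of Y Y] sot_alg.var[of Y _ V] by blast

lemma word_op_append:
  assumes "\<And>i. Y i \<in> bdd_ops V V" "x \<in> hcarrier V"
  shows "word_op V Y (\<alpha> @ \<beta>) x = word_op V Y \<alpha> (word_op V Y \<beta> x)"
proof (induction \<alpha>)
  case Nil
  then show ?case using bdd_opsD(1)[OF word_op_bdd[of Y] assms(2)] assms(1) by (simp add: on_carrier_def)
qed simp

text \<open>The adjoint of \<open>word_op V Y \<alpha>\<close>, with the factors in reversed order:
  the adjoint of the first letter acts first.\<close>

primrec word_adj :: "('m \<Rightarrow> 'a \<Rightarrow> 'a) \<Rightarrow> 'm list \<Rightarrow> 'a \<Rightarrow> 'a" where
  "word_adj Y [] y = y"
| "word_adj Y (i # \<alpha>) y = word_adj Y \<alpha> (adj V (Y i) y)"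

lemma word_adj:
  assumes Y: "\<And>i. Y i \<in> bdd_ops V V"
  shows "y \<in> hcarrier V \<Longrightarrow> word_adj Y \<alpha> y \<in> hcarrier V \<and>
    (\<forall>x\<in>hcarrier V. hip V (word_op V Y \<alpha> x) y = hip V x (word_adj Y \<alpha> y))"
proof (induction \<alpha> arbitrary: y)
  case (Cons i \<alpha>)
  note ay = bdd_opsD(1)[OF adj(1)[OF Y] Cons.prems, of i]
  have "hip V (word_op V Y (i # \<alpha>) x) y = hip V x (word_adj Y (i # \<alpha>) y)" if x: "x \<in> hcarrier V" for x
    using adj(2)[OF Y bdd_opsD(1)[OF word_op_bdd[of Y, OF Y] x] Cons.prems] Cons.IH[OF ay] x by simp
  then show ?case using Cons.IH[OF ay] by simp
qed (simp add: on_carrier_def)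

lemma row_sum_op:
  fixes Y :: "'m::finite \<Rightarrow> 'a \<Rightarrow> 'a"
  assumes Y: "\<And>i. Y i \<in> bdd_ops V V"
  shows "(\<Sum>i\<in>UNIV. Y i \<circ> adj V (Y i)) \<in> bdd_ops V V"
proof -
  have comp: "Y i \<circ> adj V (Y i) \<in> bdd_ops V V" for i
    using ops_comp[OF hilbert_space_axioms hilbert_space_axioms hilbert_space_axioms Y adj(1)[OF Y]] .
  have "(\<Sum>i\<in>I. Y i \<circ> adj V (Y i)) \<in> bdd_ops V V" for I :: "'m set"
  proof -
    have "finite I" by simp
    then show ?thesis
    proof (induction I rule: finite_induct)
      case empty
      show "(\<Sum>i\<in>{}. Y i \<circ> adj V (Y i)) \<in> bdd_ops V V"
        by (rule bdd_opsI[where C = 0]) auto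
    next
      case (insert i I)
      have "(\<Sum>i\<in>insert i I. Y i \<circ> adj V (Y i)) = (\<lambda>x. (Y i \<circ> adj V (Y i)) x + (\<Sum>i\<in>I. Y i \<circ> adj V (Y i)) x)"
        using insert.hyps by (simp add: fun_eq_iff)
      then show "(\<Sum>i\<in>insert i I. Y i \<circ> adj V (Y i)) \<in> bdd_ops V V"
        using VV.ops_add[OF comp[of i] insert.IH] by (simp only:)
    qed
  qed
  then show ?thesis .
qed

lemma row_norm_nonneg:
  fixes Y :: "'m::finite \<Rightarrow> 'a \<Rightarrow> 'a"
  shows "(\<And>i. Y i \<in> bdd_ops V V) \<Longrightarrow> 0 \<le> row_norm V Y"
  using VV.op_norm_nonneg[OF row_sum_op[of Y]] by (simp add: row_norm_def)

text \<open>Row contractivity of Y is column contractivity of its adjoints, which is inherited by all the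
  words of a given length.\<close>

lemma word_adj_bound:
  fixes Y :: "'m::finite \<Rightarrow> 'a \<Rightarrow> 'a"
  assumes Y: "\<And>i. Y i \<in> bdd_ops V V" and y: "y \<in> hcarrier V"
  shows "(\<Sum>\<alpha> | length \<alpha> = k. (hnorm V (word_adj Y \<alpha> y))\<^sup>2) \<le> (row_norm V Y ^ k * hnorm V y)\<^sup>2"
  using y
proof (induction k arbitrary: y)
  case 0
  then show ?case by simp
next
  case (Suc k)
  define R where "R = (\<Sum>i\<in>UNIV. Y i \<circ> adj V (Y i))"
  have Rop: "R \<in> bdd_ops V V" unfolding R_def by (rule row_sum_op[of Y, OF Y])
  have rn: "(row_norm V Y)\<^sup>2 = op_norm V V R" "0 \<le> row_norm V Y"
    using VV.op_norm_nonneg[OF Rop] row_norm_nonneg[of Y, OF Y] by (simp_all add: row_norm_def R_def)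
  have ay: "adj V (Y i) y \<in> hcarrier V" for i using bdd_opsD(1)[OF adj(1)[OF Y] Suc.prems] .
  \<comment> \<open>The sum of squared adjoint norms is the quadratic form of \<open>R\<close>, and
    the norm of \<open>R\<close> is the squared row norm by definition.\<close>
  have "(\<Sum>i\<in>UNIV. (hnorm V (adj V (Y i) y))\<^sup>2) = (\<Sum>i\<in>UNIV. Re (hip V (Y i (adj V (Y i) y)) y))"
    using ay Suc.prems by (simp add: hnorm_sq adj(2)[OF Y])
  also have "\<dots> = Re (hip V (R y) y)"
    using bdd_opsD(1)[OF Y ay] Suc.prems by (simp add: R_def sum_fun_apply ip_sum)
  also have "\<dots> \<le> cmod (hip V (R y) y)" by (rule complex_Re_le_cmod)
  also have "\<dots> \<le> hnorm V (R y) * hnorm V y" using Cauchy_Schwarz[OF bdd_opsD(1)[OF Rop]] Suc.prems by blast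
  also have "\<dots> \<le> ((row_norm V Y)\<^sup>2 * hnorm V y) * hnorm V y"
    using VV.op_norm_bound[OF Rop Suc.prems] Suc.prems rn by (intro mult_right_mono) auto
  finally have col: "(\<Sum>i\<in>UNIV. (hnorm V (adj V (Y i) y))\<^sup>2) \<le> (row_norm V Y)\<^sup>2 * (hnorm V y)\<^sup>2"
    by (simp add: power2_eq_square mult_ac)
  have "(\<Sum>\<alpha> | length \<alpha> = Suc k. (hnorm V (word_adj Y \<alpha> y))\<^sup>2)
      = (\<Sum>i\<in>UNIV. \<Sum>\<alpha> | length \<alpha> = k. (hnorm V (word_adj Y \<alpha> (adj V (Y i) y)))\<^sup>2)"
    by (simp add: sum_words_Suc)
  also have "\<dots> \<le> (\<Sum>i\<in>UNIV. (row_norm V Y ^ k * hnorm V (adj V (Y i) y))\<^sup>2)"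
    by (intro sum_mono Suc.IH ay)
  also have "\<dots> = (row_norm V Y ^ k)\<^sup>2 * (\<Sum>i\<in>UNIV. (hnorm V (adj V (Y i) y))\<^sup>2)"
    by (simp add: power_mult_distrib sum_distrib_left)
  also have "\<dots> \<le> (row_norm V Y ^ k)\<^sup>2 * ((row_norm V Y)\<^sup>2 * (hnorm V y)\<^sup>2)"
    using col by (rule mult_left_mono) simp
  also have "\<dots> = (row_norm V Y ^ Suc k * hnorm V y)\<^sup>2" by (simp add: power_mult_distrib)
  finally show ?case .
qed

text \<open>Moving words to the other side of an inner product allows Cauchy-Schwarz over all words
  of length \<open>k\<close> at once. With \<open>word_adj_bound\<close> the homogeneous part of
  degree \<open>k\<close> has norm at most \<open>c\<close> times the \<open>k\<close>-th power of
  the row norm, a convergent geometric series.\<close>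

lemma H2_ball_converges:
  fixes Y :: "'m::finite \<Rightarrow> 'a \<Rightarrow> 'a"
  assumes a: "a \<in> H2_ball" and Y: "Y \<in> op_ball V 1"
  shows "norm_tendsto V (nc_psum V a Y) (nc_eval V a Y)"
proof -
  have Yop: "\<And>i. Y i \<in> bdd_ops V V" and \<rho>1: "row_norm V Y < 1" using Y by (auto simp: op_ball_def)
  define c where "c = sqrt (infsum (\<lambda>\<alpha>. (cmod (a \<alpha>))\<^sup>2) UNIV)"
  define P where "P k x = (\<Sum>\<alpha> | length \<alpha> = k. hscale V (a \<alpha>) (word_op V Y \<alpha> x))" for k x
  have c: "0 \<le> c" by (simp add: c_def infsum_nonneg)
  note \<rho>0 = row_norm_nonneg[of Y, OF Yop]
  have ps: "nc_psum V a Y = (\<lambda>m x. \<Sum>k<m. P k x)" by (simp add: fun_eq_iff nc_psum_def P_def)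
  have "P k \<in> sot_alg V Y" for k
    unfolding P_def by (intro sot_alg_sum sot_alg.scale word_op_sot_alg sot_alg.var)
  then have Pop: "P k \<in> bdd_ops V V" for k using sot_alg_bdd_ops[of Y] Yop by blast
  have Pb: "hnorm V (P k x) \<le> c * row_norm V Y ^ k * hnorm V x" if x: "x \<in> hcarrier V" for k x
  proof (cases "P k x = 0")
    case True
    then show ?thesis using c \<rho>0 x by (simp add: mult_nonneg_nonneg)
  next
    case False
    \<comment> \<open>Pairing \<open>P k x\<close> with itself turns the bound on inner products
      into one for its norm, after division by \<open>hnorm V y\<close>.\<close>
    define y where "y = P k x"
    have y: "y \<in> hcarrier V" using bdd_opsD(1)[OF Pop x] by (simp add: y_def)
    have ny: "0 < hnorm V y" using hnorm_pos[OF y] False by (simp add: y_def)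
    note wC = bdd_opsD(1)[OF word_op_bdd[of Y, OF Yop] x] and wa = word_adj[of Y, OF Yop y]
    have "hip V (P k x) y = (\<Sum>\<alpha> | length \<alpha> = k. a \<alpha> * hip V x (word_adj Y \<alpha> y))"
      unfolding P_def using wC y wa x by (subst ip_sum) (auto simp: ip_scale)
    then have "cmod (hip V (P k x) y) \<le> (\<Sum>\<alpha> | length \<alpha> = k. cmod (a \<alpha> * hip V x (word_adj Y \<alpha> y)))"
      by (simp add: norm_sum)
    also have "\<dots> \<le> (\<Sum>\<alpha> | length \<alpha> = k. hnorm V x * (\<bar>cmod (a \<alpha>)\<bar> * \<bar>hnorm V (word_adj Y \<alpha> y)\<bar>))"
    proof (rule sum_mono)
      fix \<alpha>
      have "cmod (hip V x (word_adj Y \<alpha> y)) \<le> hnorm V x * hnorm V (word_adj Y \<alpha> y)"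
        using Cauchy_Schwarz x wa by blast
      then have "cmod (a \<alpha>) * cmod (hip V x (word_adj Y \<alpha> y)) \<le> cmod (a \<alpha>) * (hnorm V x * hnorm V (word_adj Y \<alpha> y))"
        by (rule mult_left_mono) simp
      then show "cmod (a \<alpha> * hip V x (word_adj Y \<alpha> y)) \<le> hnorm V x * (\<bar>cmod (a \<alpha>)\<bar> * \<bar>hnorm V (word_adj Y \<alpha> y)\<bar>)"
        using wa[of \<alpha>] by (simp add: norm_mult mult_ac)
    qed
    also have "\<dots> = hnorm V x * (\<Sum>\<alpha> | length \<alpha> = k. \<bar>cmod (a \<alpha>)\<bar> * \<bar>hnorm V (word_adj Y \<alpha> y)\<bar>)"
      by (simp add: sum_distrib_left)
    also have "\<dots> \<le> hnorm V x * (L2_set (\<lambda>\<alpha>. cmod (a \<alpha>)) {\<alpha>. length \<alpha> = k} *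
        L2_set (\<lambda>\<alpha>. hnorm V (word_adj Y \<alpha> y)) {\<alpha>. length \<alpha> = k})"
      using x by (intro mult_left_mono L2_set_mult_ineq) auto
    also have "\<dots> \<le> hnorm V x * (c * (row_norm V Y ^ k * hnorm V y))"
    proof (intro mult_left_mono mult_mono)
      show "L2_set (\<lambda>\<alpha>. cmod (a \<alpha>)) {\<alpha>. length \<alpha> = k} \<le> c"
        unfolding L2_set_def c_def using a
        by (intro real_sqrt_le_mono finite_sum_le_infsum) (auto simp: H2_ball_def finite_words)
      show "L2_set (\<lambda>\<alpha>. hnorm V (word_adj Y \<alpha> y)) {\<alpha>. length \<alpha> = k} \<le> row_norm V Y ^ k * hnorm V y"
        unfolding L2_set_def using word_adj_bound[of Y, OF Yop y, of k] \<rho>0 y by (intro real_le_lsqrt) auto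
    qed (use c x in auto)
    finally have "cmod (hip V (P k x) y) \<le> (c * row_norm V Y ^ k * hnorm V x) * hnorm V y"
      by (simp add: mult_ac)
    moreover have "hnorm V y * hnorm V y = cmod (hip V (P k x) y)"
      using ip_self[OF y] by (simp add: y_def[symmetric] power2_eq_square norm_mult)
    ultimately have "hnorm V y * hnorm V y \<le> (c * row_norm V Y ^ k * hnorm V x) * hnorm V y" by simp
    then have "hnorm V y \<le> c * row_norm V Y ^ k * hnorm V x" using ny by (rule mult_right_le_imp_le)
    then show ?thesis by (simp add: y_def)
  qed
  from norm_series_converges[OF Pop Pb \<rho>0 \<rho>1 c] obtain L where L: "norm_tendsto V (nc_psum V a Y) L"
    unfolding ps by blast
  then show ?thesis using norm_limit_sot_alg(1)[OF Yop sot_alg.var L] by simp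
qed

lemma H2_ball_eval_op: "a \<in> H2_ball \<Longrightarrow> Y \<in> op_ball V 1 \<Longrightarrow> nc_eval V a (Y :: 'm::finite \<Rightarrow> _) \<in> bdd_ops V V"
  using H2_ball_converges by (auto simp: norm_tendsto_def)

lemma nc_psum_op: "(\<And>i. Y i \<in> bdd_ops V V) \<Longrightarrow> nc_psum V a Y m \<in> bdd_ops V V"
  using sot_alg_bdd_ops[of Y] nc_psum_sot_alg[of Y Y, OF sot_alg.var] by blast

lemma H2_ball_eval_lim:
  fixes Y :: "'m::finite \<Rightarrow> 'a \<Rightarrow> 'a"
  assumes a: "a \<in> H2_ball" and Y: "Y \<in> op_ball V 1" and x: "x \<in> hcarrier V"
  shows "(\<lambda>m. hnorm V (nc_psum V a Y m x - nc_eval V a Y x)) \<longlonglongrightarrow> 0"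
  using sot_tendsto_if_norm_tendsto[OF nc_psum_op[of Y] H2_ball_converges[OF a Y]] Y x
  by (auto simp: op_ball_def sot_tendsto_def)

text \<open>Norm convergence to \<open>nc_eval\<close> is already known, so a candidate is
  identified by pointwise limits, without proving it linear or bounded.\<close>

lemma nc_eval_eqI:
  fixes Y :: "'m::finite \<Rightarrow> 'a \<Rightarrow> 'a"
  assumes a: "a \<in> H2_ball" and Y: "Y \<in> op_ball V 1" and L: "\<And>x. x \<in> hcarrier V \<Longrightarrow> L x \<in> hcarrier V"
    and off: "\<And>x. x \<notin> hcarrier V \<Longrightarrow> L x = 0"
    and lim: "\<And>x. x \<in> hcarrier V \<Longrightarrow> (\<lambda>m. hnorm V (nc_psum V a Y m x - L x)) \<longlonglongrightarrow> 0"
  shows "nc_eval V a Y = L"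
proof
  fix x show "nc_eval V a Y x = L x"
  proof (cases "x \<in> hcarrier V")
    case True
    have Yop: "\<And>i. Y i \<in> bdd_ops V V" using Y by (simp add: op_ball_def)
    show ?thesis
      by (rule hlim_unique[OF _ _ _ H2_ball_eval_lim[OF a Y True] lim[OF True]])
        (use bdd_opsD(1)[OF nc_psum_op[of Y, OF Yop] True] bdd_opsD(1)[OF H2_ball_eval_op[OF a Y] True] L[OF True] in auto)
  qed (use off bdd_opsD(4)[OF H2_ball_eval_op[OF a Y]] in simp)
qed

section \<open>Algebraic rules for evaluation on the unit row ball\<close>

lemma nc_psum_add: "nc_psum V (a + b) Y m x = nc_psum V a Y m x + nc_psum V b Y m x"
  by (simp add: nc_psum_def scale_left_distrib sum.distrib)

lemma nc_psum_scale: "nc_psum V (nc_scale c a) Y m x = hscale V c (nc_psum V a Y m x)"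
  by (simp add: nc_psum_def nc_scale_apply scale_sum_right)

text \<open>Only words ending in \<open>\<beta>\<close> carry coefficients, and cutting off this
  suffix lowers the degree by \<open>length \<beta>\<close>, hence the shifted index of the partial
  sum.\<close>

lemma nc_psum_mult_word:
  fixes Y :: "'m::finite \<Rightarrow> 'a \<Rightarrow> 'a"
  assumes Y: "\<And>i. Y i \<in> bdd_ops V V" and x: "x \<in> hcarrier V"
  shows "nc_psum V (nc_mult a (nc_word nc_var \<beta>)) Y (m + length \<beta>) x = nc_psum V a Y m (word_op V Y \<beta> x)"
proof (induction m)
  case 0
  have "hscale V (nc_mult a (nc_word nc_var \<beta>) \<gamma>) (word_op V Y \<gamma> x) = 0" if "length \<gamma> < length \<beta>" for \<gamma>
  proof -
    have "\<nexists>\<alpha>. \<gamma> = \<alpha> @ \<beta>" using that by auto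
    then show ?thesis by (simp add: nc_mult_word_zero)
  qed
  then show ?case unfolding nc_psum_def by (auto intro!: sum.neutral)
next
  case (Suc m)
  have "(\<Sum>\<gamma> | length \<gamma> = m + length \<beta>. hscale V (nc_mult a (nc_word nc_var \<beta>) \<gamma>) (word_op V Y \<gamma> x))
      = (\<Sum>\<gamma>\<in>(\<lambda>\<alpha>. \<alpha> @ \<beta>) ` {\<alpha>. length \<alpha> = m}. hscale V (nc_mult a (nc_word nc_var \<beta>) \<gamma>) (word_op V Y \<gamma> x))"
  proof (rule sum.mono_neutral_right[OF finite_words])
    show "\<forall>\<gamma>\<in>{\<gamma>. length \<gamma> = m + length \<beta>} - (\<lambda>\<alpha>. \<alpha> @ \<beta>) ` {\<alpha>. length \<alpha> = m}.
        hscale V (nc_mult a (nc_word nc_var \<beta>) \<gamma>) (word_op V Y \<gamma> x) = 0"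
    proof
      fix \<gamma> assume \<gamma>: "\<gamma> \<in> {\<gamma>. length \<gamma> = m + length \<beta>} - (\<lambda>\<alpha>. \<alpha> @ \<beta>) ` {\<alpha>. length \<alpha> = m}"
      have "\<nexists>\<alpha>. \<gamma> = \<alpha> @ \<beta>" using \<gamma> by auto
      then show "hscale V (nc_mult a (nc_word nc_var \<beta>) \<gamma>) (word_op V Y \<gamma> x) = 0"
        by (simp add: nc_mult_word_zero)
    qed
  qed auto
  also have "\<dots> = (\<Sum>\<alpha> | length \<alpha> = m. hscale V (a \<alpha>) (word_op V Y \<alpha> (word_op V Y \<beta> x)))"
    by (subst sum.reindex) (auto simp: inj_on_def nc_mult_word_append word_op_append[of Y, OF Y x])
  finally show ?case using Suc by (simp add: nc_psum_def)
qed

lemma nc_eval_add: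
  fixes Y :: "'m::finite \<Rightarrow> 'a \<Rightarrow> 'a"
  assumes a: "a \<in> H2_ball" and b: "b \<in> H2_ball" and Y: "Y \<in> op_ball V 1"
  shows "nc_eval V (a + b) Y = nc_eval V a Y + nc_eval V b Y"
proof (rule nc_eval_eqI[OF H2_ball_add[OF a b] Y])
  have Yop: "\<And>i. Y i \<in> bdd_ops V V" using Y by (simp add: op_ball_def)
  note ea = H2_ball_eval_op[OF a Y] and eb = H2_ball_eval_op[OF b Y]
  show "(nc_eval V a Y + nc_eval V b Y) x \<in> hcarrier V" if "x \<in> hcarrier V" for x
    using bdd_opsD(1)[OF ea that] bdd_opsD(1)[OF eb that] by simp
  show "(nc_eval V a Y + nc_eval V b Y) x = 0" if "x \<notin> hcarrier V" for x
    using bdd_opsD(4)[OF ea that] bdd_opsD(4)[OF eb that] by simp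
  show "(\<lambda>m. hnorm V (nc_psum V (a + b) Y m x - (nc_eval V a Y + nc_eval V b Y) x)) \<longlonglongrightarrow> 0"
    if x: "x \<in> hcarrier V" for x
    unfolding nc_psum_add plus_fun_apply
    by (intro hlim_add bdd_opsD(1)[OF nc_psum_op[of Y, OF Yop] x] bdd_opsD(1)[OF ea x] bdd_opsD(1)[OF eb x]
        H2_ball_eval_lim a b Y x)
qed

lemma nc_eval_scale:
  fixes Y :: "'m::finite \<Rightarrow> 'a \<Rightarrow> 'a"
  assumes a: "a \<in> H2_ball" and Y: "Y \<in> op_ball V 1"
  shows "nc_eval V (nc_scale c a) Y = (\<lambda>x. hscale V c (nc_eval V a Y x))"
proof (rule nc_eval_eqI[OF H2_ball_scale[OF a] Y])
  have Yop: "\<And>i. Y i \<in> bdd_ops V V" using Y by (simp add: op_ball_def)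
  note ea = H2_ball_eval_op[OF a Y]
  show "hscale V c (nc_eval V a Y x) \<in> hcarrier V" if "x \<in> hcarrier V" for x
    using bdd_opsD(1)[OF ea that] by simp
  show "hscale V c (nc_eval V a Y x) = 0" if "x \<notin> hcarrier V" for x
    using bdd_opsD(4)[OF ea that] by simp
  show "(\<lambda>m. hnorm V (nc_psum V (nc_scale c a) Y m x - hscale V c (nc_eval V a Y x))) \<longlonglongrightarrow> 0"
    if x: "x \<in> hcarrier V" for x
    unfolding nc_psum_scale
    by (intro hlim_scale bdd_opsD(1)[OF nc_psum_op[of Y, OF Yop] x] bdd_opsD(1)[OF ea x] H2_ball_eval_lim a Y x)
qed

lemma nc_eval_mult_word:
  fixes Y :: "'m::finite \<Rightarrow> 'a \<Rightarrow> 'a"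
  assumes a: "a \<in> H2_ball" and Y: "Y \<in> op_ball V 1"
  shows "nc_eval V (nc_mult a (nc_word nc_var \<beta>)) Y = nc_eval V a Y \<circ> word_op V Y \<beta>"
proof (rule nc_eval_eqI[OF H2_ball_mult_word[OF a] Y])
  have Yop: "\<And>i. Y i \<in> bdd_ops V V" using Y by (simp add: op_ball_def)
  have ea: "nc_eval V a Y \<circ> word_op V Y \<beta> \<in> bdd_ops V V"
    using ops_comp[OF hilbert_space_axioms hilbert_space_axioms hilbert_space_axioms
        H2_ball_eval_op[OF a Y] word_op_bdd[of Y, OF Yop]] .
  show "(nc_eval V a Y \<circ> word_op V Y \<beta>) x \<in> hcarrier V" if "x \<in> hcarrier V" for x
    using bdd_opsD(1)[OF ea that] .
  show "(nc_eval V a Y \<circ> word_op V Y \<beta>) x = 0" if "x \<notin> hcarrier V" for x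
    using bdd_opsD(4)[OF ea that] .
  show "(\<lambda>m. hnorm V (nc_psum V (nc_mult a (nc_word nc_var \<beta>)) Y m x - (nc_eval V a Y \<circ> word_op V Y \<beta>) x)) \<longlonglongrightarrow> 0"
    if x: "x \<in> hcarrier V" for x
  proof (rule LIMSEQ_offset)
    show "(\<lambda>m. hnorm V (nc_psum V (nc_mult a (nc_word nc_var \<beta>)) Y (m + length \<beta>) x -
        (nc_eval V a Y \<circ> word_op V Y \<beta>) x)) \<longlonglongrightarrow> 0"
      using H2_ball_eval_lim[OF a Y bdd_opsD(1)[OF word_op_bdd[of Y \<beta>, OF Yop] x]]
      by (simp add: nc_psum_mult_word[of Y, OF Yop x])
  qed
qed

lemma nc_eval_word:
  fixes Y :: "'m::finite \<Rightarrow> 'a \<Rightarrow> 'a"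
  assumes Y: "Y \<in> op_ball V 1"
  shows "nc_eval V (nc_word nc_var \<beta>) Y = word_op V Y \<beta>"
proof (rule nc_eval_eqI[OF H2_ball_word Y])
  have Yop: "\<And>i. Y i \<in> bdd_ops V V" using Y by (simp add: op_ball_def)
  note wb = word_op_bdd[of Y, OF Yop]
  show "word_op V Y \<beta> x \<in> hcarrier V" if "x \<in> hcarrier V" for x using bdd_opsD(1)[OF wb that] .
  show "word_op V Y \<beta> x = 0" if "x \<notin> hcarrier V" for x using bdd_opsD(4)[OF wb that] .
  fix x assume x: "x \<in> hcarrier V"
  \<comment> \<open>The index bound in \<open>nc_psum\<close> is strict, so degree
    \<open>length \<beta>\<close> is included from \<open>Suc (length \<beta>)\<close> on, and the
    partial sums are constant from there.\<close>
  have "nc_psum V (nc_word nc_var \<beta>) Y (m + Suc (length \<beta>)) x = word_op V Y \<beta> x" for m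
  proof -
    have "nc_psum V (nc_word nc_var \<beta>) Y (m + Suc (length \<beta>)) x
        = (\<Sum>k<m + Suc (length \<beta>). if k = length \<beta> then word_op V Y \<beta> x else 0)"
      unfolding nc_psum_def
    proof (rule sum.cong)
      fix k
      have "(\<Sum>\<alpha> | length \<alpha> = k. hscale V (nc_word nc_var \<beta> \<alpha>) (word_op V Y \<alpha> x))
          = (\<Sum>\<alpha> | length \<alpha> = k. if \<alpha> = \<beta> then word_op V Y \<beta> x else 0)"
        by (rule sum.cong) (auto simp: nc_word_var)
      then show "(\<Sum>\<alpha> | length \<alpha> = k. hscale V (nc_word nc_var \<beta> \<alpha>) (word_op V Y \<alpha> x))
          = (if k = length \<beta> then word_op V Y \<beta> x else 0)"
        by (simp add: sum.delta finite_words)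
    qed simp
    then show ?thesis by (simp add: sum.delta)
  qed
  then have "(\<lambda>m. hnorm V (nc_psum V (nc_word nc_var \<beta>) Y (m + Suc (length \<beta>)) x - word_op V Y \<beta> x)) \<longlonglongrightarrow> 0"
    by (simp del: add_Suc_right)
  then show "(\<lambda>m. hnorm V (nc_psum V (nc_word nc_var \<beta>) Y m x - word_op V Y \<beta> x)) \<longlonglongrightarrow> 0"
    by (rule LIMSEQ_offset)
qed

end

text \<open>Nondegeneracy applied to a difference of square-summable series makes composition with
  \<open>f\<close> injective, so coefficients are well defined. The range condition on
  \<open>f\<close> keeps all evaluations inside the unit row ball.\<close>

theorem model_F_creation_model:
  fixes f :: "'n::finite \<Rightarrow> 'n ncseries" and B :: "('b::ab_group_add) hilb" and K :: "('k::ab_group_add) hilb"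
  assumes B: "hilbert_space B" and F: "model_F B \<gamma> f"
    and uni: "unitarily_equiv (H2_F B \<gamma> f) (MZ_F B \<gamma> f) K MZ"
  shows "\<exists>e S. creation_model K MZ e S"
proof -
  interpret B: hilbert_space B by (rule B)
  let ?\<Phi> = "comp_map B \<gamma> f" and ?V = "H2_F B \<gamma> f"
  have range: "\<And>X. X \<in> op_ball B \<gamma> \<Longrightarrow> (\<lambda>j. nc_eval B (f j) X) \<in> op_ball B 1"
    and nonzero: "\<And>G. free_holomorphic 1 G \<Longrightarrow> G \<noteq> 0 \<Longrightarrow> ?\<Phi> G \<noteq> 0"
    and vars: "\<And>i. eval_map B \<gamma> (nc_var i) \<in> hcarrier ?V"
    and X: "\<And>i. MZ_F B \<gamma> f i \<in> bdd_ops ?V ?V"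
    and calc: "calculus_condition ?V f (MZ_F B \<gamma> f) (Mf_F B \<gamma> f)"
    using F by (auto simp: model_F_def)
  have car: "hcarrier ?V = ?\<Phi> ` H2_ball" by (simp add: H2_F_def)
  have \<Phi>_add: "?\<Phi> (a + b) = ?\<Phi> a + ?\<Phi> b" if "a \<in> H2_ball" "b \<in> H2_ball" for a b
    using B.nc_eval_add[OF that range] by (auto simp: comp_map_def fun_eq_iff)
  have \<Phi>_scale: "?\<Phi> (nc_scale c a) = hscale ?V c (?\<Phi> a)" if "a \<in> H2_ball" for c a
    using B.nc_eval_scale[OF that range] by (auto simp: comp_map_def fun_eq_iff H2_F_def)
  have inj: "a = b" if "a \<in> H2_ball" "b \<in> H2_ball" "?\<Phi> a = ?\<Phi> b" for a b
  proof -
    have d: "a - b \<in> H2_ball" using that H2_ball_diff by blast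
    have "?\<Phi> (a - b) + ?\<Phi> b = ?\<Phi> b" using \<Phi>_add[OF d that(2)] that(3) by simp
    then have "?\<Phi> (a - b) = 0" by simp
    then have "a - b = 0" using nonzero[OF H2_ball_free_holomorphic[OF d]] by blast
    then show ?thesis by simp
  qed
  have coeffs: "comp_coeffs B \<gamma> f (?\<Phi> a) = a" if "a \<in> H2_ball" for a
    unfolding comp_coeffs_def using that inj by (intro the_equality) auto
  have "\<exists>a. a \<in> H2_ball \<and> eval_map B \<gamma> (nc_var i) = ?\<Phi> a" for i using vars[of i] unfolding car by blast
  then obtain A where A: "\<And>i. A i \<in> H2_ball" "\<And>i. eval_map B \<gamma> (nc_var i) = ?\<Phi> (A i)" by metis
  have wordC: "?\<Phi> (nc_word nc_var w) \<in> hcarrier ?V" for w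
    unfolding car using H2_ball_word by blast
  show ?thesis
  proof (rule parametrized_creation_model[where V = ?V and \<Phi> = ?\<Phi> and f = f
        and X = "MZ_F B \<gamma> f" and M = "Mf_F B \<gamma> f" and A = A and MZ = MZ])
    show "vector_space (hscale ?V)"
      by unfold_locales (auto simp: H2_F_def fun_eq_iff B.scale_right_distrib B.scale_left_distrib)
    show "hip ?V (?\<Phi> a) (?\<Phi> b) = H2_ball_ip a b" if "a \<in> H2_ball" "b \<in> H2_ball" for a b
      using coeffs that by (simp add: H2_F_def)
    show "Mf_F B \<gamma> f j (?\<Phi> (nc_word nc_var w)) = ?\<Phi> (nc_word nc_var (j # w))" for j w
    proof
      fix X
      \<comment> \<open>At a point of the ball a monomial in the values of \<open>f\<close> is a
        \<open>word_op\<close>, and one more left factor is one more letter; off the ball both sides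
        are 0.\<close>
      show "Mf_F B \<gamma> f j (?\<Phi> (nc_word nc_var w)) X = ?\<Phi> (nc_word nc_var (j # w)) X"
        using wordC[of w] B.nc_eval_word[OF range, of X]
        by (simp add: Mf_F_def left_mult_def on_carrier_def eval_map_def comp_map_def fun_eq_iff del: nc_word.simps)
    qed
    show "MZ_F B \<gamma> f i (?\<Phi> (nc_word nc_var w)) = ?\<Phi> (nc_mult (A i) (nc_word nc_var w))" for i w
    proof
      fix X
      show "MZ_F B \<gamma> f i (?\<Phi> (nc_word nc_var w)) X = ?\<Phi> (nc_mult (A i) (nc_word nc_var w)) X"
        using wordC[of w] B.nc_eval_word[OF range, of X] B.nc_eval_mult_word[OF A(1) range, of X i w]
        by (simp add: MZ_F_def left_mult_def on_carrier_def A(2) comp_map_def fun_eq_iff)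
    qed
  qed (use car X calc A(1) uni \<Phi>_add \<Phi>_scale in auto)
qed

text \<open>An existence claim has to name the types of \<open>E\<close> and \<open>KE\<close>: the
  wandering subspace lives in \<open>'t\<close>, and the copy of \<open>N\<close> in functions into
  \<open>'t\<close>. The second conjunct gives the converse for representations over arbitrary
  types.\<close>

theorem theorem5p2:
  fixes f :: "'n::finite \<Rightarrow> 'n ncseries"
    and B :: "('b::ab_group_add) hilb"
    and K :: "('k::ab_group_add) hilb"
    and MZ :: "'n \<Rightarrow> 'k \<Rightarrow> 'k"
    and H :: "('h::ab_group_add) hilb"
    and KH :: "('t::ab_group_add) hilb"
    and \<tau> :: "'k \<Rightarrow> 'h \<Rightarrow> 't"
    and N :: "'t set"
  assumes "hilbert_space B" and "hseparable B" and "hinfinite_dim B"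
    and "model_space B f K MZ"
    and "hilbert_space H"
    and "hilbert_tensor K H KH \<tau>"
    and "closed_subspace KH N"
  shows "(invariant_under_ampliations K MZ H KH \<tau> N \<longleftrightarrow>
            (\<exists>(E :: 't hilb) (KE :: ('n list \<Rightarrow> 't) hilb) \<sigma> \<Psi>.
               beurling_rep K MZ H KH \<tau> N E KE \<sigma> \<Psi>)) \<and>
         (\<forall>(E :: ('e::ab_group_add) hilb) (KE :: ('s::ab_group_add) hilb) \<sigma> \<Psi>.
            beurling_rep K MZ H KH \<tau> N E KE \<sigma> \<Psi> \<longrightarrow> invariant_under_ampliations K MZ H KH \<tau> N)"
proof -
  note B = assms(1) and model = assms(4)
  have "\<exists>e S. creation_model K MZ e S"
    using model unfolding model_space_def
  proof (elim disjE conjE exE)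
    fix \<iota> assume "model_A f" "H2_A f K \<iota>"
      "\<forall>i. MZ i \<in> bdd_ops K K \<and> (\<forall>p\<in>nc_polys. MZ i (\<iota> p) = \<iota> (nc_mult (nc_var i) p))"
    then show ?thesis by (intro model_A_creation_model) auto
  qed (rule model_S_creation_model model_F_creation_model[OF B], assumption+)+
  then obtain e S where "creation_model K MZ e S" by blast
  then interpret creation_model K MZ e S .
  have "hilbert_space KH" using assms(6) by (simp add: hilbert_tensor_def)
  then interpret tensor_product K H KH \<tau>
    using assms(5,6) K.hilbert_space_axioms by (simp add: tensor_product_def tensor_product_axioms_def)
  note conv = beurling_rep_invariant[of K MZ, OF K.hilbert_space_axioms MZ]
  show ?thesis
  proof (intro conjI iffI allI impI)
    assume inv: "invariant_under_ampliations K MZ H KH \<tau> N"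
    interpret creation_model_invariant K MZ e S H KH \<tau> N
      by unfold_locales (use assms(7) inv in auto)
    show "\<exists>(E :: 't hilb) (KE :: ('n list \<Rightarrow> 't) hilb) \<sigma> \<Psi>. beurling_rep K MZ H KH \<tau> N E KE \<sigma> \<Psi>"
      by (rule beurling_rep_ex)
  qed (auto intro: conv)
qed

end
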